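(* Let $g\in M^*(\mathbb{R}^d)$ with $\|g\|_2=1$. Then for every compact set $\Omega\subset\mathbb{R}^{2d}$ with finite perimeter and $|\Omega|>0$, $$\frac{1}{|\Omega|}\|\rho_\Omega-1_\Omega\|_1\le\frac{1}{|\Omega|}+\|g\|_{M^*}^2\frac{|\partial\Omega|}{|\Omega|}+4\|g\|_{M^*}\sqrt{\frac{|\partial\Omega|}{|\Omega|}}.$$ In particular, there is a constant $C_g>0$ depending only on the window $g$ such that for every compact set $\Omega\subset\mathbb{R}^{2d}$ with finite perimeter and $|\Omega|\ge1$, $$\frac{1}{|\Omega|}\|\rho_\Omega-1_\Omega\|_1\le C_g\sqrt{\frac{|\partial\Omega|}{|\Omega|}}.$$ Here $|\partial\Omega|$ is the perimeter of $\Omega$, $\rho_\Omega$ is the accumulated spectrogram of $\Omega$ with respect to $g$, and $\|\cdot\|_1$ is the norm of $L^1(\mathbb{R}^{2d})$.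
   Context: For $f\in L^2(\mathbb{R}^d)$ and $z=(x,\xi)\in\mathbb{R}^d\times\mathbb{R}^d$, the short-time Fourier transform is $V_gf(x,\xi)=\int_{\mathbb{R}^d}f(t)\overline{g(t-x)}e^{-2\pi i\xi\cdot t}\,dt$. For compact $\Omega\subset\mathbb{R}^{2d}$, the time-frequency localization operator $H_\Omega$ on $L^2(\mathbb{R}^d)$ is $H_\Omega f(t)=\int_\Omega V_gf(x,\xi)g(t-x)e^{2\pi i\xi\cdot t}\,dx\,d\xi$, i.e. $H_\Omega f=V_g^*(1_\Omega\cdot V_gf)$; it is a compact positive operator. Let $\lambda_1^\Omega\ge\lambda_2^\Omega\ge\dots$ be its non-zero eigenvalues, counted with multiplicity and ordered non-increasingly, and $\{h_k^\Omega\}_{k\ge1}$ a corresponding orthonormal set of eigenfunctions. $|\Omega|$ denotes Lebesgue measure and $A_\Omega=\lceil|\Omega|\rceil$ is the smallest integer $\ge|\Omega|$. The accumulated spectrogram of $\Omega$ (with respect to $g$) is $\rho_\Omega(z)=\sum_{k=1}^{A_\Omega}|V_gh_k^\Omega(z)|^2$, $z\in\mathbb{R}^{2d}$. $M^*(\mathbb{R}^d)$ is the class of $g\in L^2(\mathbb{R}^d)$ with $\|g\|_{M^*}^2:=\int_{\mathbb{R}^{2d}}|z|\,|V_gg(z)|^2\,dz<+\infty$ ($|z|$ the Euclidean norm); $\|g\|_{M^*}$ is the non-negative square root. For real-valued $f\in L^1(\mathbb{R}^n)$, $\mathrm{Var}(f)=\sup\{\int_{\mathbb{R}^n}f\,\mathrm{div}\,\phi\,dx:\phi\in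 C_c^1(\mathbb{R}^n,\mathbb{R}^n),\ |\phi(x)|\le1\ \forall x\}$ (Euclidean norm). A set $\Omega\subset\mathbb{R}^{2d}$ has finite perimeter if $1_\Omega$ has bounded variation, and then its perimeter is $|\partial\Omega|:=\mathrm{Var}(1_\Omega)$. *)

theory Defs
  imports "HOL-Analysis.Analysis"
begin

text \<open>
  The space $R^d$ is an arbitrary Euclidean space \<open>'a\<close>, and phase space is \<open>'a \<times> 'a\<close>, whose
  norm is the Euclidean one. Elements of $L^2$ are represented by Lebesgue measurable functions,
  and equality in $L^2$ is equality almost everywhere.
\<close>

definition L2 :: "('a::euclidean_space \<Rightarrow> complex) set" where
  "L2 = {f \<in> borel_measurable lebesgue. integrable lebesgue (\<lambda>t. (cmod (f t))\<^sup>2)}"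

definition L2_inner :: "('a::euclidean_space \<Rightarrow> complex) \<Rightarrow> ('a \<Rightarrow> complex) \<Rightarrow> complex" where
  "L2_inner f h = (\<integral>t. f t * cnj (h t) \<partial>lebesgue)"

definition L2_norm :: "('a::euclidean_space \<Rightarrow> complex) \<Rightarrow> real" where
  "L2_norm f = sqrt (\<integral>t. (cmod (f t))\<^sup>2 \<partial>lebesgue)"

text \<open>The $L^1$ norm is extended-valued, so that it is infinite on non-integrable functions.\<close>

definition L1_norm :: "('b::euclidean_space \<Rightarrow> real) \<Rightarrow> ennreal" where
  "L1_norm F = (\<integral>\<^sup>+z. ennreal \<bar>F z\<bar> \<partial>lebesgue)"

definition stft :: "('a::euclidean_space \<Rightarrow> complex) \<Rightarrow> ('a \<Rightarrow> complex) \<Rightarrow> 'a \<times> 'a \<Rightarrow> complex" where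
  "stft g f = (\<lambda>(x, \<xi>). \<integral>t. f t * cnj (g (t - x)) * cis (- 2 * pi * (\<xi> \<bullet> t)) \<partial>lebesgue)"

text \<open>
  For compact \<open>\<Omega>\<close> and \<open>f\<close>, \<open>g\<close> in $L^2$ the integral converges absolutely for every \<open>t\<close>.
\<close>

definition loc_op ::
    "('a::euclidean_space \<Rightarrow> complex) \<Rightarrow> ('a \<times> 'a) set \<Rightarrow> ('a \<Rightarrow> complex) \<Rightarrow> 'a \<Rightarrow> complex" where
  "loc_op g \<Omega> f t =
    (LINT (x, \<xi>) : \<Omega> | lebesgue. stft g f (x, \<xi>) * g (t - x) * cis (2 * pi * (\<xi> \<bullet> t)))"

text \<open>
  The non-zero eigenvalues of the localization operator, counted with multiplicity and ordered
  non-increasingly, with a corresponding orthonormal set of eigenfunctions. They are indexed by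
  \<open>I\<close>, an initial segment of the positive integers, infinite unless the operator has finite rank.
  The last condition says that every non-zero eigenvalue \<open>\<mu>\<close> is listed with its full multiplicity:
  the functions \<open>h k\<close> with \<open>lam k = \<mu>\<close> span its eigenspace.
\<close>

definition eigensystem ::
    "('a::euclidean_space \<Rightarrow> complex) \<Rightarrow> ('a \<times> 'a) set \<Rightarrow> nat set \<Rightarrow> (nat \<Rightarrow> real) \<Rightarrow>
      (nat \<Rightarrow> 'a \<Rightarrow> complex) \<Rightarrow> bool" where
  "eigensystem g \<Omega> I lam h \<longleftrightarrow>
    (I = {1..} \<or> (\<exists>N. I = {1..N})) \<and>
    (\<forall>k\<in>I. lam k \<noteq> 0) \<and>
    (\<forall>j\<in>I. \<forall>k\<in>I. j \<le> k \<longrightarrow> lam k \<le> lam j) \<and>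
    (\<forall>k\<in>I. h k \<in> L2) \<and>
    (\<forall>j\<in>I. \<forall>k\<in>I. L2_inner (h j) (h k) = (if j = k then 1 else 0)) \<and>
    (\<forall>k\<in>I. AE t in lebesgue. loc_op g \<Omega> (h k) t = complex_of_real (lam k) * h k t) \<and>
    (\<forall>\<mu>::complex. \<forall>f\<in>L2. \<mu> \<noteq> 0 \<longrightarrow> (AE t in lebesgue. loc_op g \<Omega> f t = \<mu> * f t) \<longrightarrow>
      (\<exists>F c. finite F \<and> F \<subseteq> {k\<in>I. complex_of_real (lam k) = \<mu>} \<and>
        (AE t in lebesgue. f t = (\<Sum>k\<in>F. c k * h k t))))"

text \<open>
  The family \<open>h\<close> is a parameter because the sum depends on the choice of eigenfunctions when the
  eigenvalues with indices \<open>nat \<lceil>|\<Omega>|\<rceil>\<close> and \<open>nat \<lceil>|\<Omega>|\<rceil> + 1\<close> coincide. The eigenvalues are at most 1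
  and sum to \<open>|\<Omega>|\<close>, so at least \<open>nat \<lceil>|\<Omega>|\<rceil>\<close> of them are non-zero and only indices in \<open>I\<close> are used.
\<close>

definition accumulated_spectrogram ::
    "('a::euclidean_space \<Rightarrow> complex) \<Rightarrow> ('a \<times> 'a) set \<Rightarrow> (nat \<Rightarrow> 'a \<Rightarrow> complex) \<Rightarrow>
      'a \<times> 'a \<Rightarrow> real" where
  "accumulated_spectrogram g \<Omega> h z =
    (\<Sum>k = 1..nat \<lceil>measure lebesgue \<Omega>\<rceil>. (cmod (stft g (h k) z))\<^sup>2)"

definition Mstar :: "('a::euclidean_space \<Rightarrow> complex) set" where
  "Mstar = {g \<in> L2. integrable lebesgue (\<lambda>z. norm z * (cmod (stft g g z))\<^sup>2)}"

definition Mstar_norm :: "('a::euclidean_space \<Rightarrow> complex) \<Rightarrow> real" where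
  "Mstar_norm g = sqrt (\<integral>z. norm z * (cmod (stft g g z))\<^sup>2 \<partial>lebesgue)"

definition Cc1_fields :: "('b::euclidean_space \<Rightarrow> 'b) set" where
  "Cc1_fields = {\<phi>. (\<forall>x. \<phi> differentiable at x) \<and>
     (\<forall>v. continuous_on UNIV (\<lambda>x. frechet_derivative \<phi> (at x) v)) \<and>
     compact (closure {x. \<phi> x \<noteq> 0})}"

definition divergence :: "('b::euclidean_space \<Rightarrow> 'b) \<Rightarrow> 'b \<Rightarrow> real" where
  "divergence \<phi> x = (\<Sum>i\<in>Basis. frechet_derivative \<phi> (at x) i \<bullet> i)"

definition variation :: "('b::euclidean_space \<Rightarrow> real) \<Rightarrow> ereal" where
  "variation f = (SUP \<phi> \<in> {\<phi> \<in> Cc1_fields. \<forall>x. norm (\<phi> x) \<le> 1}.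
     ereal (\<integral>x. f x * divergence \<phi> x \<partial>lebesgue))"

definition bounded_variation :: "('b::euclidean_space \<Rightarrow> real) \<Rightarrow> bool" where
  "bounded_variation f \<longleftrightarrow> integrable lebesgue f \<and> variation f < \<infinity>"

definition finite_perimeter :: "'b::euclidean_space set \<Rightarrow> bool" where
  "finite_perimeter \<Omega> \<longleftrightarrow> bounded_variation (indicator \<Omega>)"

definition perimeter :: "'b::euclidean_space set \<Rightarrow> real" where
  "perimeter \<Omega> = real_of_ereal (variation (indicator \<Omega>))"

end

theory Submission
  imports Defs "HOL-Probability.Characteristic_Functions" "HOL-Complex_Analysis.Great_Picard"
begin

text \<open>
  Write \<open>V f z = <f, \<pi>(z) g>\<close> for the short-time Fourier transform, \<open>P\<close> for the projection onto the
  first \<open>A\<close> eigenfunctions and \<open>L\<close> for the sum of the first \<open>A\<close> eigenvalues. Since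
  \<open>\<rho>(z) = |P \<pi>(z) g|\<^sup>2\<close> lies between 0 and 1, has integral \<open>A\<close> over phase space and integral \<open>L\<close> over
  \<open>\<Omega>\<close>, the $L^1$ distance of \<open>\<rho>\<close> to the indicator of \<open>\<Omega>\<close> is exactly \<open>(A - |\<Omega>|) + 2 (|\<Omega>| - L)\<close>.

  The min-max principle gives \<open><H \<pi>(z) g, \<pi>(z) g> \<le> (\<Sum>k\<le>A. \<lambda>\<^sub>k |V h\<^sub>k z|\<^sup>2) + \<lambda>\<^sub>A (1 - \<rho>(z))\<close>. Integrated
  over \<open>\<Omega>\<close>, and combined with \<open>\<lambda>\<^sub>A \<le> \<lambda>\<^sub>k \<le> 1\<close> and \<open>|\<Omega>| \<le> A\<close>, it shows that \<open>L\<close> is at least the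
  double integral of \<open>|V g (w - z)|\<^sup>2\<close> over \<open>\<Omega> \<times> \<Omega>\<close>. By Moyal's identity \<open>|\<Omega>| - L\<close> is therefore at
  most the integral of \<open>|V g u|\<^sup>2 |\<Omega> - (\<Omega> - u)|\<close> over \<open>u\<close>, and \<open>|\<Omega> - (\<Omega> - u)| \<le> |u| |\<partial>\<Omega>|\<close>.

  The same translation estimate, averaged over a ball of volume at least \<open>2 |\<Omega>|\<close>, bounds the
  perimeter below when \<open>|\<Omega>| \<ge> 1\<close>, which absorbs the term \<open>1 / |\<Omega>|\<close>.
\<close>

section \<open>Square-integrable functions\<close>

text \<open>The proof takes no spectral theorem as given. \<open>eigensystem\<close> only says that
  each non-zero eigenspace is spanned by listed functions, so the form of \<open>H\<close> on the
  complement of the first eigenfunctions is bounded by producing an eigenfunction there: were the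
  form too large, its supremum would be attained, at an eigenfunction outside the span that the list
  allows. Attainment rests on equicontinuity of the transforms of unit vectors over the compact set
  \<Omega>. The same bound with remainder 0 shows that a finite list has at least \<open>A\<close>
  members, so \<open>lam A\<close> makes sense. The mass \<open>E\<close> that leaks out of \<Omega>
  is bounded both by |\<Omega>| and by the squared \<open>Mstar_norm\<close> times the perimeter;
  the geometric mean of these two bounds is the source of the square root in the theorem. Moyal's
  identity is reached through Gaussian weights in frequency. For a fixed position the product of
  \<open>f\<close> with the translated window is always integrable, but square-integrable only at
  almost every position.\<close>

text \<open>
  Up to the last section functions are Borel measurable and integrals are over \<open>lborel\<close>: unlike
  the completed measure \<open>lebesgue\<close>, it is compatible with products.
\<close>

definition L2_of :: "'b measure \<Rightarrow> ('b \<Rightarrow> complex) set" where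
  "L2_of M = {f \<in> borel_measurable M. integrable M (\<lambda>x. (cmod (f x))\<^sup>2)}"

text \<open>The measure is a parameter because two kinds of Hilbert space occur: functions under
  \<open>lborel\<close>, and functions on phase space under \<open>lborel\<close> restricted to
  \<Omega>.\<close>

definition L2_ip :: "'b measure \<Rightarrow> ('b \<Rightarrow> complex) \<Rightarrow> ('b \<Rightarrow> complex) \<Rightarrow> complex" where
  "L2_ip M f h = (\<integral>x. f x * cnj (h x) \<partial>M)"

definition L2_sq :: "'b measure \<Rightarrow> ('b \<Rightarrow> complex) \<Rightarrow> real" where
  "L2_sq M f = (\<integral>x. (cmod (f x))\<^sup>2 \<partial>M)"

lemma borel_measurable_cnj [measurable]: "cnj \<in> borel_measurable borel"
  by (intro borel_measurable_continuous_onI continuous_intros)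

lemma L2_of_measurable [measurable_dest]: "f \<in> L2_of M \<Longrightarrow> f \<in> borel_measurable M"
  by (simp add: L2_of_def)

lemma L2_of_integrable: "f \<in> L2_of M \<Longrightarrow> integrable M (\<lambda>x. (cmod (f x))\<^sup>2)"
  by (simp add: L2_of_def)

lemma L2_sq_nonneg: "0 \<le> L2_sq M f"
  by (simp add: L2_sq_def)

lemma ennreal_L2_sq: "f \<in> L2_of M \<Longrightarrow> (\<integral>\<^sup>+x. ennreal ((cmod (f x))\<^sup>2) \<partial>M) = ennreal (L2_sq M f)"
  unfolding L2_sq_def by (rule nn_integral_eq_integral) (auto simp: L2_of_integrable)

lemma L2_of_integrable_norm_mult:
  assumes [measurable]: "f \<in> L2_of M" "h \<in> L2_of M"
  shows "integrable M (\<lambda>x. cmod (f x) * cmod (h x))"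
proof (rule Bochner_Integration.integrable_bound)
  show "integrable M (\<lambda>x. (cmod (f x))\<^sup>2 + (cmod (h x))\<^sup>2)"
    using assms by (intro Bochner_Integration.integrable_add L2_of_integrable)
  have "a * b \<le> a\<^sup>2 + b\<^sup>2" for a b :: real
    using sum_squares_bound[of a b] zero_le_power2[of a] zero_le_power2[of b]
      zero_le_power2[of "a + b"] by (simp add: power2_sum)
  then show "AE x in M. norm (cmod (f x) * cmod (h x)) \<le> norm ((cmod (f x))\<^sup>2 + (cmod (h x))\<^sup>2)"
    by (auto simp: abs_mult)
qed measurable

lemma L2_of_integrable_mult:
  assumes [measurable]: "f \<in> L2_of M" "h \<in> L2_of M"
  shows "integrable M (\<lambda>x. f x * cnj (h x))"
  using L2_of_integrable_norm_mult[OF assms]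
  by (rule Bochner_Integration.integrable_bound) (auto simp: norm_mult abs_mult)

lemma L2_of_add [intro]:
  assumes [measurable]: "f \<in> L2_of M" "h \<in> L2_of M"
  shows "(\<lambda>x. f x + h x) \<in> L2_of M"
proof -
  have "integrable M (\<lambda>x. (cmod (f x + h x))\<^sup>2)"
  proof (rule Bochner_Integration.integrable_bound)
    show "integrable M (\<lambda>x. 2 * (cmod (f x))\<^sup>2 + 2 * (cmod (h x))\<^sup>2)"
      using assms by (intro Bochner_Integration.integrable_add integrable_mult_right L2_of_integrable)
    have "(cmod (a + b))\<^sup>2 \<le> 2 * (cmod a)\<^sup>2 + 2 * (cmod b)\<^sup>2" for a b
    proof -
      have "(cmod (a + b))\<^sup>2 \<le> (cmod a + cmod b)\<^sup>2"
        by (intro power_mono norm_triangle_ineq) auto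
      also have "\<dots> \<le> 2 * (cmod a)\<^sup>2 + 2 * (cmod b)\<^sup>2"
        using sum_squares_bound[of "cmod a" "cmod b"] by (simp add: power2_sum)
      finally show ?thesis .
    qed
    then show "AE x in M. norm ((cmod (f x + h x))\<^sup>2) \<le> norm (2 * (cmod (f x))\<^sup>2 + 2 * (cmod (h x))\<^sup>2)"
      by auto
  qed measurable
  then show ?thesis by (simp add: L2_of_def)
qed

lemma L2_of_cmult [intro]: "f \<in> L2_of M \<Longrightarrow> (\<lambda>x. c * f x) \<in> L2_of M"
  by (auto simp: L2_of_def norm_mult power_mult_distrib)

lemma L2_of_diff [intro]: "f \<in> L2_of M \<Longrightarrow> h \<in> L2_of M \<Longrightarrow> (\<lambda>x. f x - h x) \<in> L2_of M"
  using L2_of_add[of f M "\<lambda>x. (-1) * h x"] L2_of_cmult[of h M "-1"] by simp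

lemma L2_of_zero [simp]: "(\<lambda>x. 0) \<in> L2_of M"
  by (simp add: L2_of_def)

lemma L2_of_sum [intro]: "(\<And>i. i \<in> F \<Longrightarrow> f i \<in> L2_of M) \<Longrightarrow> (\<lambda>x. \<Sum>i\<in>F. f i x) \<in> L2_of M"
  by (induction F rule: infinite_finite_induct) auto

lemma L2_ip_self: "L2_ip M f f = complex_of_real (L2_sq M f)"
  unfolding L2_ip_def L2_sq_def by (subst integral_complex_of_real[symmetric]) (simp add: complex_norm_square del: of_real_power)

lemma L2_ip_cnj: "cnj (L2_ip M f h) = L2_ip M h f"
  unfolding L2_ip_def by (simp add: mult.commute flip: Bochner_Integration.integral_cnj)

lemma L2_ip_add_left: "f \<in> L2_of M \<Longrightarrow> f' \<in> L2_of M \<Longrightarrow> h \<in> L2_of M \<Longrightarrow>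
    L2_ip M (\<lambda>x. f x + f' x) h = L2_ip M f h + L2_ip M f' h"
  unfolding L2_ip_def by (simp add: ring_distribs L2_of_integrable_mult)

lemma L2_ip_cmult_left: "L2_ip M (\<lambda>x. c * f x) h = c * L2_ip M f h"
  unfolding L2_ip_def by (simp add: mult.assoc)

lemma L2_ip_diff_left: "f \<in> L2_of M \<Longrightarrow> f' \<in> L2_of M \<Longrightarrow> h \<in> L2_of M \<Longrightarrow>
    L2_ip M (\<lambda>x. f x - f' x) h = L2_ip M f h - L2_ip M f' h"
  unfolding L2_ip_def by (simp add: ring_distribs L2_of_integrable_mult)

lemma L2_ip_sum_left: "(\<And>i. i \<in> F \<Longrightarrow> f i \<in> L2_of M) \<Longrightarrow> h \<in> L2_of M \<Longrightarrow>
    L2_ip M (\<lambda>x. \<Sum>i\<in>F. f i x) h = (\<Sum>i\<in>F. L2_ip M (f i) h)"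
  unfolding L2_ip_def by (simp add: sum_distrib_right L2_of_integrable_mult)

lemma L2_ip_cong_AE:
  assumes "AE x in M. f x = f' x" "AE x in M. h x = h' x"
    and [measurable]: "f \<in> borel_measurable M" "f' \<in> borel_measurable M"
      "h \<in> borel_measurable M" "h' \<in> borel_measurable M"
  shows "L2_ip M f h = L2_ip M f' h'"
  unfolding L2_ip_def using assms(1,2) by (intro integral_cong_AE) auto

lemma L2_ip_add_right: "f \<in> L2_of M \<Longrightarrow> f' \<in> L2_of M \<Longrightarrow> h \<in> L2_of M \<Longrightarrow>
    L2_ip M h (\<lambda>x. f x + f' x) = L2_ip M h f + L2_ip M h f'"
  unfolding L2_ip_def by (simp add: ring_distribs L2_of_integrable_mult)

lemma L2_ip_cmult_right: "L2_ip M h (\<lambda>x. c * f x) = cnj c * L2_ip M h f"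
  unfolding L2_ip_def by (simp add: mult.assoc mult.left_commute)

lemma L2_ip_diff_right: "f \<in> L2_of M \<Longrightarrow> f' \<in> L2_of M \<Longrightarrow> h \<in> L2_of M \<Longrightarrow>
    L2_ip M h (\<lambda>x. f x - f' x) = L2_ip M h f - L2_ip M h f'"
  unfolding L2_ip_def by (simp add: ring_distribs L2_of_integrable_mult)

lemma L2_sq_cmult: "L2_sq M (\<lambda>x. c * f x) = (cmod c)\<^sup>2 * L2_sq M f"
  by (simp add: L2_sq_def norm_mult power_mult_distrib)

lemma L2_sq_add:
  assumes "f \<in> L2_of M" "h \<in> L2_of M"
  shows "L2_sq M (\<lambda>x. f x + h x) = L2_sq M f + 2 * Re (L2_ip M f h) + L2_sq M h"
proof -
  have "complex_of_real (L2_sq M (\<lambda>x. f x + h x)) = L2_ip M f f + L2_ip M f h + (cnj (L2_ip M f h) + L2_ip M h h)"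
    unfolding L2_ip_self[symmetric] using assms
    by (simp add: L2_ip_add_left L2_ip_add_right L2_ip_cnj L2_of_add)
  then have "Re (complex_of_real (L2_sq M (\<lambda>x. f x + h x))) = Re (L2_ip M f f + L2_ip M f h + (cnj (L2_ip M f h) + L2_ip M h h))"
    by simp
  then show ?thesis by (simp add: L2_ip_self)
qed

lemma L2_sq_diff:
  assumes "f \<in> L2_of M" "h \<in> L2_of M"
  shows "L2_sq M (\<lambda>x. f x - h x) = L2_sq M f - 2 * Re (L2_ip M f h) + L2_sq M h"
proof -
  have "L2_sq M (\<lambda>x. f x + (-1) * h x) = L2_sq M f + 2 * Re (L2_ip M f (\<lambda>x. (-1) * h x)) + L2_sq M (\<lambda>x. (-1) * h x)"
    using assms by (intro L2_sq_add L2_of_cmult)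
  then show ?thesis unfolding L2_ip_cmult_right L2_sq_cmult by simp
qed

lemma L2_sq_add_le:
  assumes "f \<in> L2_of M" "h \<in> L2_of M"
  shows "L2_sq M (\<lambda>x. f x + h x) \<le> 2 * L2_sq M f + 2 * L2_sq M h"
  using L2_sq_add[OF assms] L2_sq_diff[OF assms] L2_sq_nonneg[of M "\<lambda>x. f x - h x"] by simp

lemma L2_sq_eq_0_iff: "f \<in> L2_of M \<Longrightarrow> L2_sq M f = 0 \<longleftrightarrow> (AE x in M. f x = 0)"
  unfolding L2_sq_def using integral_nonneg_eq_0_iff_AE[OF L2_of_integrable, of f M] by simp

lemma L2_ip_Cauchy_Schwarz:
  assumes f: "f \<in> L2_of M" and h: "h \<in> L2_of M"
  shows "(cmod (L2_ip M f h))\<^sup>2 \<le> L2_sq M f * L2_sq M h"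
proof (cases "L2_sq M h = 0")
  case True
  then have "AE x in M. h x = 0" using h L2_sq_eq_0_iff by blast
  then have "L2_ip M f h = 0" unfolding L2_ip_def
    by (intro integral_eq_zero_AE) auto
  then show ?thesis by (simp add: L2_sq_nonneg)
next
  case False
  then have pos: "L2_sq M h > 0" using L2_sq_nonneg[of M h] by simp
  \<comment> \<open>\<open>c * h\<close> is the orthogonal projection of \<open>f\<close> onto the
    line of \<open>h\<close>; the inequality is non-negativity of the squared distance to
    it.\<close>
  define c where "c = L2_ip M f h / L2_sq M h"
  have "Re (cnj c * L2_ip M f h) = (cmod (L2_ip M f h))\<^sup>2 / L2_sq M h"
  proof -
    have "cnj c * L2_ip M f h = complex_of_real ((cmod (L2_ip M f h))\<^sup>2 / L2_sq M h)"
      unfolding c_def by (simp add: complex_norm_square mult.commute del: of_real_power)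
    then show ?thesis by simp
  qed
  moreover have "(cmod c)\<^sup>2 * L2_sq M h = (cmod (L2_ip M f h))\<^sup>2 / L2_sq M h"
    unfolding c_def using pos by (simp add: norm_divide power_divide power2_eq_square)
  moreover have "0 \<le> L2_sq M f - 2 * Re (cnj c * L2_ip M f h) + (cmod c)\<^sup>2 * L2_sq M h"
    using L2_sq_diff[OF f L2_of_cmult[OF h, of c]] L2_sq_nonneg[of M "\<lambda>x. f x - c * h x"]
    by (simp add: L2_ip_cmult_right L2_sq_cmult)
  ultimately have "(cmod (L2_ip M f h))\<^sup>2 / L2_sq M h \<le> L2_sq M f" by simp
  then show ?thesis using pos by (simp add: pos_divide_le_eq)
qed

lemma integral_norm_mult_le:
  assumes f: "f \<in> L2_of M" and h: "h \<in> L2_of M"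
  shows "(\<integral>x. cmod (f x) * cmod (h x) \<partial>M)\<^sup>2 \<le> L2_sq M f * L2_sq M h"
proof -
  have [measurable]: "f \<in> borel_measurable M" "h \<in> borel_measurable M" using f h by measurable
  have 1: "(\<lambda>x. complex_of_real (cmod (f x))) \<in> L2_of M" "(\<lambda>x. complex_of_real (cmod (h x))) \<in> L2_of M"
    using f h by (auto simp: L2_of_def)
  have "L2_ip M (\<lambda>x. complex_of_real (cmod (f x))) (\<lambda>x. complex_of_real (cmod (h x)))
     = complex_of_real (\<integral>x. cmod (f x) * cmod (h x) \<partial>M)"
    unfolding L2_ip_def by (subst integral_complex_of_real[symmetric]) simp
  then show ?thesis using L2_ip_Cauchy_Schwarz[OF 1] by (simp add: L2_sq_def)
qed

abbreviation L2B :: "('a::euclidean_space \<Rightarrow> complex) set" where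
  "L2B \<equiv> L2_of lborel"

abbreviation ip :: "('a::euclidean_space \<Rightarrow> complex) \<Rightarrow> ('a \<Rightarrow> complex) \<Rightarrow> complex" where
  "ip \<equiv> L2_ip lborel"

abbreviation nsq :: "('a::euclidean_space \<Rightarrow> complex) \<Rightarrow> real" where
  "nsq \<equiv> L2_sq lborel"

section \<open>Fourier transforms of Gaussians\<close>

text \<open>\<open>lborel\<close> on a Euclidean space is the image of a product of one-dimensional
  Lebesgue measures under the coordinate map, so products of one-variable functions integrate factor
  by factor.\<close>

lemma integral_lborel_prod:
  fixes f :: "'a::euclidean_space \<Rightarrow> real \<Rightarrow> complex"
  assumes f: "\<And>b. b \<in> Basis \<Longrightarrow> integrable lborel (f b)"
  shows "integrable lborel (\<lambda>x::'a. \<Prod>b\<in>Basis. f b (x \<bullet> b))"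
    and "(\<integral>x. (\<Prod>b\<in>Basis. f b (x \<bullet> b)) \<partial>(lborel::'a measure)) = (\<Prod>b\<in>Basis. \<integral>s. f b s \<partial>lborel)"
proof -
  interpret product_sigma_finite "\<lambda>_::'a. lborel :: real measure" ..
  have [measurable]: "f b \<in> borel_measurable borel" if "b \<in> Basis" for b
    using borel_measurable_integrable[OF f[OF that]] by simp
  have m: "(\<lambda>x::'a. \<Prod>b\<in>Basis. f b (x \<bullet> b)) \<in> borel_measurable borel"
    by (intro borel_measurable_prod) measurable
  have eq: "(\<Prod>b\<in>Basis. f b ((\<Sum>c\<in>Basis. x c *\<^sub>R c) \<bullet> b)) = (\<Prod>b\<in>Basis. f b (x b))" for x :: "'a \<Rightarrow> real"
    by (intro prod.cong) auto
  have meas: "(\<lambda>x. \<Sum>b\<in>Basis. x b *\<^sub>R b) \<in> (\<Pi>\<^sub>M b\<in>Basis. lborel) \<rightarrow>\<^sub>M (borel :: 'a measure)"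
    by measurable
  show "integrable lborel (\<lambda>x::'a. \<Prod>b\<in>Basis. f b (x \<bullet> b))"
    unfolding lborel_eq[where 'a='a]
    by (subst integrable_distr_eq[OF meas m], unfold eq)
      (intro product_integrable_prod finite_Basis f)
  show "(\<integral>x. (\<Prod>b\<in>Basis. f b (x \<bullet> b)) \<partial>(lborel::'a measure)) = (\<Prod>b\<in>Basis. \<integral>s. f b s \<partial>lborel)"
    unfolding lborel_eq[where 'a='a]
    by (subst integral_distr[OF meas m], unfold eq)
      (intro product_integral_prod finite_Basis f)
qed

lemma borel_measurable_cis [measurable]: "cis \<in> borel_measurable borel"
  by (intro borel_measurable_continuous_onI continuous_intros)

definition gauss :: "'a::euclidean_space \<Rightarrow> real" where
  "gauss x = (\<Prod>b\<in>Basis. std_normal_density (x \<bullet> b))"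

lemma gauss_measurable [measurable]: "gauss \<in> borel_measurable borel"
  unfolding gauss_def by measurable

lemma gauss_nonneg: "0 \<le> gauss x"
  unfolding gauss_def by (intro prod_nonneg) (auto simp: normal_density_nonneg)

lemma gauss_eq:
  "gauss (x::'a::euclidean_space) = (1 / sqrt (2 * pi)) ^ DIM('a) * exp (- (norm x)\<^sup>2 / 2)"
proof -
  have "(norm x)\<^sup>2 = (\<Sum>b\<in>Basis. (x \<bullet> b)\<^sup>2)"
    unfolding power2_norm_eq_inner euclidean_inner[of x x] by (simp only: power2_eq_square)
  then have "(\<Sum>b\<in>Basis. - (x \<bullet> b)\<^sup>2 / 2) = - (norm x)\<^sup>2 / 2"
    by (simp add: sum_negf sum_divide_distrib)
  then show ?thesis
    unfolding gauss_def std_normal_density_def prod.distrib exp_sum[OF finite_Basis, symmetric]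
    by simp
qed

text \<open>The integral is the characteristic function of the standard normal law at
  \<open>v\<close>.\<close>

lemma fourier_std_normal_density:
  "integrable lborel (\<lambda>s. complex_of_real (std_normal_density s) * cis (v * s))"
  "(LBINT s. complex_of_real (std_normal_density s) * cis (v * s)) = exp (- v\<^sup>2 / 2)"
proof -
  show "integrable lborel (\<lambda>s. complex_of_real (std_normal_density s) * cis (v * s))"
    by (rule Bochner_Integration.integrable_bound[OF integrable_normal_density[of 1 0]])
      (auto simp: norm_mult)
  have "(LBINT s. complex_of_real (std_normal_density s) * cis (v * s))
    = (CLINT s|std_normal_distribution. iexp (v * s))"
    by (subst integral_density) (auto simp: cis_conv_exp scaleR_conv_of_real)
  also have "\<dots> = char std_normal_distribution v"
    by (simp add: char_def)
  finally show "(LBINT s. complex_of_real (std_normal_density s) * cis (v * s)) = exp (- v\<^sup>2 / 2)"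
    by (simp add: char_std_normal_distribution)
qed

lemma cis_sum: "finite A \<Longrightarrow> cis (sum f A) = (\<Prod>a\<in>A. cis (f a))"
  by (induction A rule: finite_induct) (auto simp: cis_mult[symmetric])

lemma fourier_gauss:
  fixes v :: "'a::euclidean_space"
  shows "(LBINT x. complex_of_real (gauss x) * cis (v \<bullet> x)) = exp (- (norm v)\<^sup>2 / 2)"
    and "integrable lborel (\<lambda>x. complex_of_real (gauss x) * cis (v \<bullet> x))"
proof -
  have eq: "complex_of_real (gauss x) * cis (v \<bullet> x)
      = (\<Prod>b\<in>Basis. complex_of_real (std_normal_density (x \<bullet> b)) * cis ((v \<bullet> b) * (x \<bullet> b)))" for x
    unfolding gauss_def euclidean_inner[of v x] by (simp add: prod.distrib cis_sum)
  show "integrable lborel (\<lambda>x. complex_of_real (gauss x) * cis (v \<bullet> x))"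
    unfolding eq by (intro integral_lborel_prod fourier_std_normal_density)
  have "(norm v)\<^sup>2 = (\<Sum>b\<in>Basis. (v \<bullet> b)\<^sup>2)"
    unfolding power2_norm_eq_inner euclidean_inner[of v v] by (simp only: power2_eq_square)
  then show "(LBINT x. complex_of_real (gauss x) * cis (v \<bullet> x)) = exp (- (norm v)\<^sup>2 / 2)"
    unfolding eq
    by (subst integral_lborel_prod) (simp_all add: fourier_std_normal_density exp_sum[symmetric]
        sum_negf sum_divide_distrib[symmetric] del: of_real_exp flip: of_real_prod)
qed

lemma integrable_gauss: "integrable lborel (gauss :: 'a::euclidean_space \<Rightarrow> real)"
proof -
  have "integrable lborel (\<lambda>x::'a. complex_of_real (gauss x))"
    using fourier_gauss(2)[of "0::'a"] by simp
  then show ?thesis using complex_of_real_integrable_eq by blast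
qed

lemma integral_gauss: "(\<integral>x. gauss x \<partial>(lborel :: 'a::euclidean_space measure)) = 1"
proof -
  have "complex_of_real (\<integral>x. gauss x \<partial>(lborel :: 'a measure)) = 1"
    using fourier_gauss(1)[of "0::'a"] by simp
  then show ?thesis by simp
qed

section \<open>Translations in $L^1$ and $L^2$\<close>

lemma lborel_distr_diff: "distr lborel borel (\<lambda>x::'a::euclidean_space. x - h) = lborel"
  using lborel_distr_plus[of "- h"] by (simp add: algebra_simps cong: distr_cong)

lemma lborel_distr_reflect: "distr lborel borel (\<lambda>x::'a::euclidean_space. h - x) = lborel"
  using lborel_affine[of "-1" h] by (simp add: density_1)

lemma
  fixes f :: "'a::euclidean_space \<Rightarrow> 'b::{banach,second_countable_topology}"
  assumes [measurable]: "f \<in> borel_measurable borel"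
  shows integral_translate: "(LBINT x. f (x - h)) = (LBINT x. f x)"
    and integral_reflect: "(LBINT x. f (h - x)) = (LBINT x. f x)"
    and integrable_translate: "integrable lborel (\<lambda>x. f (x - h)) \<longleftrightarrow> integrable lborel f"
proof -
  show "(LBINT x. f (x - h)) = (LBINT x. f x)"
    by (subst (2) lborel_distr_diff[of h, symmetric], subst integral_distr) auto
  show "(LBINT x. f (h - x)) = (LBINT x. f x)"
    by (subst (2) lborel_distr_reflect[of h, symmetric], subst integral_distr) auto
  show "integrable lborel (\<lambda>x. f (x - h)) \<longleftrightarrow> integrable lborel f"
    by (subst (2) lborel_distr_diff[of h, symmetric], subst integrable_distr_eq) auto
qed

lemma
  fixes f :: "'a::euclidean_space \<Rightarrow> ennreal"
  assumes [measurable]: "f \<in> borel_measurable borel"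
  shows nn_integral_translate: "(\<integral>\<^sup>+x. f (x - h) \<partial>lborel) = (\<integral>\<^sup>+x. f x \<partial>lborel)"
    and nn_integral_reflect: "(\<integral>\<^sup>+x. f (h - x) \<partial>lborel) = (\<integral>\<^sup>+x. f x \<partial>lborel)"
proof -
  show "(\<integral>\<^sup>+x. f (x - h) \<partial>lborel) = (\<integral>\<^sup>+x. f x \<partial>lborel)"
    by (subst (2) lborel_distr_diff[of h, symmetric], subst nn_integral_distr) auto
  show "(\<integral>\<^sup>+x. f (h - x) \<partial>lborel) = (\<integral>\<^sup>+x. f x \<partial>lborel)"
    by (subst (2) lborel_distr_reflect[of h, symmetric], subst nn_integral_distr) auto
qed

lemma emeasure_translate:
  fixes A :: "'a::euclidean_space set"
  assumes [measurable]: "A \<in> sets borel"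
  shows "emeasure lborel {x. x - h \<in> A} = emeasure lborel A"
proof -
  have "emeasure lborel A = emeasure (distr lborel borel (\<lambda>x. x - h)) A"
    by (simp add: lborel_distr_diff)
  also have "\<dots> = emeasure lborel {x. x - h \<in> A}"
    by (subst emeasure_distr) (auto simp: vimage_def)
  finally show ?thesis by simp
qed

text \<open>A point of an open set stays in it under small translations, which gives pointwise
  convergence; the indicator of \<open>T\<close> dominates.\<close>

lemma open_translate_tendsto:
  fixes T :: "'a::euclidean_space set"
  assumes T: "open T" "emeasure lborel T < \<infinity>" and h: "h \<longlonglongrightarrow> 0"
  shows "(\<lambda>n. measure lborel (T - {x. x - h n \<in> T})) \<longlonglongrightarrow> 0"
proof -
  have [measurable]: "T \<in> sets borel" using T by auto
  have "(\<lambda>n. \<integral>x. indicat_real (T - {x. x - h n \<in> T}) x \<partial>lborel) \<longlonglongrightarrow> (\<integral>x. 0 \<partial>(lborel::'a measure))"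
  proof (rule integral_dominated_convergence[where w="indicat_real T"])
    show "integrable lborel (indicat_real T)" using T by (intro integrable_real_indicator) auto
    show "AE x in lborel. (\<lambda>n. indicat_real (T - {x. x - h n \<in> T}) x) \<longlonglongrightarrow> 0"
    proof (rule AE_I2)
      fix x
      show "(\<lambda>n. indicat_real (T - {x. x - h n \<in> T}) x) \<longlonglongrightarrow> 0"
      proof (cases "x \<in> T")
        case True
        have "(\<lambda>n. x - h n) \<longlonglongrightarrow> x - 0" by (intro tendsto_intros h)
        then have "\<forall>\<^sub>F n in sequentially. x - h n \<in> T"
          using T(1) True by (simp add: topological_tendstoD)
        then show ?thesis
          by (intro tendsto_eventually) (auto elim!: eventually_mono)
      qed auto
    qed
  qed (auto simp: indicator_def intro!: AE_I2)
  then show ?thesis by (simp add: Diff_eq vimage_def)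
qed

text \<open>Outer regularity reduces to an open \<open>T\<close> around \<open>A\<close>: if a point
  of \<open>A\<close> is translated out of \<open>A\<close>, its translate lies outside
  \<open>T\<close> or in the small set \<open>T - A\<close>.\<close>

lemma indicator_translate_tendsto:
  fixes A :: "'a::euclidean_space set"
  assumes [measurable]: "A \<in> sets borel" and fin: "emeasure lborel A < \<infinity>" and h: "h \<longlonglongrightarrow> 0"
  shows "(\<lambda>n. measure lborel (A - {x. x - h n \<in> A})) \<longlonglongrightarrow> 0"
proof (rule LIMSEQ_I)
  fix e :: real assume e: "0 < e"
  obtain T where T: "open T" "A \<subseteq> T" "emeasure lborel (T - A) < ennreal (e/2)"
    using outer_regular_lborel[of A "e/2"] e by auto
  have [measurable]: "T \<in> sets borel" using T by auto
  have "T = A \<union> (T - A)" using T by auto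
  then have "emeasure lborel T \<le> emeasure lborel A + emeasure lborel (T - A)"
    using emeasure_subadditive[of A lborel "T - A"] by simp
  also have "\<dots> < \<infinity>" using fin T(3) by (auto simp: less_top[symmetric] top_unique)
  finally have Tf: "emeasure lborel T < \<infinity>" .
  obtain N where N: "\<And>n. n \<ge> N \<Longrightarrow> \<bar>measure lborel (T - {x. x - h n \<in> T})\<bar> < e/2"
    using LIMSEQ_D[OF open_translate_tendsto[OF T(1) Tf h], of "e/2"] e by auto
  have "measure lborel (A - {x. x - h n \<in> A}) < e" if "n \<ge> N" for n
  proof -
    have 1: "emeasure lborel {x. x - h n \<in> T - A} = emeasure lborel (T - A)"
      by (intro emeasure_translate) auto
    have sub: "A - {x. x - h n \<in> A} \<subseteq> (T - {x. x - h n \<in> T}) \<union> {x. x - h n \<in> T - A}"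
      using T by auto
    have m1: "T - {x. x - h n \<in> T} \<in> fmeasurable lborel"
      by (rule fmeasurableI2[of T]) (use Tf in \<open>auto intro: fmeasurableI\<close>)
    have m2: "{x. x - h n \<in> T - A} \<in> fmeasurable lborel"
      by (rule fmeasurableI) (use 1 T(3) in \<open>auto simp: less_top[symmetric] top_unique\<close>)
    have "measure lborel (A - {x. x - h n \<in> A}) \<le> measure lborel ((T - {x. x - h n \<in> T}) \<union> {x. x - h n \<in> T - A})"
      by (rule measure_mono_fmeasurable[OF sub]) (use m1 m2 in auto)
    also have "\<dots> \<le> measure lborel (T - {x. x - h n \<in> T}) + measure lborel {x. x - h n \<in> T - A}"
      using m1 m2 by (intro measure_Un_le) auto
    also have "measure lborel {x. x - h n \<in> T - A} < e/2"
    proof -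
      have "ennreal (measure lborel {x. x - h n \<in> T - A}) < ennreal (e/2)"
        using emeasure_eq_measure2[OF m2] 1 T(3) by simp
      then show ?thesis by (subst (asm) ennreal_less_iff) auto
    qed
    finally show ?thesis using N[OF that] by simp
  qed
  then show "\<exists>N. \<forall>n\<ge>N. norm (measure lborel (A - {x. x - h n \<in> A}) - 0) < e"
    by auto
qed

text \<open>Approximation by simple functions. Symmetric differences of a set and its translate
  settle the indicators, and translation invariance of the L1 distance carries the claim to
  limits.\<close>

lemma L1_translate_tendsto:
  fixes f :: "'a::euclidean_space \<Rightarrow> complex"
  assumes f: "integrable lborel f" and h: "h \<longlonglongrightarrow> 0"
  shows "(\<lambda>n. \<integral>x. cmod (f (x - h n) - f x) \<partial>lborel) \<longlonglongrightarrow> 0"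
  using f
proof (induction rule: integrable_induct)
  case (base A c)
  have [measurable]: "A \<in> sets borel" using base by simp
  have neg: "(\<lambda>n. - h n) \<longlonglongrightarrow> 0" using tendsto_minus[OF h] by simp
  have eq: "(LBINT x. cmod (indicator A (x - h n) *\<^sub>R c - indicator A x *\<^sub>R c))
      = cmod c * (measure lborel (A - {x. x - - h n \<in> A}) + measure lborel (A - {x. x - h n \<in> A}))" for n
  proof -
    have fm: "B \<in> fmeasurable lborel" if "B \<in> sets borel" "B \<subseteq> A" for B
      by (rule fmeasurableI2[of A]) (use base that in \<open>auto intro: fmeasurableI\<close>)
    have fm': "{x. x - h n \<in> A - {x. x - - h n \<in> A}} \<in> fmeasurable lborel"
      using fm[of "A - {x. x - - h n \<in> A}"]
      by (intro fmeasurableI) (auto simp: emeasure_translate fmeasurable_def simp del: Diff_iff)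
    \<comment> \<open>The symmetric difference is cut into \<open>A\<close> minus its translate and
      a translate of \<open>A\<close> minus its opposite translate, so that the one-sided lemma
      serves for both.\<close>
    have "cmod (indicator A (x - h n) *\<^sub>R c - indicator A x *\<^sub>R c)
      = cmod c * (indicat_real {x. x - h n \<in> A - {x. x - - h n \<in> A}} x + indicat_real (A - {x. x - h n \<in> A}) x)" for x
      by (auto simp: indicator_def)
    then have "(LBINT x. cmod (indicator A (x - h n) *\<^sub>R c - indicator A x *\<^sub>R c))
      = cmod c * (measure lborel {x. x - h n \<in> A - {x. x - - h n \<in> A}} + measure lborel (A - {x. x - h n \<in> A}))"
      using fm' fm[of "A - {x. x - h n \<in> A}"]
      by (simp add: fmeasurable_def) 
    also have "measure lborel {x. x - h n \<in> A - {x. x - - h n \<in> A}} = measure lborel (A - {x. x - - h n \<in> A})"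
      unfolding measure_def by (subst emeasure_translate) auto
    finally show ?thesis .
  qed
  have "(\<lambda>n. cmod c * (measure lborel (A - {x. x - - h n \<in> A}) + measure lborel (A - {x. x - h n \<in> A}))) \<longlonglongrightarrow> cmod c * (0 + 0)"
    using base h neg by (intro tendsto_intros indicator_translate_tendsto) auto
  then show ?case unfolding eq by simp
next
  case (add f g)
  have [measurable]: "f \<in> borel_measurable borel" "g \<in> borel_measurable borel"
    using add by (auto dest: borel_measurable_integrable)
  have int: "integrable lborel (\<lambda>x. cmod (f (x - h n) - f x))" "integrable lborel (\<lambda>x. cmod (g (x - h n) - g x))" for n
    using add by (auto simp: integrable_translate intro!: integrable_norm Bochner_Integration.integrable_diff)
  show ?case
  proof (rule tendsto_sandwich[OF _ _ tendsto_const])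
    show "\<forall>\<^sub>F n in sequentially. (LBINT x. cmod (f (x - h n) + g (x - h n) - (f x + g x)))
      \<le> (LBINT x. cmod (f (x - h n) - f x)) + (LBINT x. cmod (g (x - h n) - g x))"
    proof (rule always_eventually, rule allI)
      fix n
      have "(LBINT x. cmod (f (x - h n) + g (x - h n) - (f x + g x)))
        \<le> (LBINT x. cmod (f (x - h n) - f x) + cmod (g (x - h n) - g x))"
        using add int by (intro integral_mono)
          (auto simp: integrable_translate norm_diff_triangle_ineq intro!: integrable_norm Bochner_Integration.integrable_diff Bochner_Integration.integrable_add)
      then show "(LBINT x. cmod (f (x - h n) + g (x - h n) - (f x + g x)))
      \<le> (LBINT x. cmod (f (x - h n) - f x)) + (LBINT x. cmod (g (x - h n) - g x))"
        using int by simp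
    qed
    show "(\<lambda>n. (LBINT x. cmod (f (x - h n) - f x)) + (LBINT x. cmod (g (x - h n) - g x))) \<longlonglongrightarrow> 0"
      using tendsto_add[OF add(3,4)] by simp
  qed auto
next
  case (lim f s)
  have [measurable]: "f \<in> borel_measurable borel" "\<And>i. s i \<in> borel_measurable borel"
    using lim by (auto dest: borel_measurable_integrable)
  \<comment> \<open>The approximants satisfy |s i| \<le> 2 |f|, whence the factor 3 in the
    dominating function.\<close>
  have app: "(\<lambda>i. \<integral>x. cmod (s i x - f x) \<partial>lborel) \<longlonglongrightarrow> (\<integral>x. 0 \<partial>(lborel::'a measure))"
  proof (rule integral_dominated_convergence[where w="\<lambda>x. 3 * cmod (f x)"])
    show "AE x in lborel. (\<lambda>i. cmod (s i x - f x)) \<longlonglongrightarrow> 0"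
      using lim by (auto simp: tendsto_norm_zero_iff LIM_zero_iff)
    show "AE x in lborel. norm (cmod (s i x - f x)) \<le> 3 * cmod (f x)" for i
    proof (rule AE_I2)
      fix x
      show "norm (cmod (s i x - f x)) \<le> 3 * cmod (f x)"
        using lim(3)[of x i] norm_triangle_ineq4[of "s i x" "f x"] by simp
    qed
  qed (use lim in auto)
  show ?case
  proof (rule LIMSEQ_I)
    fix e :: real assume e: "0 < e"
    obtain i where i: "(LBINT x. cmod (s i x - f x)) < e/3"
      using LIMSEQ_D[OF app, of "e/3"] e by auto
    obtain N where N: "\<And>n. n \<ge> N \<Longrightarrow> (LBINT x. cmod (s i (x - h n) - s i x)) < e/3"
      using LIMSEQ_D[OF lim(5)[of i], of "e/3"] e by auto
    have "(LBINT x. cmod (f (x - h n) - f x)) < e" if "n \<ge> N" for n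
    proof -
      have int: "integrable lborel (\<lambda>x. cmod (s i x - f x))" "integrable lborel (\<lambda>x. cmod (s i (x - h n) - f (x - h n)))"
        "integrable lborel (\<lambda>x. cmod (s i (x - h n) - s i x))" "integrable lborel (\<lambda>x. cmod (f (x - h n) - f x))"
        using lim by (auto simp: integrable_translate intro!: integrable_norm Bochner_Integration.integrable_diff)
      have tri: "cmod (f (x - h n) - f x) \<le> cmod (s i (x - h n) - f (x - h n)) + (cmod (s i (x - h n) - s i x) + cmod (s i x - f x))" for x
        using norm_triangle_ineq4[of "s i (x - h n) - s i x + (s i x - f x)" "s i (x - h n) - f (x - h n)"]
          norm_triangle_ineq[of "s i (x - h n) - s i x" "s i x - f x"] by simp
      have "(LBINT x. cmod (f (x - h n) - f x)) \<le> (LBINT x. cmod (s i (x - h n) - f (x - h n)) + (cmod (s i (x - h n) - s i x) + cmod (s i x - f x)))"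
        using int tri by (intro integral_mono) auto
      also have "\<dots> = (LBINT x. cmod (s i (x - h n) - f (x - h n))) + ((LBINT x. cmod (s i (x - h n) - s i x)) + (LBINT x. cmod (s i x - f x)))"
        using int by simp
      also have "(LBINT x. cmod (s i (x - h n) - f (x - h n))) = (LBINT x. cmod (s i x - f x))"
        by (rule integral_translate[of "\<lambda>x. cmod (s i x - f x)"]) measurable
      finally show ?thesis using i N[OF that] by simp
    qed
    then show "\<exists>N. \<forall>n\<ge>N. norm ((LBINT x. cmod (f (x - h n) - f x)) - 0) < e"
      by auto
  qed
qed

text \<open>
  The map \<open>a \<mapsto> a |a|\<close> takes $L^2$ to $L^1$, and its inverse is 1/2-Hoelder: continuity of
  translations in $L^1$ gives continuity in $L^2$.
\<close>

lemma cmod_diff_square_le: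
  fixes a b :: complex
  shows "(cmod (a - b))\<^sup>2 \<le> 2 * cmod (a * cmod a - b * cmod b)"
proof (cases "a = b")
  case False
  define r s where "r = cmod a" and "s = cmod b"
  define p where "p = a \<bullet> b"
  have n2: "(cmod (a - b))\<^sup>2 = r\<^sup>2 + s\<^sup>2 - 2 * p"
    by (simp add: power2_norm_eq_inner inner_diff_left inner_diff_right r_def s_def p_def inner_commute)
  \<comment> \<open>Strong monotonicity of a |a|: its increment paired with a - b exceeds (r + s)/2
    times |a - b|^2 by exactly (r + s)/2 times (r - s)^2.\<close>
  have "(a * cmod a - b * cmod b) \<bullet> (a - b) = r * r\<^sup>2 + s * s\<^sup>2 - (r + s) * p"
  proof -
    have "a * cmod a = r *\<^sub>R a" "b * cmod b = s *\<^sub>R b"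
      by (simp_all add: r_def s_def scaleR_conv_of_real)
    then show ?thesis
      by (simp add: inner_diff_left inner_diff_right power2_norm_eq_inner[symmetric] inner_commute[of b a]
          p_def[symmetric] r_def[symmetric] s_def[symmetric] algebra_simps)
  qed
  moreover have "r * r\<^sup>2 + s * s\<^sup>2 - (r + s) * p - (r + s) / 2 * (r\<^sup>2 + s\<^sup>2 - 2 * p) = (r + s) / 2 * (r - s)\<^sup>2"
    by (simp add: power2_eq_square field_simps)
  moreover have "0 \<le> (r + s) / 2 * (r - s)\<^sup>2"
    by (simp add: r_def s_def)
  ultimately have "(r + s) / 2 * (cmod (a - b))\<^sup>2 \<le> (a * cmod a - b * cmod b) \<bullet> (a - b)"
    unfolding n2 by linarith
  also have "\<dots> \<le> cmod (a * cmod a - b * cmod b) * cmod (a - b)"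
    by (rule norm_cauchy_schwarz)
  finally have "(r + s) * cmod (a - b) * cmod (a - b) \<le> (2 * cmod (a * cmod a - b * cmod b)) * cmod (a - b)"
    by (simp add: power2_eq_square)
  then have "(r + s) * cmod (a - b) \<le> 2 * cmod (a * cmod a - b * cmod b)"
    using False by (simp add: mult_le_cancel_right)
  moreover have "cmod (a - b) * cmod (a - b) \<le> (r + s) * cmod (a - b)"
    unfolding r_def s_def by (intro mult_right_mono norm_triangle_ineq4) auto
  ultimately show ?thesis by (simp add: power2_eq_square)
qed auto

lemma L2_of_translate:
  fixes f :: "'a::euclidean_space \<Rightarrow> complex"
  assumes [measurable]: "f \<in> L2B"
  shows "(\<lambda>x. f (x - h)) \<in> L2B" "nsq (\<lambda>x. f (x - h)) = nsq f"
proof -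
  have [measurable]: "f \<in> borel_measurable borel" using assms by (simp add: L2_of_def)
  show "(\<lambda>x. f (x - h)) \<in> L2B"
    using L2_of_integrable[OF assms] integrable_translate[of "\<lambda>x. (cmod (f x))\<^sup>2" h] by (simp add: L2_of_def)
  show "nsq (\<lambda>x. f (x - h)) = nsq f"
    unfolding L2_sq_def by (rule integral_translate[of "\<lambda>x. (cmod (f x))\<^sup>2"]) measurable
qed

lemma L2_translate_tendsto:
  fixes f :: "'a::euclidean_space \<Rightarrow> complex"
  assumes f: "f \<in> L2B" and h: "h \<longlonglongrightarrow> 0"
  shows "(\<lambda>n. nsq (\<lambda>x. f (x - h n) - f x)) \<longlonglongrightarrow> 0"
proof (rule tendsto_sandwich[OF _ _ tendsto_const])
  have [measurable]: "f \<in> borel_measurable borel" using f by (simp add: L2_of_def)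
  let ?F = "\<lambda>x. f x * cmod (f x)"
  have F: "integrable lborel ?F"
    by (rule Bochner_Integration.integrable_bound[OF L2_of_integrable[OF f]])
      (auto simp: norm_mult power2_eq_square)
  show "(\<lambda>n. 2 * (LBINT x. cmod (?F (x - h n) - ?F x))) \<longlonglongrightarrow> 0"
    using tendsto_mult[OF tendsto_const[of 2] L1_translate_tendsto[OF F h]] by simp
  show "\<forall>\<^sub>F n in sequentially. nsq (\<lambda>x. f (x - h n) - f x) \<le> 2 * (LBINT x. cmod (?F (x - h n) - ?F x))"
  proof (intro always_eventually allI)
    fix n
    have int: "integrable lborel (\<lambda>x. 2 * cmod (?F (x - h n) - ?F x))"
      using F integrable_translate[of ?F "h n"] by (intro integrable_mult_right integrable_norm Bochner_Integration.integrable_diff) auto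
    have "nsq (\<lambda>x. f (x - h n) - f x) \<le> (LBINT x. 2 * cmod (?F (x - h n) - ?F x))"
      unfolding L2_sq_def
      by (intro integral_mono int cmod_diff_square_le L2_of_integrable L2_of_diff L2_of_translate f)
    then show "nsq (\<lambda>x. f (x - h n) - f x) \<le> 2 * (LBINT x. cmod (?F (x - h n) - ?F x))" by simp
  qed
qed (auto simp: L2_sq_nonneg)

section \<open>Moyal's identity\<close>

lemma borel_measurable_fst_snd [measurable]:
  "fst \<in> borel_measurable (borel :: ('a::second_countable_topology \<times> 'b::second_countable_topology) measure)"
  "snd \<in> borel_measurable (borel :: ('a \<times> 'b) measure)"
  by (auto intro!: borel_measurable_continuous_onI continuous_intros)

lemma lborel_Tonelli:
  fixes f :: "'a::euclidean_space \<Rightarrow> 'b::euclidean_space \<Rightarrow> ennreal"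
  assumes "(\<lambda>p. f (fst p) (snd p)) \<in> borel_measurable borel"
  shows "(\<integral>\<^sup>+x. \<integral>\<^sup>+y. f x y \<partial>lborel \<partial>lborel) = (\<integral>\<^sup>+p. f (fst p) (snd p) \<partial>lborel)"
    and "(\<integral>\<^sup>+y. \<integral>\<^sup>+x. f x y \<partial>lborel \<partial>lborel) = (\<integral>\<^sup>+p. f (fst p) (snd p) \<partial>lborel)"
proof -
  have m: "(\<lambda>p. f (fst p) (snd p)) \<in> borel_measurable (lborel \<Otimes>\<^sub>M lborel)"
    using assms by (simp add: lborel_prod)
  show "(\<integral>\<^sup>+x. \<integral>\<^sup>+y. f x y \<partial>lborel \<partial>lborel) = (\<integral>\<^sup>+p. f (fst p) (snd p) \<partial>lborel)"
    using lborel.nn_integral_fst[OF m] by (simp add: lborel_prod)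
  show "(\<integral>\<^sup>+y. \<integral>\<^sup>+x. f x y \<partial>lborel \<partial>lborel) = (\<integral>\<^sup>+p. f (fst p) (snd p) \<partial>lborel)"
    using lborel_pair.nn_integral_snd[OF m] by (simp add: lborel_prod)
qed

text \<open>Tonelli turns absolute convergence of one iterated integral into joint
  integrability.\<close>

lemma (in pair_sigma_finite)
  fixes f :: "'a \<Rightarrow> 'b \<Rightarrow> 'c::{banach,second_countable_topology}"
  assumes m: "(\<lambda>p. f (fst p) (snd p)) \<in> borel_measurable (M1 \<Otimes>\<^sub>M M2)"
    and fin: "(\<integral>\<^sup>+y. \<integral>\<^sup>+x. ennreal (norm (f x y)) \<partial>M1 \<partial>M2) < \<infinity>"
  shows Fubini_swap: "(\<integral>x. \<integral>y. f x y \<partial>M2 \<partial>M1) = (\<integral>y. \<integral>x. f x y \<partial>M1 \<partial>M2)"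
    and Fubini_integrable_fst: "integrable M1 (\<lambda>x. \<integral>y. f x y \<partial>M2)"
proof -
  have "(\<integral>\<^sup>+p. ennreal (norm (f (fst p) (snd p))) \<partial>(M1 \<Otimes>\<^sub>M M2)) < \<infinity>"
    using fin nn_integral_snd[of "\<lambda>p. ennreal (norm (f (fst p) (snd p)))"] m by simp
  then have i: "integrable (M1 \<Otimes>\<^sub>M M2) (\<lambda>p. f (fst p) (snd p))"
    using m by (intro integrableI_bounded) auto
  then have i': "integrable (M2 \<Otimes>\<^sub>M M1) (\<lambda>p. f (snd p) (fst p))"
    using integrable_product_swap[OF i] by (simp add: case_prod_unfold)
  interpret Q: pair_sigma_finite M2 M1 ..
  show "(\<integral>x. \<integral>y. f x y \<partial>M2 \<partial>M1) = (\<integral>y. \<integral>x. f x y \<partial>M1 \<partial>M2)"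
    using integral_fst'[OF i] Q.integral_fst'[OF i'] integral_product_swap[OF m]
    by (simp add: case_prod_unfold)
  show "integrable M1 (\<lambda>x. \<integral>y. f x y \<partial>M2)"
    using integrable_fst'[OF i] by simp
qed

text \<open>The non-integrable case is covered by the default value 0 of the Bochner
  integral.\<close>

lemma cmod_integral_le_nn_integral:
  fixes f :: "'a \<Rightarrow> complex"
  shows "ennreal (cmod (\<integral>x. f x \<partial>M)) \<le> (\<integral>\<^sup>+x. ennreal (cmod (f x)) \<partial>M)"
  by (cases "integrable M f") (auto simp: integral_norm_bound_ennreal not_integrable_integral_eq)

section \<open>Gaussian regularization of Plancherel's identity\<close>

lemma
  fixes f :: "'a::euclidean_space \<Rightarrow> 'b::{banach,second_countable_topology}"
  assumes [measurable]: "f \<in> borel_measurable borel" and c: "c > 0"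
  shows integral_scaled: "(LBINT x. f x) = c ^ DIM('a) *\<^sub>R (LBINT x. f (c *\<^sub>R x))"
    and integrable_scaled: "integrable lborel f \<longleftrightarrow> integrable lborel (\<lambda>x. f (c *\<^sub>R x))"
proof -
  have eq: "(lborel::'a measure) = density (distr lborel borel (\<lambda>x. c *\<^sub>R x)) (\<lambda>_. ennreal (c ^ DIM('a)))"
    using lborel_affine[of c "0::'a"] c by simp
  show "(LBINT x. f x) = c ^ DIM('a) *\<^sub>R (LBINT x. f (c *\<^sub>R x))"
    using c by (subst eq) (simp add: integral_density integral_distr)
  show "integrable lborel f \<longleftrightarrow> integrable lborel (\<lambda>x. f (c *\<^sub>R x))"
  proof -
    have "integrable lborel f \<longleftrightarrow> integrable lborel (\<lambda>x. (c ^ DIM('a)) *\<^sub>R f (c *\<^sub>R x))"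
      using c by (subst eq) (simp add: integrable_density integrable_distr_eq)
    also have "\<dots> \<longleftrightarrow> integrable lborel (\<lambda>x. f (c *\<^sub>R x))"
    proof
      assume "integrable lborel (\<lambda>x. (c ^ DIM('a)) *\<^sub>R f (c *\<^sub>R x))"
      then have "integrable lborel (\<lambda>x. (1 / c ^ DIM('a)) *\<^sub>R ((c ^ DIM('a)) *\<^sub>R f (c *\<^sub>R x)))"
        by (rule integrable_scaleR_right)
      then show "integrable lborel (\<lambda>x. f (c *\<^sub>R x))" using c by simp
    qed (rule integrable_scaleR_right)
    finally show ?thesis .
  qed
qed

definition gauss_weight :: "real \<Rightarrow> 'a::euclidean_space \<Rightarrow> real" where
  "gauss_weight n \<xi> = exp (- (norm \<xi>)\<^sup>2 / (2 * n\<^sup>2))"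

text \<open>The Fourier transform of \<open>gauss_weight n\<close>: an approximate identity of mass
  1 for large n, while the weights themselves increase to 1.\<close>

definition gauss_kernel :: "real \<Rightarrow> 'a::euclidean_space \<Rightarrow> real" where
  "gauss_kernel n u = (2 * pi * n) ^ DIM('a) * gauss ((2 * pi * n) *\<^sub>R u)"

lemma gauss_weight_measurable [measurable]: "gauss_weight n \<in> borel_measurable borel"
  unfolding gauss_weight_def by measurable

lemma gauss_kernel_measurable [measurable]: "gauss_kernel n \<in> borel_measurable borel"
  unfolding gauss_kernel_def by measurable

lemma gauss_weight_nonneg: "0 \<le> gauss_weight n \<xi>"
  by (simp add: gauss_weight_def)

lemma gauss_kernel_nonneg: "0 < n \<Longrightarrow> 0 \<le> gauss_kernel n u"
  by (simp add: gauss_kernel_def gauss_nonneg)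

lemma gauss_weight_eq:
  fixes \<eta> :: "'a::euclidean_space"
  assumes "n > 0"
  shows "gauss_weight n (n *\<^sub>R \<eta>) = sqrt (2 * pi) ^ DIM('a) * gauss \<eta>"
proof -
  have "(norm (n *\<^sub>R \<eta>))\<^sup>2 / (2 * n\<^sup>2) = (norm \<eta>)\<^sup>2 / 2"
    using assms by (simp add: power_mult_distrib)
  moreover have "sqrt (2 * pi) ^ DIM('a) * (1 / sqrt (2 * pi)) ^ DIM('a) = 1"
    by (simp add: power_mult_distrib[symmetric])
  ultimately show ?thesis
    unfolding gauss_weight_def gauss_eq mult.assoc[symmetric] by simp
qed

lemma fourier_gauss_weight:
  fixes u :: "'a::euclidean_space"
  assumes n: "n > 0"
  shows "integrable lborel (gauss_weight n :: 'a \<Rightarrow> real)"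
    and "(LBINT \<xi>. complex_of_real (gauss_weight n \<xi>) * cis (- 2 * pi * (\<xi> \<bullet> u))) = gauss_kernel n u"
proof -
  have "integrable lborel (\<lambda>\<eta>. gauss_weight n (n *\<^sub>R (\<eta>::'a)))"
    unfolding gauss_weight_eq[OF n] by (intro integrable_mult_right integrable_gauss)
  then show "integrable lborel (gauss_weight n :: 'a \<Rightarrow> real)"
    using integrable_scaled[of "gauss_weight n :: 'a \<Rightarrow> real" n] n by simp
  have "(LBINT \<xi>. complex_of_real (gauss_weight n \<xi>) * cis (- 2 * pi * (\<xi> \<bullet> u)))
    = n ^ DIM('a) *\<^sub>R (LBINT \<eta>. complex_of_real (gauss_weight n (n *\<^sub>R \<eta>)) * cis (- 2 * pi * ((n *\<^sub>R \<eta>) \<bullet> u)))"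
    using n by (intro integral_scaled) auto
  also have "\<dots> = n ^ DIM('a) *\<^sub>R (complex_of_real (sqrt (2 * pi) ^ DIM('a)) *
      (LBINT \<eta>. complex_of_real (gauss \<eta>) * cis (((- 2 * pi * n) *\<^sub>R u) \<bullet> \<eta>)))"
    unfolding gauss_weight_eq[OF n]
    by (subst integral_mult_right_zero[symmetric]) (simp add: mult_ac inner_commute)
  also have "\<dots> = complex_of_real (n ^ DIM('a) * (sqrt (2 * pi) ^ DIM('a) * exp (- (norm ((2 * pi * n) *\<^sub>R u))\<^sup>2 / 2)))"
    unfolding fourier_gauss by (simp add: scaleR_conv_of_real del: of_real_exp)
  also have "n ^ DIM('a) * (sqrt (2 * pi) ^ DIM('a) * exp (- (norm ((2 * pi * n) *\<^sub>R u))\<^sup>2 / 2)) = gauss_kernel n u"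
  proof -
    have "(2 * pi) ^ DIM('a) * (1 / sqrt (2 * pi)) ^ DIM('a) = sqrt (2 * pi) ^ DIM('a)"
      unfolding power_mult_distrib[symmetric] by (simp add: real_div_sqrt)
    moreover have "a * (s * e) = p * a * (r * e)" if "p * r = s" for a s e p r :: real
      unfolding that[symmetric] by (simp only: mult_ac)
    ultimately show ?thesis
      unfolding gauss_kernel_def gauss_eq power_mult_distrib[of "2 * pi" n] by blast
  qed
  finally show "(LBINT \<xi>. complex_of_real (gauss_weight n \<xi>) * cis (- 2 * pi * (\<xi> \<bullet> u))) = gauss_kernel n u" .
qed

text \<open>Substituting v = 2 pi n u moves the concentration from the kernel into the argument of
  \<open>k\<close>, leaving a fixed density under which the limit in n can be taken by
  domination.\<close>

lemma integral_gauss_kernel: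
  fixes k :: "'a::euclidean_space \<Rightarrow> complex"
  assumes n: "n > 0" and [measurable]: "k \<in> borel_measurable borel"
  shows "(LBINT u. complex_of_real (gauss_kernel n u) * k u)
    = (LBINT v. complex_of_real (gauss v) * k (v /\<^sub>R (2 * pi * n)))"
proof -
  have p: "2 * pi * n > 0" using n by simp
  have "(LBINT v. complex_of_real (gauss v) * k (v /\<^sub>R (2 * pi * n)))
    = (2 * pi * n) ^ DIM('a) *\<^sub>R (LBINT v. complex_of_real (gauss ((2 * pi * n) *\<^sub>R v)) * k (((2 * pi * n) *\<^sub>R v) /\<^sub>R (2 * pi * n)))"
    by (rule integral_scaled[OF _ p]) measurable
  also have "(\<lambda>v. k (((2 * pi * n) *\<^sub>R v) /\<^sub>R (2 * pi * n))) = k"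
    using left_inverse[of "2 * pi * n"] p by (simp only: scaleR_scaleR scaleR_one)
  then have "(LBINT v. complex_of_real (gauss ((2 * pi * n) *\<^sub>R v)) * k (((2 * pi * n) *\<^sub>R v) /\<^sub>R (2 * pi * n)))
    = (LBINT v. complex_of_real (gauss ((2 * pi * n) *\<^sub>R v)) * k v)" by (simp add: fun_eq_iff)
  moreover have "complex_of_real (gauss_kernel n u) * k u
      = complex_of_real ((2 * pi * n) ^ DIM('a)) * (complex_of_real (gauss ((2 * pi * n) *\<^sub>R u)) * k u)" for u
    by (simp only: gauss_kernel_def of_real_mult mult.assoc)
  ultimately show ?thesis
    by (simp only: integral_mult_right_zero scaleR_conv_of_real)
qed

lemma integrable_gauss_kernel:
  assumes n: "n > 0"
  shows "integrable lborel (gauss_kernel n :: 'a::euclidean_space \<Rightarrow> real)"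
  unfolding gauss_kernel_def
  by (intro integrable_mult_right)
    (use integrable_gauss integrable_scaled[of "gauss::'a \<Rightarrow> real" "2 * pi * n"] n in auto)

text \<open>The autocorrelation, used because its Fourier transform is the squared modulus of that
  of \<open>F\<close>.\<close>

definition autocorr :: "('a::euclidean_space \<Rightarrow> complex) \<Rightarrow> 'a \<Rightarrow> complex" where
  "autocorr F u = (LBINT t. F t * cnj (F (t - u)))"

lemma autocorr_measurable [measurable]:
  assumes [measurable]: "F \<in> borel_measurable borel"
  shows "autocorr F \<in> borel_measurable borel"
  unfolding autocorr_def by measurable

text \<open>\<open>autocorr F\<close> is integrable and its Fourier transform is the squared modulus
  of \<open>Fh\<close>. Against the Gaussian weight, Fubini moves the transform onto the weight,
  where it becomes \<open>gauss_kernel n\<close>.\<close>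

lemma weighted_Plancherel:
  fixes F :: "'a::euclidean_space \<Rightarrow> complex"
  assumes F: "integrable lborel F" and n: "n > 0"
  defines "Fh \<equiv> \<lambda>\<xi>. \<integral>t. F t * cis (- 2 * pi * (\<xi> \<bullet> t)) \<partial>lborel"
  shows "(LBINT \<xi>. complex_of_real (gauss_weight n \<xi> * (cmod (Fh \<xi>))\<^sup>2))
      = (LBINT u. complex_of_real (gauss_kernel n u) * autocorr F u)"
    and "integrable lborel (\<lambda>\<xi>. gauss_weight n \<xi> * (cmod (Fh \<xi>))\<^sup>2)"
proof -
  have Fm [measurable]: "F \<in> borel_measurable borel" using F by (auto dest: borel_measurable_integrable)
  have nnF: "(\<integral>\<^sup>+t. ennreal (cmod (F t)) \<partial>lborel) < \<infinity>"
    using F by (simp add: integrable_iff_bounded)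
  have corr_nn: "(\<integral>\<^sup>+u. \<integral>\<^sup>+t. ennreal (cmod (F t * cnj (F (t - u)))) \<partial>lborel \<partial>lborel) < \<infinity>"
  proof -
    have "(\<integral>\<^sup>+u. \<integral>\<^sup>+t. ennreal (cmod (F t * cnj (F (t - u)))) \<partial>lborel \<partial>lborel)
      = (\<integral>\<^sup>+t. \<integral>\<^sup>+u. ennreal (cmod (F t)) * ennreal (cmod (F (t - u))) \<partial>lborel \<partial>lborel)"
      by (subst lborel_pair.Fubini') (auto simp: norm_mult ennreal_mult)
    also have "\<dots> = (\<integral>\<^sup>+t. ennreal (cmod (F t)) * (\<integral>\<^sup>+s. ennreal (cmod (F s)) \<partial>lborel) \<partial>lborel)"
      by (simp add: nn_integral_cmult nn_integral_reflect[of "\<lambda>s. ennreal (cmod (F s))"])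
    also have "\<dots> = (\<integral>\<^sup>+s. ennreal (cmod (F s)) \<partial>lborel) * (\<integral>\<^sup>+s. ennreal (cmod (F s)) \<partial>lborel)"
      by (simp add: nn_integral_multc)
    finally show ?thesis using nnF by (simp add: ennreal_mult_less_top)
  qed
  have Fhsq: "complex_of_real ((cmod (Fh \<xi>))\<^sup>2) = (LBINT u. autocorr F u * cis (- 2 * pi * (\<xi> \<bullet> u)))" for \<xi>
  proof -
    let ?g = "\<lambda>t u. F t * cnj (F (t - u)) * cis (- 2 * pi * (\<xi> \<bullet> u))"
    have m: "(\<lambda>p. ?g (fst p) (snd p)) \<in> borel_measurable (lborel \<Otimes>\<^sub>M lborel)" by measurable
    have fin: "(\<integral>\<^sup>+u. \<integral>\<^sup>+t. ennreal (cmod (?g t u)) \<partial>lborel \<partial>lborel) < \<infinity>"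
      using corr_nn by (simp add: norm_mult)
    have "(LBINT u. autocorr F u * cis (- 2 * pi * (\<xi> \<bullet> u))) = (LBINT u. LBINT t. ?g t u)"
      by (simp add: autocorr_def)
    also have "\<dots> = (LBINT t. LBINT u. ?g t u)"
      using lborel_pair.Fubini_swap[OF m fin] by simp
    also have "\<dots> = (LBINT t. F t * cis (- 2 * pi * (\<xi> \<bullet> t)) * cnj (Fh \<xi>))"
    proof (rule Bochner_Integration.integral_cong[OF refl])
      fix t
      \<comment> \<open>Replacing u by t - u separates the variables, and the integral factors into
        \<open>Fh\<close> and its conjugate.\<close>
      have "(LBINT u. ?g t u) = (LBINT u. ?g t (t - u))"
        by (rule integral_reflect[of "\<lambda>u. ?g t u", symmetric]) measurable
      also have "\<dots> = (LBINT u. F t * cis (- 2 * pi * (\<xi> \<bullet> t)) * cnj (F u * cis (- 2 * pi * (\<xi> \<bullet> u))))"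
      proof (rule Bochner_Integration.integral_cong[OF refl])
        fix u
        have "cis (- 2 * pi * (\<xi> \<bullet> (t - u))) = cis (- 2 * pi * (\<xi> \<bullet> t)) * cnj (cis (- 2 * pi * (\<xi> \<bullet> u)))"
          by (simp add: cis_cnj cis_mult inner_diff_right algebra_simps)
        then show "?g t (t - u) = F t * cis (- 2 * pi * (\<xi> \<bullet> t)) * cnj (F u * cis (- 2 * pi * (\<xi> \<bullet> u)))"
          by (simp add: mult_ac)
      qed
      also have "\<dots> = F t * cis (- 2 * pi * (\<xi> \<bullet> t)) * cnj (Fh \<xi>)"
        unfolding Fh_def Bochner_Integration.integral_cnj[symmetric] by (rule integral_mult_right_zero)
      finally show "(LBINT u. ?g t u) = F t * cis (- 2 * pi * (\<xi> \<bullet> t)) * cnj (Fh \<xi>)" .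
    qed
    also have "\<dots> = Fh \<xi> * cnj (Fh \<xi>)" by (simp add: Fh_def)
    finally show ?thesis by (simp only: complex_norm_square)
  qed
  let ?h = "\<lambda>\<xi> u. complex_of_real (gauss_weight n \<xi>) * (autocorr F u * cis (- 2 * pi * (\<xi> \<bullet> u)))"
  have m: "(\<lambda>p. ?h (fst p) (snd p)) \<in> borel_measurable (lborel \<Otimes>\<^sub>M lborel)" by measurable
  have fin: "(\<integral>\<^sup>+u. \<integral>\<^sup>+\<xi>. ennreal (cmod (?h \<xi> u)) \<partial>lborel \<partial>lborel) < \<infinity>"
  proof -
    have "(\<integral>\<^sup>+u. \<integral>\<^sup>+\<xi>. ennreal (cmod (?h \<xi> u)) \<partial>lborel \<partial>lborel)
      = (\<integral>\<^sup>+u. ennreal (cmod (autocorr F u)) * (\<integral>\<^sup>+\<xi>. ennreal (gauss_weight n (\<xi>::'a)) \<partial>lborel) \<partial>lborel)"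
      by (simp add: norm_mult gauss_weight_nonneg mult.commute[of "gauss_weight n _"] ennreal_mult nn_integral_cmult)
    also have "\<dots> = (\<integral>\<^sup>+u. ennreal (cmod (autocorr F u)) \<partial>lborel) * (\<integral>\<^sup>+\<xi>. ennreal (gauss_weight n (\<xi>::'a)) \<partial>lborel)"
      by (simp add: nn_integral_multc)
    also have "\<dots> < \<infinity>"
    proof -
      have "(\<integral>\<^sup>+u. ennreal (cmod (autocorr F u)) \<partial>lborel) \<le> (\<integral>\<^sup>+u. \<integral>\<^sup>+t. ennreal (cmod (F t * cnj (F (t - u)))) \<partial>lborel \<partial>lborel)"
        unfolding autocorr_def by (intro nn_integral_mono cmod_integral_le_nn_integral)
      moreover have "(\<integral>\<^sup>+\<xi>. ennreal (gauss_weight n (\<xi>::'a)) \<partial>lborel) < \<infinity>"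
        using fourier_gauss_weight(1)[OF n, where 'a='a] by (simp add: integrable_iff_bounded gauss_weight_nonneg)
      ultimately show ?thesis using corr_nn by (auto simp: ennreal_mult_less_top)
    qed
    finally show ?thesis .
  qed
  have inner: "(LBINT u. ?h \<xi> u) = complex_of_real (gauss_weight n \<xi> * (cmod (Fh \<xi>))\<^sup>2)" for \<xi>
    unfolding of_real_mult Fhsq by simp
  have "(LBINT \<xi>. ?h \<xi> u) = complex_of_real (gauss_kernel n u) * autocorr F u" for u
  proof -
    have "(LBINT \<xi>. ?h \<xi> u) = (LBINT \<xi>. autocorr F u * (complex_of_real (gauss_weight n \<xi>) * cis (- 2 * pi * (\<xi> \<bullet> u))))"
      by (simp add: mult_ac)
    then show ?thesis using fourier_gauss_weight(2)[OF n, of u] by (simp add: mult.commute)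
  qed
  then show "(LBINT \<xi>. complex_of_real (gauss_weight n \<xi> * (cmod (Fh \<xi>))\<^sup>2))
      = (LBINT u. complex_of_real (gauss_kernel n u) * autocorr F u)"
    unfolding inner[symmetric] using lborel_pair.Fubini_swap[OF m fin] by simp
  have "integrable lborel (\<lambda>\<xi>. complex_of_real (gauss_weight n \<xi> * (cmod (Fh \<xi>))\<^sup>2))"
    unfolding inner[symmetric] using lborel_pair.Fubini_integrable_fst[OF m fin] by simp
  then show "integrable lborel (\<lambda>\<xi>. gauss_weight n \<xi> * (cmod (Fh \<xi>))\<^sup>2)"
    using complex_of_real_integrable_eq by blast
qed

lemma nn_corr_le:
  fixes f :: "'a::euclidean_space \<Rightarrow> complex"
  assumes f: "f \<in> L2B"
  shows "(\<integral>\<^sup>+t. ennreal (cmod (f t * cnj (f (t - u)))) \<partial>lborel) \<le> ennreal (nsq f)"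
proof -
  note fu = L2_of_translate[OF f, of u]
  have "(\<integral>\<^sup>+t. ennreal (cmod (f t * cnj (f (t - u)))) \<partial>lborel) = ennreal (LBINT t. cmod (f t) * cmod (f (t - u)))"
    using nn_integral_eq_integral[OF L2_of_integrable_norm_mult[OF f fu(1)]] by (simp add: norm_mult)
  also have "(LBINT t. cmod (f t) * cmod (f (t - u))) \<le> nsq f"
    using integral_norm_mult_le[OF f fu(1)] fu(2) L2_sq_nonneg[of lborel f]
    by (intro power2_le_imp_le[of "\<integral>t. cmod (f t) * cmod (f (t - u)) \<partial>lborel"]) (simp_all add: power2_eq_square[of "nsq f"])
  finally show ?thesis by (simp add: ennreal_leI)
qed

lemma cmod_autocorr_le:
  fixes f :: "'a::euclidean_space \<Rightarrow> complex"
  assumes f: "f \<in> L2B"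
  shows "cmod (autocorr f u) \<le> nsq f"
proof -
  have "cmod (autocorr f u) = cmod (ip f (\<lambda>t. f (t - u)))"
    by (simp add: autocorr_def L2_ip_def)
  moreover have "(cmod (ip f (\<lambda>t. f (t - u))))\<^sup>2 \<le> (nsq f)\<^sup>2"
    using L2_ip_Cauchy_Schwarz[OF f L2_of_translate(1)[OF f, of u]] L2_of_translate(2)[OF f, of u]
    by (simp add: power2_eq_square)
  ultimately show ?thesis using L2_sq_nonneg[of lborel f] power2_le_imp_le by metis
qed

text \<open>The value at shift 0 is \<open>nsq f\<close>, and the deviation from it is the inner
  product of \<open>f\<close> with a translation increment, small by continuity of translations in
  L2.\<close>

lemma autocorr_tendsto:
  fixes f :: "'a::euclidean_space \<Rightarrow> complex"
  assumes f: "f \<in> L2B" and h: "h \<longlonglongrightarrow> 0"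
  shows "(\<lambda>n. autocorr f (h n)) \<longlonglongrightarrow> complex_of_real (nsq f)"
proof -
  have "(\<lambda>n. cmod (autocorr f (h n) - complex_of_real (nsq f))) \<longlonglongrightarrow> 0"
  proof (rule tendsto_sandwich[OF _ _ tendsto_const])
    have "(\<lambda>n. sqrt (nsq f * nsq (\<lambda>x. f (x - h n) - f x))) \<longlonglongrightarrow> sqrt (nsq f * 0)"
      by (intro tendsto_intros L2_translate_tendsto[OF f h])
    then show "(\<lambda>n. sqrt (nsq f * nsq (\<lambda>x. f (x - h n) - f x))) \<longlonglongrightarrow> 0" by simp
    have "cmod (autocorr f (h n) - complex_of_real (nsq f)) \<le> sqrt (nsq f * nsq (\<lambda>x. f (x - h n) - f x))" for n
    proof -
      have "autocorr f (h n) - complex_of_real (nsq f) = ip f (\<lambda>x. f (x - h n) - f x)"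
        using L2_ip_diff_right[OF L2_of_translate(1)[OF f] f f] by (simp add: L2_ip_self autocorr_def L2_ip_def)
      then show ?thesis
        using L2_ip_Cauchy_Schwarz[OF f L2_of_diff[OF L2_of_translate(1)[OF f, of "h n"] f]]
        by (intro real_le_rsqrt) simp
    qed
    then show "\<forall>\<^sub>F n in sequentially. cmod (autocorr f (h n) - complex_of_real (nsq f)) \<le> sqrt (nsq f * nsq (\<lambda>x. f (x - h n) - f x))"
      by simp
  qed auto
  then show ?thesis by (simp add: LIM_zero_iff tendsto_norm_zero_iff)
qed

section \<open>Time-frequency shifts and Moyal's identity\<close>

definition tf_shift :: "('a::euclidean_space \<Rightarrow> complex) \<Rightarrow> 'a \<times> 'a \<Rightarrow> 'a \<Rightarrow> complex" where
  "tf_shift g z t = cis (2 * pi * (snd z \<bullet> t)) * g (t - fst z)"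

lemma L2_of_borel [measurable_dest]: "f \<in> L2B \<Longrightarrow> f \<in> borel_measurable borel"
  by (simp add: L2_of_def)

lemma tf_shift_measurable [measurable (raw)]:
  assumes [measurable]: "g \<in> borel_measurable borel" "z \<in> borel_measurable M" "t \<in> borel_measurable M"
  shows "(\<lambda>x. tf_shift g (z x) (t x)) \<in> borel_measurable M"
  unfolding tf_shift_def by measurable

lemma
  assumes g: "g \<in> L2B"
  shows L2_of_tf_shift: "tf_shift g z \<in> L2B" and L2_sq_tf_shift: "nsq (tf_shift g z) = nsq g"
proof -
  have [measurable]: "g \<in> borel_measurable borel" using g by measurable
  have eq: "cmod (tf_shift g z t) = cmod (g (t - fst z))" for t by (simp add: tf_shift_def norm_mult)
  have [measurable]: "tf_shift g z \<in> borel_measurable borel" by measurable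
  show "tf_shift g z \<in> L2B"
    using L2_of_translate(1)[OF g, of "fst z"] by (simp add: L2_of_def eq)
  show "nsq (tf_shift g z) = nsq g"
    using L2_of_translate(2)[OF g, of "fst z"] by (simp add: L2_sq_def eq)
qed

lemma L2_ip_tf_shift_measurable [measurable]:
  assumes [measurable]: "f \<in> borel_measurable borel" "g \<in> borel_measurable borel"
  shows "(\<lambda>z. ip f (tf_shift g z)) \<in> borel_measurable borel"
  unfolding L2_ip_def by measurable

text \<open>For a fixed position x the transform in frequency is the Fourier transform of the
  integrable function \<open>F x\<close>, so \<open>weighted_Plancherel\<close> applies. Integration
  over x turns the autocorrelations of the \<open>F x\<close> into \<open>k\<close>, which tends to
  \<open>N\<close> at 0; then the weight is sent to 1.\<close>

lemma Moyal:
  fixes f g :: "'a::euclidean_space \<Rightarrow> complex"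
  assumes f: "f \<in> L2B" and g: "g \<in> L2B"
  shows "(\<integral>\<^sup>+z. ennreal ((cmod (ip f (tf_shift g z)))\<^sup>2) \<partial>lborel) = ennreal (nsq f * nsq g)"
proof -
  have [measurable]: "f \<in> borel_measurable borel" "g \<in> borel_measurable borel" using f g by measurable
  define F where "F = (\<lambda>x t. f t * cnj (g (t - x)))"
  have [measurable]: "F x \<in> borel_measurable borel" for x unfolding F_def by measurable
  have F: "integrable lborel (F x)" for x
    unfolding F_def by (intro L2_of_integrable_mult f L2_of_translate g)
  define k where "k = (\<lambda>u. autocorr f u * cnj (autocorr g u))"
  have [measurable]: "k \<in> borel_measurable borel" unfolding k_def by measurable
  define N where "N = nsq f * nsq g"
  have k_le: "cmod (k u) \<le> N" for u
    unfolding k_def N_def norm_mult complex_mod_cnj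
    by (intro mult_mono cmod_autocorr_le f g L2_sq_nonneg norm_ge_zero)
  define U where "U = (\<lambda>z. (cmod (ip f (tf_shift g z)))\<^sup>2)"
  have [measurable]: "U \<in> borel_measurable borel" unfolding U_def by measurable
  have U_nn: "0 \<le> U z" for z by (simp add: U_def)
  have U_F: "U z = (cmod (LBINT t. F (fst z) t * cis (- 2 * pi * (snd z \<bullet> t))))\<^sup>2" for z
    by (simp add: U_def L2_ip_def tf_shift_def F_def cis_cnj mult_ac)
  have FF: "F x t * cnj (F x (t - u)) = (f t * cnj (f (t - u))) * cnj (g (t - x) * cnj (g (t - x - u)))" for x t u
    by (simp add: F_def algebra_simps)
  \<comment> \<open>Being uniform in \<open>u\<close>, this bound justifies exchanging x with t for
    each \<open>u\<close> and, multiplied by the integrable Gaussian kernel, x with u.\<close>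
  have nn: "(\<integral>\<^sup>+x. \<integral>\<^sup>+t. ennreal (cmod (F x t * cnj (F x (t - u)))) \<partial>lborel \<partial>lborel) \<le> ennreal N" for u
  proof -
    have "(\<integral>\<^sup>+x. \<integral>\<^sup>+t. ennreal (cmod (F x t * cnj (F x (t - u)))) \<partial>lborel \<partial>lborel)
      = (\<integral>\<^sup>+t. \<integral>\<^sup>+x. ennreal (cmod (f t * cnj (f (t - u)))) * ennreal (cmod (g (t - x) * cnj (g (t - x - u)))) \<partial>lborel \<partial>lborel)"
      unfolding FF by (subst lborel_pair.Fubini') (auto simp: norm_mult ennreal_mult[symmetric])
    also have "\<dots> = (\<integral>\<^sup>+t. ennreal (cmod (f t * cnj (f (t - u)))) * (\<integral>\<^sup>+y. ennreal (cmod (g y * cnj (g (y - u)))) \<partial>lborel) \<partial>lborel)"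
      by (simp add: nn_integral_cmult nn_integral_reflect[of "\<lambda>y. ennreal (cmod (g y * cnj (g (y - u))))"])
    also have "\<dots> = (\<integral>\<^sup>+t. ennreal (cmod (f t * cnj (f (t - u)))) \<partial>lborel) * (\<integral>\<^sup>+y. ennreal (cmod (g y * cnj (g (y - u)))) \<partial>lborel)"
      by (simp add: nn_integral_multc)
    also have "\<dots> \<le> ennreal (nsq f) * ennreal (nsq g)"
      by (intro mult_mono nn_corr_le f g) auto
    finally show ?thesis by (simp add: N_def ennreal_mult L2_sq_nonneg)
  qed
  have auto_x: "(LBINT x. autocorr (F x) u) = k u" for u
  proof -
    let ?h = "\<lambda>t x. F x t * cnj (F x (t - u))"
    have m: "(\<lambda>p. ?h (fst p) (snd p)) \<in> borel_measurable (lborel \<Otimes>\<^sub>M lborel)" unfolding F_def by measurable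
    have fin: "(\<integral>\<^sup>+x. \<integral>\<^sup>+t. ennreal (cmod (?h t x)) \<partial>lborel \<partial>lborel) < \<infinity>"
      using nn[of u] by (auto simp: less_top[symmetric] top_unique)
    have "(LBINT x. autocorr (F x) u) = (LBINT t. LBINT x. ?h t x)"
      unfolding autocorr_def using lborel_pair.Fubini_swap[OF m fin] by simp
    also have "\<dots> = (LBINT t. (f t * cnj (f (t - u))) * cnj (autocorr g u))"
    proof (rule Bochner_Integration.integral_cong[OF refl])
      fix t
      have "(LBINT x. ?h t x) = (f t * cnj (f (t - u))) * (LBINT x. cnj (g (t - x) * cnj (g (t - x - u))))"
        unfolding FF by (rule integral_mult_right_zero)
      also have "(LBINT x. cnj (g (t - x) * cnj (g (t - x - u)))) = (LBINT y. cnj (g y * cnj (g (y - u))))"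
        by (rule integral_reflect[of "\<lambda>y. cnj (g y * cnj (g (y - u)))"]) measurable
      finally show "(LBINT x. ?h t x) = (f t * cnj (f (t - u))) * cnj (autocorr g u)"
        by (simp only: autocorr_def Bochner_Integration.integral_cnj)
    qed
    also have "\<dots> = k u"
      by (simp only: k_def autocorr_def integral_mult_left_zero)
    finally show ?thesis .
  qed
  have weighted: "(\<integral>\<^sup>+z. ennreal (gauss_weight n (snd z) * U z) \<partial>lborel)
      = ennreal (Re (LBINT u. complex_of_real (gauss_kernel n u) * k u))" if n: "n > 0" for n
  proof -
    let ?h = "\<lambda>x u. complex_of_real (gauss_kernel n u) * autocorr (F x) u"
    have m: "(\<lambda>p. ?h (fst p) (snd p)) \<in> borel_measurable (lborel \<Otimes>\<^sub>M lborel)" unfolding F_def autocorr_def by measurable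
    have fin: "(\<integral>\<^sup>+u. \<integral>\<^sup>+x. ennreal (cmod (?h x u)) \<partial>lborel \<partial>lborel) < \<infinity>"
    proof -
      have [measurable]: "(\<lambda>x. autocorr (F x) u) \<in> borel_measurable borel" for u
        unfolding F_def autocorr_def by measurable
      have "(\<integral>\<^sup>+x. ennreal (cmod (?h x u)) \<partial>lborel) \<le> ennreal (gauss_kernel n u) * ennreal N" for u
      proof -
        have "ennreal (cmod (autocorr (F x) u)) \<le> (\<integral>\<^sup>+t. ennreal (cmod (F x t * cnj (F x (t - u)))) \<partial>lborel)" for x
          unfolding autocorr_def by (rule cmod_integral_le_nn_integral)
        then have "(\<integral>\<^sup>+x. ennreal (cmod (autocorr (F x) u)) \<partial>lborel) \<le> ennreal N"
          by (intro order_trans[OF nn_integral_mono nn])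
        then show ?thesis
          using n by (simp add: norm_mult gauss_kernel_nonneg ennreal_mult nn_integral_cmult mult_left_mono)
      qed
      then have "(\<integral>\<^sup>+u. \<integral>\<^sup>+x. ennreal (cmod (?h x u)) \<partial>lborel \<partial>lborel) \<le> (\<integral>\<^sup>+u. ennreal (gauss_kernel n (u::'a)) * ennreal N \<partial>lborel)"
        by (rule nn_integral_mono)
      also have "\<dots> = (\<integral>\<^sup>+u. ennreal (gauss_kernel n (u::'a)) \<partial>lborel) * ennreal N"
        by (simp add: nn_integral_multc)
      also have "\<dots> < \<infinity>"
        using integrable_gauss_kernel[OF n, where 'a='a] n
        by (simp add: integrable_iff_bounded gauss_kernel_nonneg ennreal_mult_less_top)
      finally show ?thesis .
    qed
    have inner: "(\<integral>\<^sup>+\<xi>. ennreal (gauss_weight n \<xi> * U (x, \<xi>)) \<partial>lborel)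
        = ennreal (Re (LBINT u. ?h x u))"
      and inner_nn: "0 \<le> Re (LBINT u. ?h x u)" for x
    proof -
      have eq: "Re (LBINT u. ?h x u) = (LBINT \<xi>. gauss_weight n \<xi> * U (x, \<xi>))"
        unfolding weighted_Plancherel(1)[OF F n, symmetric] integral_complex_of_real U_F by simp
      then show "0 \<le> Re (LBINT u. ?h x u)"
        by (simp add: gauss_weight_nonneg U_nn)
      show "(\<integral>\<^sup>+\<xi>. ennreal (gauss_weight n \<xi> * U (x, \<xi>)) \<partial>lborel)
        = ennreal (Re (LBINT u. ?h x u))"
        unfolding eq
        by (rule nn_integral_eq_integral) (use weighted_Plancherel(2)[OF F n, of x] in \<open>auto simp: U_F gauss_weight_nonneg\<close>)
    qed
    have "(\<integral>\<^sup>+z. ennreal (gauss_weight n (snd z) * U z) \<partial>lborel)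
      = (\<integral>\<^sup>+x. ennreal (Re (LBINT u. ?h x u)) \<partial>lborel)"
      using lborel_Tonelli(1)[of "\<lambda>x \<xi>. ennreal (gauss_weight n \<xi> * U (x, \<xi>))"]
      by (simp add: inner)
    also have "\<dots> = ennreal (\<integral>x. Re (LBINT u. ?h x u) \<partial>lborel)"
      using lborel_pair.Fubini_integrable_fst[OF m fin] by (intro nn_integral_eq_integral) (auto simp: inner_nn)
    also have "(\<integral>x. Re (LBINT u. ?h x u) \<partial>lborel) = Re (LBINT x. LBINT u. ?h x u)"
      using lborel_pair.Fubini_integrable_fst[OF m fin] by (rule integral_Re)
    also have "(LBINT x. LBINT u. ?h x u) = (LBINT u. LBINT x. ?h x u)"
      using lborel_pair.Fubini_swap[OF m fin] by simp
    also have "\<dots> = (LBINT u. complex_of_real (gauss_kernel n u) * k u)"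
      by (simp add: auto_x)
    finally show ?thesis .
  qed
  let ?c = "\<lambda>i::nat. \<integral>u. complex_of_real (gauss_kernel (real (Suc i)) u) * k u \<partial>lborel"
  have "?c \<longlonglongrightarrow> (\<integral>v. complex_of_real (gauss v) * complex_of_real N \<partial>(lborel::'a measure))"
  proof -
    have "(\<lambda>i::nat. \<integral>v. complex_of_real (gauss v) * k (v /\<^sub>R (2 * pi * real (Suc i))) \<partial>lborel)
      \<longlonglongrightarrow> (\<integral>v. complex_of_real (gauss v) * complex_of_real N \<partial>(lborel::'a measure))"
    proof (rule integral_dominated_convergence[where w="\<lambda>v::'a. gauss v * N"])
      show "integrable lborel (\<lambda>v::'a. gauss v * N)"
        by (intro integrable_mult_left integrable_gauss)
      show "AE v in lborel. norm (complex_of_real (gauss v) * k (v /\<^sub>R (2 * pi * real (Suc i)))) \<le> gauss v * N" for i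
        by (auto simp: norm_mult gauss_nonneg simp del: of_nat_Suc intro!: mult_left_mono k_le)
      show "AE v in lborel. (\<lambda>i. complex_of_real (gauss v) * k (v /\<^sub>R (2 * pi * real (Suc i)))) \<longlonglongrightarrow> complex_of_real (gauss v) * complex_of_real N"
      proof (rule AE_I2)
        fix v :: 'a
        have "(\<lambda>i. (inverse (2 * pi) * inverse (real (Suc i))) *\<^sub>R v) \<longlonglongrightarrow> (inverse (2 * pi) * 0) *\<^sub>R v"
          by (intro tendsto_intros LIMSEQ_inverse_real_of_nat)
        then have 0: "(\<lambda>i. v /\<^sub>R (2 * pi * real (Suc i))) \<longlonglongrightarrow> 0"
          by (simp del: of_nat_Suc)
        have "(\<lambda>i. k (v /\<^sub>R (2 * pi * real (Suc i)))) \<longlonglongrightarrow> complex_of_real (nsq f) * cnj (complex_of_real (nsq g))"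
          unfolding k_def by (intro tendsto_intros autocorr_tendsto f g 0)
        then show "(\<lambda>i. complex_of_real (gauss v) * k (v /\<^sub>R (2 * pi * real (Suc i)))) \<longlonglongrightarrow> complex_of_real (gauss v) * complex_of_real N"
          by (intro tendsto_intros) (simp add: N_def)
      qed
    qed measurable
    moreover have "?c i = (LBINT v. complex_of_real (gauss v) * k (v /\<^sub>R (2 * pi * real (Suc i))))" for i
      by (rule integral_gauss_kernel) auto
    ultimately show ?thesis by simp
  qed
  also have "(\<integral>v. complex_of_real (gauss v) * complex_of_real N \<partial>(lborel::'a measure)) = complex_of_real N"
    by (simp add: integral_gauss)
  finally have lim1: "(\<lambda>i. ennreal (Re (?c i))) \<longlonglongrightarrow> ennreal N"
    by (intro tendsto_ennrealI) (auto dest: tendsto_Re)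
  \<comment> \<open>The kernel side tends to \<open>N\<close> by dominated convergence. The weights
    increase to 1, so the same sequence also tends to the unweighted integral by monotone
    convergence.\<close>
  let ?w = "\<lambda>i z. ennreal (gauss_weight (real (Suc i)) (snd z) * U z)"
  have "(\<lambda>i. \<integral>\<^sup>+z. ?w i z \<partial>lborel) \<longlonglongrightarrow> (\<integral>\<^sup>+z. ennreal (U z) \<partial>lborel)"
  proof (rule nn_integral_LIMSEQ)
    show "incseq ?w"
    proof (intro incseq_SucI le_funI ennreal_leI mult_right_mono)
      fix i and z :: "'a \<times> 'a"
      have "(norm (snd z))\<^sup>2 / (2 * (real (Suc (Suc i)))\<^sup>2) \<le> (norm (snd z))\<^sup>2 / (2 * (real (Suc i))\<^sup>2)"
        by (intro divide_left_mono mult_left_mono power_mono) auto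
      then show "gauss_weight (real (Suc i)) (snd z) \<le> gauss_weight (real (Suc (Suc i))) (snd z)"
        by (simp add: gauss_weight_def)
    qed (rule U_nn)
    show "(\<lambda>i. ?w i z) \<longlonglongrightarrow> ennreal (U z)" for z
    proof -
      have "(\<lambda>i. exp (- (norm (snd z))\<^sup>2 / 2 * (inverse (real (Suc i)))\<^sup>2) * U z)
        \<longlonglongrightarrow> exp (- (norm (snd z))\<^sup>2 / 2 * 0\<^sup>2) * U z"
        by (intro tendsto_intros LIMSEQ_inverse_real_of_nat)
      then show ?thesis
        by (intro tendsto_ennrealI) (simp add: gauss_weight_def field_simps del: of_nat_Suc)
    qed
  qed measurable
  moreover have "(\<integral>\<^sup>+z. ?w i z \<partial>lborel) = ennreal (Re (?c i))" for i
    by (rule weighted) simp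
  ultimately show ?thesis
    using lim1 LIMSEQ_unique unfolding N_def U_def by fastforce
qed

section \<open>Translates of sets of finite perimeter\<close>

definition C1_grad :: "('b::euclidean_space \<Rightarrow> real) \<Rightarrow> ('b \<Rightarrow> 'b) \<Rightarrow> bool" where
  "C1_grad \<psi> D \<longleftrightarrow> (\<forall>x. (\<psi> has_derivative (\<lambda>v. D x \<bullet> v)) (at x)) \<and> continuous_on UNIV D"

lemma C1_gradD: "C1_grad \<psi> D \<Longrightarrow> (\<psi> has_derivative (\<lambda>v. D x \<bullet> v)) (at x)"
  "C1_grad \<psi> D \<Longrightarrow> continuous_on UNIV D"
  by (auto simp: C1_grad_def)

lemma C1_grad_continuous: "C1_grad \<psi> D \<Longrightarrow> continuous_on UNIV \<psi>"
  by (meson C1_gradD(1) has_derivative_continuous continuous_at_imp_continuous_on)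

lemma C1_grad_sum:
  assumes "\<And>p. p \<in> P \<Longrightarrow> C1_grad (f p) (D p)"
  shows "C1_grad (\<lambda>x. \<Sum>p\<in>P. f p x) (\<lambda>x. \<Sum>p\<in>P. D p x)"
  unfolding C1_grad_def
proof (intro conjI allI)
  fix x
  have "((\<lambda>x. \<Sum>p\<in>P. f p x) has_derivative (\<lambda>v. \<Sum>p\<in>P. D p x \<bullet> v)) (at x)"
    by (intro has_derivative_sum C1_gradD(1) assms)
  then show "((\<lambda>x. \<Sum>p\<in>P. f p x) has_derivative (\<lambda>v. (\<Sum>p\<in>P. D p x) \<bullet> v)) (at x)"
    by (simp add: inner_sum_left)
  show "continuous_on UNIV (\<lambda>x. \<Sum>p\<in>P. D p x)"
    by (intro continuous_on_sum C1_gradD(2)[OF assms])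
qed

lemma C1_grad_compose:
  assumes f: "C1_grad f D" and q: "\<And>t. (q has_real_derivative q' t) (at t)" "continuous_on UNIV q'"
  shows "C1_grad (\<lambda>x. q (f x)) (\<lambda>x. q' (f x) *\<^sub>R D x)"
  unfolding C1_grad_def
proof (intro conjI allI)
  fix x
  have "(q has_derivative (\<lambda>v. q' (f x) * v)) (at (f x))"
    using q(1)[of "f x"] by (simp add: has_field_derivative_def mult_commute_abs)
  from has_derivative_compose[OF C1_gradD(1)[OF f] this]
  show "((\<lambda>x. q (f x)) has_derivative (\<lambda>v. (q' (f x) *\<^sub>R D x) \<bullet> v)) (at x)"
    by simp
  show "continuous_on UNIV (\<lambda>x. q' (f x) *\<^sub>R D x)"
    using C1_grad_continuous[OF f] C1_gradD(2)[OF f] q(2)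
    by (intro continuous_intros continuous_on_compose2[OF q(2)]) auto
qed

lemma DERIV_max_0_square: "((\<lambda>u::real. (max 0 u)\<^sup>2) has_real_derivative 2 * max 0 u) (at u)"
proof -
  consider "u > 0" | "u < 0" | "u = 0" by linarith
  then show ?thesis
  proof cases
    case 1
    have "((\<lambda>u. u\<^sup>2) has_real_derivative 2 * max 0 u) (at u)"
      using 1 by (auto intro!: derivative_eq_intros)
    then show ?thesis
      by (rule has_field_derivative_transform_within_open[where S="{0<..}"]) (use 1 in auto)
  next
    case 2
    have "((\<lambda>u. 0) has_real_derivative 2 * max 0 u) (at u)"
      using 2 by (auto intro!: derivative_eq_intros)
    then show ?thesis
      by (rule has_field_derivative_transform_within_open[where S="{..<0}"]) (use 2 in auto)
  next
    case 3
    have "((\<lambda>y::real. max 0 y) \<longlongrightarrow> max 0 0) (at 0)" by (intro tendsto_intros)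
    moreover have "\<forall>\<^sub>F y in at 0. max 0 y = ((max 0 y)\<^sup>2 - (max 0 0)\<^sup>2) / (y - 0 :: real)"
      by (auto simp: eventually_at power2_eq_square max_def intro!: exI[of _ 1])
    ultimately show ?thesis
      using 3 unfolding has_field_derivative_iff by (auto intro: Lim_transform_eventually)
  qed
qed

text \<open>It is 1 at 0 and vanishes from 1 on; the square removes the corner of
  \<open>max 0 (1 - t)\<close>. It serves twice, to shape single bumps and to cap their sum.\<close>

definition quad_cut :: "real \<Rightarrow> real" where
  "quad_cut t = (max 0 (1 - t))\<^sup>2"

lemma DERIV_quad_cut: "(quad_cut has_real_derivative - 2 * max 0 (1 - t)) (at t)"
proof -
  have "((\<lambda>t. (max 0 (1 - t))\<^sup>2) has_real_derivative 2 * max 0 (1 - t) * (- 1)) (at t)"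
    by (rule DERIV_chain2[where f="\<lambda>u. (max 0 u)\<^sup>2", OF DERIV_max_0_square]) (auto intro!: derivative_eq_intros)
  then show ?thesis by (simp add: quad_cut_def[abs_def])
qed

lemma quad_cut_range: "0 \<le> t \<Longrightarrow> 0 \<le> quad_cut t \<and> quad_cut t \<le> 1"
  by (auto simp: quad_cut_def max_def intro!: power_le_one)

lemma C1_grad_quad_cut:
  assumes "C1_grad f D"
  shows "C1_grad (\<lambda>x. quad_cut (f x)) (\<lambda>x. (- 2 * max 0 (1 - f x)) *\<^sub>R D x)"
  by (rule C1_grad_compose[OF assms DERIV_quad_cut]) (intro continuous_intros)

text \<open>Take bumps of radius 2r around the centres of a finite cover by balls of radius r. Their
  sum is bounded below on \<Omega>, and one more cut caps it at the value 1 there.\<close>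

lemma C1_cutoff_exists:
  fixes \<Omega> :: "'b::euclidean_space set"
  assumes \<Omega>: "compact \<Omega>" and r: "r > 0"
  shows "\<exists>\<psi> D. C1_grad \<psi> D \<and> (\<forall>x. 0 \<le> \<psi> x \<and> \<psi> x \<le> 1) \<and> (\<forall>x\<in>\<Omega>. \<psi> x = 1) \<and>
    (\<forall>x. \<psi> x \<noteq> 0 \<longrightarrow> (\<exists>p\<in>\<Omega>. dist x p < 2 * r))"
proof -
  obtain P where P: "P \<subseteq> \<Omega>" "finite P" "\<Omega> \<subseteq> (\<Union>p\<in>P. ball p r)"
    using compactE_image[OF \<Omega>, of \<Omega> "\<lambda>p. ball p r"] r by (metis centre_in_ball open_ball UN_I subsetI)
  define b where "b = (\<lambda>p x::'b. quad_cut ((norm (x - p))\<^sup>2 / (4 * r\<^sup>2)))"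
  define s where "s = (\<lambda>x. (\<Sum>p\<in>P. b p x))"
  \<comment> \<open>Within distance r of a centre the bump is at least (1 - 1/4)^2 = 9/16, so with
    the factor 16/9 the argument is at least 1 on \<Omega>, where the cut vanishes.\<close>
  define \<psi> where "\<psi> = (\<lambda>x. 1 - quad_cut (16 / 9 * s x))"
  have "C1_grad (\<lambda>x. (norm (x - p))\<^sup>2) (\<lambda>x. 2 *\<^sub>R (x - p))" for p :: 'b
    unfolding C1_grad_def power2_norm_eq_inner
    by (auto intro!: derivative_eq_intros continuous_intros simp: fun_eq_iff inner_commute algebra_simps)
  then have "C1_grad (\<lambda>x. (norm (x - p))\<^sup>2 / (4 * r\<^sup>2)) (\<lambda>x. (1 / (4 * r\<^sup>2)) *\<^sub>R (2 *\<^sub>R (x - p)))" for p :: 'b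
    by (rule C1_grad_compose[where q="\<lambda>t. t / (4 * r\<^sup>2)"]) (use r in \<open>auto intro!: derivative_eq_intros simp: divide_simps power2_eq_square power4_eq_xxxx\<close>)
  then have b: "\<exists>D. C1_grad (b p) D" for p
    unfolding b_def using C1_grad_quad_cut by blast
  then obtain Db where "\<And>p. C1_grad (b p) (Db p)" by metis
  then have s: "C1_grad s (\<lambda>x. \<Sum>p\<in>P. Db p x)"
    unfolding s_def by (intro C1_grad_sum)
  then have "C1_grad (\<lambda>x. 16 / 9 * s x) (\<lambda>x. (16 / 9) *\<^sub>R (\<Sum>p\<in>P. Db p x))"
    by (rule C1_grad_compose) (auto intro!: derivative_eq_intros continuous_intros)
  then have "\<exists>D. C1_grad (\<lambda>x. quad_cut (16 / 9 * s x)) D"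
    using C1_grad_quad_cut by blast
  then obtain D where "C1_grad (\<lambda>x. quad_cut (16 / 9 * s x)) D" by blast
  then have "C1_grad \<psi> (\<lambda>x. (-1) *\<^sub>R D x)"
    unfolding \<psi>_def by (rule C1_grad_compose) (auto intro!: derivative_eq_intros continuous_intros)
  moreover have b_nn: "0 \<le> b p x" for p x
    unfolding b_def by (simp add: quad_cut_range)
  then have s_nn: "0 \<le> s x" for x unfolding s_def by (simp add: sum_nonneg)
  then have "0 \<le> \<psi> x \<and> \<psi> x \<le> 1" for x
    unfolding \<psi>_def using quad_cut_range[of "16 / 9 * s x"] by simp
  moreover have "\<psi> x = 1" if x: "x \<in> \<Omega>" for x
  proof -
    obtain p where p: "p \<in> P" "dist p x < r" using P(3) x by auto
    have "(norm (x - p))\<^sup>2 / (4 * r\<^sup>2) \<le> 1 / 4"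
    proof -
      have "(norm (x - p))\<^sup>2 \<le> r\<^sup>2" using p by (intro power_mono) (auto simp: dist_norm norm_minus_commute)
      then show ?thesis using r by (simp add: divide_simps)
    qed
    then have "(3/4)\<^sup>2 \<le> b p x"
      unfolding b_def quad_cut_def by (intro power_mono) auto
    also have "b p x \<le> s x"
      unfolding s_def using P(2) p(1) b_nn by (intro member_le_sum) auto
    finally have "quad_cut (16 / 9 * s x) = 0" by (simp add: quad_cut_def power2_eq_square)
    then show ?thesis by (simp add: \<psi>_def)
  qed
  moreover have "\<exists>p\<in>\<Omega>. dist x p < 2 * r" if "\<psi> x \<noteq> 0" for x
  proof (rule ccontr)
    assume "\<not> (\<exists>p\<in>\<Omega>. dist x p < 2 * r)"
    then have far: "2 * r \<le> norm (x - p)" if "p \<in> P" for p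
      using that P(1) by (force simp: dist_norm)
    have "b p x = 0" if "p \<in> P" for p
    proof -
      have "(2 * r)\<^sup>2 \<le> (norm (x - p))\<^sup>2" using far[OF that] r by (intro power_mono) auto
      then have "1 \<le> (norm (x - p))\<^sup>2 / (4 * r\<^sup>2)" using r by (simp add: power_mult_distrib)
      then show ?thesis by (simp add: b_def quad_cut_def)
    qed
    then have "\<psi> x = 0" by (simp add: \<psi>_def s_def quad_cut_def)
    then show False using that by simp
  qed
  ultimately show ?thesis by blast
qed

lemma C1_translate:
  assumes "C1_grad \<psi> D"
  shows "C1_grad (\<lambda>x. \<psi> (x - a)) (\<lambda>x. D (x - a))"
  unfolding C1_grad_def
proof (intro conjI allI)
  fix x
  have "((\<lambda>x. x - a) has_derivative (\<lambda>v. v)) (at x)"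
    by (auto intro!: derivative_eq_intros)
  from has_derivative_compose[OF this C1_gradD(1)[OF assms]]
  show "((\<lambda>x. \<psi> (x - a)) has_derivative (\<lambda>v. D (x - a) \<bullet> v)) (at x)" .
  show "continuous_on UNIV (\<lambda>x. D (x - a))"
    by (intro continuous_on_compose2[OF C1_gradD(2)[OF assms]] continuous_intros) auto
qed

lemma
  fixes \<psi> :: "'b::euclidean_space \<Rightarrow> real" and e :: 'b
  assumes \<psi>: "C1_grad \<psi> D" and supp: "\<And>x. \<psi> x \<noteq> 0 \<Longrightarrow> norm x \<le> R"
  shows field_in_Cc1: "(\<lambda>x. \<psi> x *\<^sub>R e) \<in> Cc1_fields"
    and divergence_field: "divergence (\<lambda>x. \<psi> x *\<^sub>R e) x = D x \<bullet> e"
proof -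
  have der: "((\<lambda>x. \<psi> x *\<^sub>R e) has_derivative (\<lambda>v. (D x \<bullet> v) *\<^sub>R e)) (at x)" for x
    using C1_gradD(1)[OF \<psi>] by (auto intro!: derivative_eq_intros)
  have fr: "frechet_derivative (\<lambda>x. \<psi> x *\<^sub>R e) (at x) = (\<lambda>v. (D x \<bullet> v) *\<^sub>R e)" for x
    using frechet_derivative_at[OF der] by simp
  have "closure {x. \<psi> x *\<^sub>R e \<noteq> 0} \<subseteq> cball 0 R"
    by (intro closure_minimal) (auto dest: supp)
  then have "compact (closure {x. \<psi> x *\<^sub>R e \<noteq> 0})"
    by (meson bounded_cball bounded_subset closed_closure compact_eq_bounded_closed)
  then show "(\<lambda>x. \<psi> x *\<^sub>R e) \<in> Cc1_fields"
    using C1_gradD(2)[OF \<psi>] der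
    by (auto simp: Cc1_fields_def fr differentiable_def simp del: scaleR_eq_0_iff intro!: continuous_intros)
  show "divergence (\<lambda>x. \<psi> x *\<^sub>R e) x = D x \<bullet> e"
    unfolding divergence_def fr by (simp add: euclidean_inner[of "D x" e])
qed

section \<open>Perimeter and translations\<close>

lemma perimeter_ge:
  fixes \<Omega> :: "'b::euclidean_space set"
  assumes fin: "finite_perimeter \<Omega>" and \<phi>: "\<phi> \<in> Cc1_fields" "\<And>x. norm (\<phi> x) \<le> 1"
  shows "(\<integral>x. indicator \<Omega> x * divergence \<phi> x \<partial>lebesgue) \<le> perimeter \<Omega>"
proof -
  have "ereal (\<integral>x. indicator \<Omega> x * divergence \<phi> x \<partial>lebesgue) \<le> variation (indicator \<Omega>)"
    unfolding variation_def using \<phi> by (intro SUP_upper) auto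
  moreover have "variation (indicator \<Omega> :: 'b \<Rightarrow> real) < \<infinity>"
    using fin by (simp add: finite_perimeter_def bounded_variation_def)
  ultimately show ?thesis
    unfolding perimeter_def by (cases "variation (indicator \<Omega> :: 'b \<Rightarrow> real)") auto
qed

lemma perimeter_nonneg:
  fixes \<Omega> :: "'b::euclidean_space set"
  assumes "finite_perimeter \<Omega>"
  shows "0 \<le> perimeter \<Omega>"
proof -
  have "C1_grad (\<lambda>x::'b. 0) (\<lambda>x. 0)" by (auto simp: C1_grad_def)
  then have "(\<lambda>x::'b. (0::real) *\<^sub>R (0::'b)) \<in> Cc1_fields" "\<And>x. divergence (\<lambda>x::'b. (0::real) *\<^sub>R (0::'b)) x = 0"
    using field_in_Cc1[of "\<lambda>x::'b. 0" "\<lambda>x. 0" 0 0] divergence_field[of "\<lambda>x::'b. 0" "\<lambda>x. 0" 0 0] by auto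
  then show ?thesis using perimeter_ge[OF assms, of "\<lambda>x::'b. (0::real) *\<^sub>R (0::'b)"] by simp
qed

text \<open>By the fundamental theorem, the increment of \<open>\<psi>\<close> is the integral over
  s in [0, 1] of the derivative along \<open>h\<close> at \<open>x - s *\<^sub>R h\<close>. For each
  s this derivative is \<open>norm h\<close> times the divergence of a translate of the field
  \<open>\<psi>\<close> times a unit vector, which is admissible for the perimeter.\<close>

lemma test_function_translate_le:
  fixes \<Omega> :: "'b::euclidean_space set"
  assumes \<Omega>: "compact \<Omega>" "finite_perimeter \<Omega>"
    and \<psi>: "C1_grad \<psi> D" and supp: "\<And>x. \<psi> x \<noteq> 0 \<Longrightarrow> norm x \<le> R" and range: "\<And>x. \<bar>\<psi> x\<bar> \<le> 1"
  shows "(LBINT x. indicator \<Omega> x * (\<psi> x - \<psi> (x - h))) \<le> norm h * perimeter \<Omega>"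
proof (cases "h = 0")
  case False
  define e where "e = h /\<^sub>R norm h"
  have e: "norm e = 1" "h = norm h *\<^sub>R e" using False by (auto simp: e_def)
  have [measurable]: "\<Omega> \<in> sets borel" using \<Omega> by (simp add: borel_compact)
  have [measurable]: "D \<in> borel_measurable borel"
    using C1_gradD(2)[OF \<psi>] by (rule borel_measurable_continuous_onI)
  have slice: "(LBINT x. indicator \<Omega> x * (D (x - s *\<^sub>R h) \<bullet> e)) \<le> perimeter \<Omega>" for s
  proof -
    let ?\<phi> = "\<lambda>x. \<psi> (x - s *\<^sub>R h) *\<^sub>R e"
    note c1 = C1_translate[OF \<psi>, of "s *\<^sub>R h"]
    have sp: "norm x \<le> R + norm (s *\<^sub>R h)" if "\<psi> (x - s *\<^sub>R h) \<noteq> 0" for x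
      using supp[OF that] norm_triangle_sub[of x "s *\<^sub>R h"] by simp
    have "(\<integral>x. indicator \<Omega> x * divergence ?\<phi> x \<partial>lebesgue) \<le> perimeter \<Omega>"
      by (rule perimeter_ge[OF \<Omega>(2) field_in_Cc1[OF c1 sp]]) (use range e in auto)
    moreover have "divergence ?\<phi> x = D (x - s *\<^sub>R h) \<bullet> e" for x
      by (rule divergence_field[OF c1 sp])
    ultimately have "(\<integral>x. indicator \<Omega> x * (D (x - s *\<^sub>R h) \<bullet> e) \<partial>lebesgue) \<le> perimeter \<Omega>"
      by simp
    then show ?thesis by (subst (asm) integral_completion) auto
  qed
  have FTC: "(LBINT s. indicator {0..1} s * (D (x - s *\<^sub>R h) \<bullet> h)) = \<psi> x - \<psi> (x - h)" for x
  proof -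
    have der: "((\<lambda>s. - \<psi> (x - s *\<^sub>R h)) has_real_derivative (D (x - s *\<^sub>R h) \<bullet> h)) (at s)" for s
    proof -
      have "((\<lambda>s. x - s *\<^sub>R h) has_derivative (\<lambda>t. - (t *\<^sub>R h))) (at s)"
        by (auto intro!: derivative_eq_intros)
      from has_derivative_minus[OF has_derivative_compose[OF this C1_gradD(1)[OF \<psi>]]]
      show ?thesis by (simp add: has_field_derivative_def mult_commute_abs)
    qed
    have "(LBINT s. indicator {0..1} s *\<^sub>R (D (x - s *\<^sub>R h) \<bullet> h)) = - \<psi> (x - 1 *\<^sub>R h) - (- \<psi> (x - 0 *\<^sub>R h))"
    proof (rule integral_FTC_Icc)
      show "((\<lambda>s. - \<psi> (x - s *\<^sub>R h)) has_vector_derivative (D (x - s *\<^sub>R h) \<bullet> h)) (at s within {0..1})" for s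
        using der has_real_derivative_iff_has_vector_derivative has_vector_derivative_at_within by blast
      show "continuous_on {0..1} (\<lambda>s. D (x - s *\<^sub>R h) \<bullet> h)"
        by (intro continuous_intros continuous_on_compose2[OF C1_gradD(2)[OF \<psi>]]) auto
    qed auto
    then show ?thesis by simp
  qed
  let ?f = "\<lambda>p::'b \<times> real. indicator \<Omega> (fst p) * (indicator {0..1} (snd p) * (D (fst p - snd p *\<^sub>R h) \<bullet> h))"
  \<comment> \<open>The integrand lives on the compact set \<Omega> \<times> [0, 1], where the
    continuous gradient is bounded; this licenses the exchange of the two integrals.\<close>
  have int: "integrable (lborel \<Otimes>\<^sub>M lborel) ?f"
  proof -
    have "compact ((\<lambda>p. D (fst p - snd p *\<^sub>R h) \<bullet> h) ` (\<Omega> \<times> {0..1::real}))"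
      by (intro compact_continuous_image compact_Times \<Omega> compact_Icc continuous_intros
          continuous_on_compose2[OF C1_gradD(2)[OF \<psi>]]) auto
    then obtain M where M: "\<And>x s. x \<in> \<Omega> \<Longrightarrow> s \<in> {0..1} \<Longrightarrow> \<bar>D (x - s *\<^sub>R h) \<bullet> h\<bar> \<le> M"
      using compact_imp_bounded[THEN bounded_pos[THEN iffD1]] by fastforce
    have cp: "compact (\<Omega> \<times> {0..1::real})"
      by (intro compact_Times \<Omega> compact_Icc)
    have "integrable lborel (\<lambda>p. indicator (\<Omega> \<times> {0..1::real}) p * M)"
      using borel_compact[OF cp] emeasure_compact_finite[OF cp]
      by (intro integrable_mult_left integrable_real_indicator) auto
    then have 1: "integrable (lborel \<Otimes>\<^sub>M lborel) (\<lambda>p. indicator (\<Omega> \<times> {0..1::real}) p * M)"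
      by (simp add: lborel_prod)
    show ?thesis
      by (rule Bochner_Integration.integrable_bound[OF 1])
        (use M in \<open>auto simp: indicator_def intro!: AE_I2 order_trans[OF _ abs_ge_self]\<close>)
  qed
  have int': "integrable (lborel \<Otimes>\<^sub>M lborel) (\<lambda>p. ?f (snd p, fst p))"
    using lborel_pair.integrable_product_swap[OF int] by (simp add: case_prod_unfold)
  have "(LBINT x. indicator \<Omega> x * (\<psi> x - \<psi> (x - h))) = (LBINT x. LBINT s. ?f (x, s))"
    by (simp add: FTC)
  also have "\<dots> = (LBINT s. LBINT x. ?f (x, s))"
    using lborel_pair.integral_fst'[OF int] lborel_pair.integral_fst'[OF int']
      lborel_pair.integral_product_swap[of ?f] borel_measurable_integrable[OF int]
    by (simp add: case_prod_unfold)
  also have "\<dots> \<le> (LBINT s. indicator {0..1::real} s * (norm h * perimeter \<Omega>))"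
  proof (rule integral_mono)
    show "integrable lborel (\<lambda>s. \<integral>x. ?f (x, s) \<partial>lborel)"
      using lborel_pair.integrable_fst'[OF int'] by simp
    show "integrable lborel (\<lambda>s::real. indicator {0..1} s * (norm h * perimeter \<Omega>))"
      by (intro integrable_mult_left integrable_real_indicator) auto
    fix s :: real
    have "(LBINT x. ?f (x, s)) = (LBINT x. (indicator {0..1} s * norm h) * (indicator \<Omega> x * (D (x - s *\<^sub>R h) \<bullet> e)))"
      using e(2) by (intro Bochner_Integration.integral_cong) (auto, metis inner_scaleR_right)
    also have "\<dots> = (indicator {0..1} s * norm h) * (LBINT x. indicator \<Omega> x * (D (x - s *\<^sub>R h) \<bullet> e))"
      by (rule integral_mult_right_zero)
    also have "\<dots> \<le> (indicator {0..1} s * norm h) * perimeter \<Omega>"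
      by (intro mult_left_mono slice) auto
    finally show "(LBINT x. ?f (x, s)) \<le> indicator {0..1} s * (norm h * perimeter \<Omega>)" by simp
  qed
  also have "\<dots> = norm h * perimeter \<Omega>" by simp
  finally show ?thesis .
qed auto

text \<open>As \<Omega> is closed, cutoffs supported in shrinking neighbourhoods tend to its
  indicator at every point, and the inequality for test functions passes to the limit by
  domination.\<close>

lemma measure_diff_translate_le:
  fixes \<Omega> :: "'b::euclidean_space set"
  assumes \<Omega>: "compact \<Omega>" "finite_perimeter \<Omega>"
  shows "measure lborel (\<Omega> - {x. x - h \<in> \<Omega>}) \<le> norm h * perimeter \<Omega>"
proof -
  have [measurable]: "\<Omega> \<in> sets borel" using \<Omega> by (simp add: borel_compact)
  have "\<forall>n. \<exists>\<psi> D. C1_grad \<psi> D \<and> (\<forall>x. 0 \<le> \<psi> x \<and> \<psi> x \<le> 1) \<and> (\<forall>x\<in>\<Omega>. \<psi> x = 1) \<and>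
    (\<forall>x. \<psi> x \<noteq> 0 \<longrightarrow> (\<exists>p\<in>\<Omega>. dist x p < 2 * inverse (real (Suc n))))"
    by (intro allI C1_cutoff_exists \<Omega>) simp
  then obtain \<psi> D where \<psi>: "\<And>n. C1_grad (\<psi> n) (D n)" "\<And>n x. 0 \<le> \<psi> n x \<and> \<psi> n x \<le> 1"
      "\<And>n x. x \<in> \<Omega> \<Longrightarrow> \<psi> n x = 1" "\<And>n x. \<psi> n x \<noteq> 0 \<Longrightarrow> \<exists>p\<in>\<Omega>. dist x p < 2 * inverse (real (Suc n))"
    by metis
  have [measurable]: "\<psi> n \<in> borel_measurable borel" for n
    using C1_grad_continuous[OF \<psi>(1)] by (rule borel_measurable_continuous_onI)
  obtain B where B: "\<And>x. x \<in> \<Omega> \<Longrightarrow> norm x \<le> B"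
    using compact_imp_bounded[OF \<Omega>(1)] unfolding bounded_iff by auto
  have supp: "norm x \<le> B + 2" if nz: "\<psi> n x \<noteq> 0" for n x
  proof -
    obtain p where "p \<in> \<Omega>" "dist x p < 2 * inverse (real (Suc n))" using \<psi>(4)[OF nz] by auto
    moreover have "inverse (real (Suc n)) \<le> 1" by (simp add: inverse_le_1_iff)
    ultimately show ?thesis using B[of p] norm_triangle_sub[of x p] by (simp add: dist_norm)
  qed
  have lim: "(\<lambda>n. \<psi> n x) \<longlonglongrightarrow> indicator \<Omega> x" for x
  proof (cases "x \<in> \<Omega>")
    case False
    have "open (- \<Omega>)" using \<Omega>(1) compact_imp_closed by blast
    then obtain d where d: "d > 0" "ball x d \<subseteq> - \<Omega>" using False by (auto simp: open_contains_ball)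
    have "(\<lambda>n. 2 * inverse (real (Suc n))) \<longlonglongrightarrow> 2 * 0"
      by (intro tendsto_intros LIMSEQ_inverse_real_of_nat)
    then have "\<forall>\<^sub>F n in sequentially. 2 * inverse (real (Suc n)) < d"
      by (rule order_tendstoD(2)) (use d(1) in simp)
    then have "\<forall>\<^sub>F n in sequentially. \<psi> n x = 0"
    proof eventually_elim
      case (elim n)
      then show ?case using \<psi>(4)[of n x] d(2) by force
    qed
    then show ?thesis using False by (simp add: tendsto_eventually)
  qed (simp add: \<psi>)
  have "(\<lambda>n. \<integral>x. indicator \<Omega> x * (\<psi> n x - \<psi> n (x - h)) \<partial>lborel)
      \<longlonglongrightarrow> (LBINT x. indicator \<Omega> x * (indicator \<Omega> x - indicator \<Omega> (x - h)))"
  proof (rule integral_dominated_convergence[where w="indicat_real \<Omega>"])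
    show "integrable lborel (indicat_real \<Omega>)"
      using emeasure_compact_finite[OF \<Omega>(1)] by (intro integrable_real_indicator) auto
    show "AE x in lborel. (\<lambda>n. indicator \<Omega> x * (\<psi> n x - \<psi> n (x - h))) \<longlonglongrightarrow> indicator \<Omega> x * (indicat_real \<Omega> x - indicator \<Omega> (x - h))"
      by (intro AE_I2 tendsto_intros lim)
    have "\<bar>\<psi> n x - \<psi> n y\<bar> \<le> 1" for n x y using \<psi>(2)[of n x] \<psi>(2)[of n y] by linarith
    then show "AE x in lborel. norm (indicator \<Omega> x * (\<psi> n x - \<psi> n (x - h))) \<le> indicat_real \<Omega> x" for n
      by (auto simp: indicator_def)
  qed measurable
  also have "(\<lambda>x. indicator \<Omega> x * (indicat_real \<Omega> x - indicator \<Omega> (x - h))) = indicat_real (\<Omega> - {x. x - h \<in> \<Omega>})"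
    by (auto simp: indicator_def)
  finally have "(\<lambda>n. \<integral>x. indicator \<Omega> x * (\<psi> n x - \<psi> n (x - h)) \<partial>lborel) \<longlonglongrightarrow> measure lborel (\<Omega> - {x. x - h \<in> \<Omega>})"
    by simp
  then show ?thesis
    by (rule LIMSEQ_le_const2)
      (use \<psi>(2) in \<open>auto intro!: exI[of _ 0] test_function_translate_le[OF \<Omega> \<psi>(1) supp] simp: abs_le_iff\<close>)
qed

section \<open>The localization operator\<close>

text \<open>The difference splits into a modulated translation increment, small by continuity of
  translations in L2, and a difference of modulations acting on a fixed translate of
  \<open>g\<close>, small by dominated convergence.\<close>

lemma tf_shift_continuous:
  fixes g :: "'a::euclidean_space \<Rightarrow> complex"
  assumes g: "g \<in> L2B"
  shows "((\<lambda>w. nsq (\<lambda>t. tf_shift g w t - tf_shift g z t)) \<longlongrightarrow> 0) (at z)"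
proof -
  have [measurable]: "g \<in> borel_measurable borel" using g by measurable
  have "(\<lambda>n. nsq (\<lambda>t. tf_shift g (w n) t - tf_shift g z t)) \<longlonglongrightarrow> 0" if w: "w \<longlonglongrightarrow> z" for w
  proof (rule tendsto_sandwich[OF _ _ tendsto_const])
    let ?a = "\<lambda>n. nsq (\<lambda>t. g (t - (fst (w n) - fst z)) - g t)"
    let ?c = "\<lambda>n t. cis (2 * pi * (snd (w n) \<bullet> t)) - cis (2 * pi * (snd z \<bullet> t))"
    let ?b = "\<lambda>n. \<integral>t. (cmod (?c n t))\<^sup>2 * (cmod (g (t - fst z)))\<^sup>2 \<partial>lborel"
    have fst0: "(\<lambda>n. fst (w n) - fst z) \<longlonglongrightarrow> 0"
      using tendsto_fst[OF w] by (simp add: LIM_zero_iff)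
    have gz: "(\<lambda>t. g (t - fst z)) \<in> L2B" by (rule L2_of_translate(1)[OF g])
    have cis: "isCont cis a" for a
      using continuous_on_eq_continuous_at[of UNIV cis] by (simp add: continuous_on_cis)
    have c4: "(cmod (cis a - cis b))\<^sup>2 \<le> 4" for a b
    proof -
      have "cmod (cis a - cis b) \<le> 2" using norm_triangle_ineq4[of "cis a" "cis b"] by simp
      then have "(cmod (cis a - cis b))\<^sup>2 \<le> 2\<^sup>2" by (intro power_mono) auto
      then show ?thesis by simp
    qed
    have "?b \<longlonglongrightarrow> (\<integral>t. 0 \<partial>(lborel::'a measure))"
    proof (rule integral_dominated_convergence[where w="\<lambda>t. 4 * (cmod (g (t - fst z)))\<^sup>2"])
      show "integrable lborel (\<lambda>t. 4 * (cmod (g (t - fst z)))\<^sup>2)"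
        by (intro integrable_mult_right L2_of_integrable gz)
      show "AE t in lborel. norm ((cmod (?c n t))\<^sup>2 * (cmod (g (t - fst z)))\<^sup>2) \<le> 4 * (cmod (g (t - fst z)))\<^sup>2" for n
        using c4 by (auto intro!: mult_right_mono)
      show "AE t in lborel. (\<lambda>n. (cmod (?c n t))\<^sup>2 * (cmod (g (t - fst z)))\<^sup>2) \<longlonglongrightarrow> 0"
      proof (rule AE_I2)
        fix t
        have "(\<lambda>n. cis (2 * pi * (snd (w n) \<bullet> t))) \<longlonglongrightarrow> cis (2 * pi * (snd z \<bullet> t))"
          by (intro isCont_tendsto_compose[OF cis] tendsto_intros tendsto_snd w)
        then have "(\<lambda>n. ?c n t) \<longlonglongrightarrow> 0" by (simp add: LIM_zero_iff)
        then have "(\<lambda>n. (cmod (?c n t))\<^sup>2 * (cmod (g (t - fst z)))\<^sup>2) \<longlonglongrightarrow> (cmod 0)\<^sup>2 * (cmod (g (t - fst z)))\<^sup>2"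
          by (intro tendsto_intros)
        then show "(\<lambda>n. (cmod (?c n t))\<^sup>2 * (cmod (g (t - fst z)))\<^sup>2) \<longlonglongrightarrow> 0" by simp
      qed
    qed measurable
    then have "(\<lambda>n. 2 * ?a n + 2 * ?b n) \<longlonglongrightarrow> 2 * 0 + 2 * 0"
      by (intro tendsto_intros L2_translate_tendsto[OF g fst0]) simp
    then show "(\<lambda>n. 2 * ?a n + 2 * ?b n) \<longlonglongrightarrow> 0" by simp
    have "nsq (\<lambda>t. tf_shift g (w n) t - tf_shift g z t) \<le> 2 * ?a n + 2 * ?b n" for n
    proof -
      let ?u = "\<lambda>t. cis (2 * pi * (snd (w n) \<bullet> t)) * (g (t - fst (w n)) - g (t - fst z))"
      let ?v = "\<lambda>t. ?c n t * g (t - fst z)"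
      have d: "(\<lambda>t. g (t - fst (w n)) - g (t - fst z)) \<in> L2B"
        by (intro L2_of_diff L2_of_translate g)
      have u: "?u \<in> L2B" using L2_of_integrable[OF d] by (simp add: L2_of_def norm_mult)
      have "integrable lborel (\<lambda>t. (cmod (?v t))\<^sup>2)"
        by (rule Bochner_Integration.integrable_bound[OF integrable_mult_right[OF L2_of_integrable[OF gz], of 4]])
          (use c4 in \<open>auto simp: norm_mult power_mult_distrib intro!: mult_right_mono\<close>)
      then have v: "?v \<in> L2B" by (simp add: L2_of_def)
      have "(\<lambda>t. tf_shift g (w n) t - tf_shift g z t) = (\<lambda>t. ?u t + ?v t)"
        by (auto simp: tf_shift_def algebra_simps)
      then have "nsq (\<lambda>t. tf_shift g (w n) t - tf_shift g z t) \<le> 2 * nsq ?u + 2 * nsq ?v"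
        using L2_sq_add_le[OF u v] by simp
      also have "nsq ?v = ?b n" by (simp add: L2_sq_def norm_mult power_mult_distrib)
      also have "nsq ?u = nsq (\<lambda>t. g (t - fst (w n)) - g (t - fst z))"
        by (simp add: L2_sq_def norm_mult)
      also have "\<dots> = ?a n"
        using L2_of_translate(2)[OF L2_of_diff[OF L2_of_translate(1)[OF g] g], of "fst z" "fst (w n) - fst z"]
        by (simp add: algebra_simps)
      finally show ?thesis .
    qed
    then show "\<forall>\<^sub>F n in sequentially. nsq (\<lambda>t. tf_shift g (w n) t - tf_shift g z t) \<le> 2 * ?a n + 2 * ?b n"
      by simp
  qed (simp add: L2_sq_nonneg)
  then show ?thesis unfolding tendsto_at_iff_sequentially comp_def by blast
qed

section \<open>The short-time Fourier transform as an isometry\<close>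

locale tf_window =
  fixes g :: "'a::euclidean_space \<Rightarrow> complex"
  assumes g: "g \<in> L2B" and g_norm: "nsq g = 1"
begin

definition V :: "('a \<Rightarrow> complex) \<Rightarrow> 'a \<times> 'a \<Rightarrow> complex" where
  "V f z = ip f (tf_shift g z)"

lemma g_measurable [measurable]: "g \<in> borel_measurable borel"
  using g by measurable

lemma V_measurable [measurable]: "f \<in> borel_measurable borel \<Longrightarrow> V f \<in> borel_measurable borel"
  unfolding V_def[abs_def] by (intro L2_ip_tf_shift_measurable g_measurable)

lemma V_diff: "f \<in> L2B \<Longrightarrow> h \<in> L2B \<Longrightarrow> V (\<lambda>t. f t - h t) z = V f z - V h z"
  unfolding V_def by (intro L2_ip_diff_left L2_of_tf_shift g)

lemma V_cmult: "V (\<lambda>t. c * f t) z = c * V f z"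
  unfolding V_def by (rule L2_ip_cmult_left)

lemma V_sum: "(\<And>i. i \<in> F \<Longrightarrow> f i \<in> L2B) \<Longrightarrow> V (\<lambda>t. \<Sum>i\<in>F. f i t) z = (\<Sum>i\<in>F. V (f i) z)"
  unfolding V_def by (intro L2_ip_sum_left L2_of_tf_shift g)

lemma cmod_V_le: "f \<in> L2B \<Longrightarrow> (cmod (V f z))\<^sup>2 \<le> nsq f"
  unfolding V_def using L2_ip_Cauchy_Schwarz[OF _ L2_of_tf_shift[OF g], of f z] by (simp add: L2_sq_tf_shift g g_norm)

lemma L2_of_V:
  assumes f: "f \<in> L2B"
  shows "V f \<in> L2B" "nsq (V f) = nsq f"
proof -
  have [measurable]: "f \<in> borel_measurable borel" using f by measurable
  have eq: "(\<integral>\<^sup>+z. ennreal ((cmod (V f z))\<^sup>2) \<partial>lborel) = ennreal (nsq f)"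
    unfolding V_def using Moyal[OF f g] by (simp add: g_norm)
  then have "integrable lborel (\<lambda>z. (cmod (V f z))\<^sup>2)"
    by (intro integrableI_bounded) auto
  then show sq: "V f \<in> L2B" by (simp add: L2_of_def)
  show "nsq (V f) = nsq f"
    using ennreal_L2_sq[OF sq] eq by (simp add: L2_sq_nonneg)
qed

end

section \<open>Restriction to the domain and the adjoint transform\<close>

locale tf_localization = tf_window g for g :: "'a::euclidean_space \<Rightarrow> complex" +
  fixes \<Omega> :: "('a \<times> 'a) set"
  assumes \<Omega>: "compact \<Omega>"
begin

text \<open>A density rather than a restricted space: the underlying space and the measurable sets
  remain those of phase space, so measurability facts carry over.\<close>

definition W :: "('a \<times> 'a) measure" where
  "W = density lborel (\<lambda>z. ennreal (indicator \<Omega> z))"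

lemma sets_W [simp, measurable_cong]: "sets W = sets borel"
  by (simp add: W_def)

lemma space_W [simp]: "space W = UNIV"
  by (simp add: W_def)

lemma measurable_W [simp]: "measurable W N = measurable borel N"
  by (rule measurable_cong_sets) auto

lemma \<Omega>_borel [measurable]: "\<Omega> \<in> sets borel"
  using \<Omega> by (simp add: borel_compact)

lemma emeasure_\<Omega>: "emeasure lborel \<Omega> = ennreal (measure lborel \<Omega>)"
  using emeasure_compact_finite[OF \<Omega>] by (simp add: emeasure_eq_ennreal_measure)

lemma emeasure_W: "emeasure W UNIV = ennreal (measure lborel \<Omega>)"
  by (simp add: W_def emeasure_density emeasure_\<Omega> ennreal_indicator)

lemma measure_W: "measure W UNIV = measure lborel \<Omega>"
  using emeasure_W by (simp add: measure_def)

sublocale W: finite_measure W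
  by (rule finite_measureI) (simp add: emeasure_W)

sublocale LW: pair_sigma_finite lborel W ..

lemma nn_integral_W:
  assumes [measurable]: "f \<in> borel_measurable borel"
  shows "(\<integral>\<^sup>+z. f z \<partial>W) = (\<integral>\<^sup>+z. indicator \<Omega> z * f z \<partial>lborel)"
  unfolding W_def by (subst nn_integral_density) (auto simp: ennreal_indicator)

lemma integral_W:
  fixes f :: "'a \<times> 'a \<Rightarrow> 'b::{banach,second_countable_topology}"
  assumes [measurable]: "f \<in> borel_measurable borel"
  shows "(\<integral>z. f z \<partial>W) = (LBINT z. indicator \<Omega> z *\<^sub>R f z)"
  unfolding W_def by (subst integral_density) auto

lemma L2_of_W_of_bounded:
  assumes [measurable]: "F \<in> borel_measurable borel" and B: "\<And>z. z \<in> \<Omega> \<Longrightarrow> (cmod (F z))\<^sup>2 \<le> B"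
  shows "F \<in> L2_of W" "L2_sq W F \<le> B * measure lborel \<Omega>"
proof -
  have ae: "AE z in W. (cmod (F z))\<^sup>2 \<le> B"
    unfolding W_def by (subst AE_density) (use B in \<open>auto simp: indicator_def\<close>)
  have "integrable W (\<lambda>z. (cmod (F z))\<^sup>2)"
    by (rule W.integrable_const_bound[where B=B]) (use ae in auto)
  then show "F \<in> L2_of W" by (simp add: L2_of_def)
  have "L2_sq W F \<le> (\<integral>z. B \<partial>W)"
    unfolding L2_sq_def using ae \<open>integrable W (\<lambda>z. (cmod (F z))\<^sup>2)\<close> by (intro integral_mono_AE) auto
  then show "L2_sq W F \<le> B * measure lborel \<Omega>" by (simp add: measure_W mult.commute)
qed

lemma L2_of_W_V:
  assumes f: "f \<in> L2B"
  shows "V f \<in> L2_of W" "L2_sq W (V f) \<le> nsq f"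
proof -
  have [measurable]: "f \<in> borel_measurable borel" using f by measurable
  show sq: "V f \<in> L2_of W"
    by (rule L2_of_W_of_bounded(1)[where B="nsq f"]) (auto intro: cmod_V_le f)
  have "ennreal (L2_sq W (V f)) = (\<integral>\<^sup>+z. indicator \<Omega> z * ennreal ((cmod (V f z))\<^sup>2) \<partial>lborel)"
    by (subst ennreal_L2_sq[OF sq, symmetric], subst nn_integral_W) auto
  also have "\<dots> \<le> (\<integral>\<^sup>+z. ennreal ((cmod (V f z))\<^sup>2) \<partial>lborel)"
    by (intro nn_integral_mono) (auto simp: indicator_def)
  also have "\<dots> = ennreal (nsq f)"
    using ennreal_L2_sq[OF L2_of_V(1)[OF f]] L2_of_V(2)[OF f] by simp
  finally show "L2_sq W (V f) \<le> nsq f" by (simp add: L2_sq_nonneg)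
qed

text \<open>The adjoint of \<open>V\<close> regarded as a map into L2 of \<open>W\<close>;
  adjointness is proved in \<open>L2_ip_S\<close>.\<close>

definition S :: "('a \<times> 'a \<Rightarrow> complex) \<Rightarrow> 'a \<Rightarrow> complex" where
  "S F t = (\<integral>z. F z * tf_shift g z t \<partial>W)"

definition H :: "('a \<Rightarrow> complex) \<Rightarrow> 'a \<Rightarrow> complex" where
  "H f = S (V f)"

lemma S_measurable [measurable]:
  assumes [measurable]: "F \<in> borel_measurable borel"
  shows "S F \<in> borel_measurable borel"
proof -
  have "(\<lambda>p. F (snd p) * tf_shift g (snd p) (fst p)) \<in> borel_measurable (borel \<Otimes>\<^sub>M W)"
    by measurable
  then show ?thesis
    unfolding S_def using W.borel_measurable_lebesgue_integral[of "\<lambda>t z. F z * tf_shift g z t" borel]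
    by (simp add: case_prod_unfold)
qed

text \<open>The modulus of \<open>tf_shift g z t\<close> does not depend on the frequency, so
  boundedness of \<Omega> in frequency makes its square integrable over \<Omega>. Hence
  \<open>S F t\<close> converges absolutely at every \<open>t\<close> when \<open>F\<close> is in L2
  of \<open>W\<close>.\<close>

lemma S_cnj_tf_shift:
  shows "(\<lambda>z. cnj (tf_shift g z t)) \<in> L2_of W"
proof -
  obtain R where R: "R > 0" "\<Omega> \<subseteq> cball 0 R"
    using compact_imp_bounded[OF \<Omega>] unfolding bounded_pos by (auto simp: subset_iff)
  have sub: "indicator \<Omega> z \<le> (indicator (cball (0::'a) R) (snd z) :: ennreal)" for z
  proof -
    have "norm (snd z) \<le> norm z" by (metis norm_snd_le surjective_pairing)
    then show ?thesis using R(2) by (force simp: indicator_def)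
  qed
  have "(\<integral>\<^sup>+z. ennreal ((cmod (tf_shift g z t))\<^sup>2) \<partial>W) = (\<integral>\<^sup>+z. indicator \<Omega> z * ennreal ((cmod (g (t - fst z)))\<^sup>2) \<partial>lborel)"
    by (subst nn_integral_W) (auto simp: tf_shift_def norm_mult)
  also have "\<dots> \<le> (\<integral>\<^sup>+z. ennreal ((cmod (g (t - fst z)))\<^sup>2) * indicator (cball (0::'a) R) (snd z) \<partial>lborel)"
    unfolding mult.commute[of "indicator \<Omega> _"] by (intro nn_integral_mono mult_left_mono sub) simp
  also have "\<dots> = (\<integral>\<^sup>+x. \<integral>\<^sup>+y. ennreal ((cmod (g (t - x)))\<^sup>2) * indicator (cball (0::'a) R) y \<partial>lborel \<partial>lborel)"
  proof -
    have [measurable]: "(indicator (cball (0::'a) R) :: 'a \<Rightarrow> ennreal) \<in> borel_measurable borel"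
      by (intro borel_measurable_indicator) simp
    have "(\<lambda>p::'a \<times> 'a. (indicator (cball (0::'a) R) (snd p) :: ennreal)) \<in> borel_measurable borel"
      by (rule measurable_compose[OF borel_measurable_fst_snd(2)]) measurable
    then show ?thesis by (subst lborel_Tonelli(1)) auto
  qed
  also have "\<dots> = (\<integral>\<^sup>+x. ennreal ((cmod (g (t - x)))\<^sup>2) \<partial>lborel) * emeasure lborel (cball (0::'a) R)"
    by (simp add: nn_integral_cmult_indicator nn_integral_multc)
  also have "(\<integral>\<^sup>+x. ennreal ((cmod (g (t - x)))\<^sup>2) \<partial>lborel) = (\<integral>\<^sup>+x. ennreal ((cmod (g x))\<^sup>2) \<partial>lborel)"
    by (rule nn_integral_reflect[of "\<lambda>x. ennreal ((cmod (g x))\<^sup>2)"]) measurable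
  also have "\<dots> * emeasure lborel (cball (0::'a) R) < \<infinity>"
    using emeasure_compact_finite[OF compact_cball[of "0::'a" R]]
    by (simp add: ennreal_L2_sq[OF g] ennreal_mult_less_top)
  finally have "integrable W (\<lambda>z. (cmod (tf_shift g z t))\<^sup>2)"
    by (intro integrableI_bounded) auto
  then show ?thesis by (simp add: L2_of_def)
qed

lemma S_eq_L2_ip: "S F t = L2_ip W F (\<lambda>z. cnj (tf_shift g z t))"
  by (simp add: S_def L2_ip_def)

lemma S_diff: "F \<in> L2_of W \<Longrightarrow> G \<in> L2_of W \<Longrightarrow> S (\<lambda>z. F z - G z) t = S F t - S G t"
  unfolding S_eq_L2_ip by (intro L2_ip_diff_left S_cnj_tf_shift)

lemma S_cmult: "S (\<lambda>z. c * F z) t = c * S F t"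
  unfolding S_eq_L2_ip by (rule L2_ip_cmult_left)

text \<open>A Hilbert-Schmidt estimate: Cauchy-Schwarz at each \<open>t\<close>, then Tonelli, every
  shifted window having norm 1.\<close>

lemma L2_of_S:
  assumes F: "F \<in> L2_of W"
  shows "S F \<in> L2B" "nsq (S F) \<le> measure lborel \<Omega> * L2_sq W F"
proof -
  have [measurable]: "F \<in> borel_measurable borel" using F by (auto simp: L2_of_def)
  have "(\<integral>\<^sup>+t. ennreal ((cmod (S F t))\<^sup>2) \<partial>lborel) \<le> (\<integral>\<^sup>+t. ennreal (L2_sq W F) * (\<integral>\<^sup>+z. ennreal ((cmod (tf_shift g z t))\<^sup>2) \<partial>W) \<partial>lborel)"
  proof (rule nn_integral_mono)
    fix t
    have "(\<integral>\<^sup>+z. ennreal ((cmod (tf_shift g z t))\<^sup>2) \<partial>W) = ennreal (L2_sq W (\<lambda>z. cnj (tf_shift g z t)))"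
      using ennreal_L2_sq[OF S_cnj_tf_shift[of t]] by simp
    then show "ennreal ((cmod (S F t))\<^sup>2) \<le> ennreal (L2_sq W F) * (\<integral>\<^sup>+z. ennreal ((cmod (tf_shift g z t))\<^sup>2) \<partial>W)"
      using L2_ip_Cauchy_Schwarz[OF F S_cnj_tf_shift[of t]]
      by (simp add: S_eq_L2_ip ennreal_mult[symmetric] L2_sq_nonneg ennreal_leI)
  qed
  also have "\<dots> = ennreal (L2_sq W F) * (\<integral>\<^sup>+t. \<integral>\<^sup>+z. ennreal ((cmod (tf_shift g z t))\<^sup>2) \<partial>W \<partial>lborel)"
    by (intro nn_integral_cmult) measurable
  also have "(\<integral>\<^sup>+t. \<integral>\<^sup>+z. ennreal ((cmod (tf_shift g z t))\<^sup>2) \<partial>W \<partial>lborel) = (\<integral>\<^sup>+z. \<integral>\<^sup>+t. ennreal ((cmod (tf_shift g z t))\<^sup>2) \<partial>lborel \<partial>W)"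
    by (rule LW.Fubini'[symmetric]) (simp add: case_prod_unfold)
  also have "\<dots> = ennreal (measure lborel \<Omega>)"
    by (simp add: ennreal_L2_sq L2_of_tf_shift g L2_sq_tf_shift g_norm emeasure_W)
  finally have le: "(\<integral>\<^sup>+t. ennreal ((cmod (S F t))\<^sup>2) \<partial>lborel) \<le> ennreal (L2_sq W F * measure lborel \<Omega>)"
    by (simp add: ennreal_mult L2_sq_nonneg)
  then have "integrable lborel (\<lambda>t. (cmod (S F t))\<^sup>2)"
    by (intro integrableI_bounded) (auto intro: le_less_trans)
  then show sq: "S F \<in> L2B" by (simp add: L2_of_def)
  show "nsq (S F) \<le> measure lborel \<Omega> * L2_sq W F"
    using le unfolding ennreal_L2_sq[OF sq] by (simp add: L2_sq_nonneg mult.commute)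
qed

text \<open>Fubini applies because the inner absolute integral is at most |F z| times the norm of
  \<open>f\<close>, and \<open>F\<close> is integrable for the finite measure
  \<open>W\<close>.\<close>

lemma L2_ip_S:
  assumes F: "F \<in> L2_of W" and f: "f \<in> L2B"
  shows "ip (S F) f = L2_ip W F (V f)"
proof -
  have [measurable]: "F \<in> borel_measurable borel" "f \<in> borel_measurable borel"
    using F f by (auto simp: L2_of_def)
  have "(\<integral>\<^sup>+z. \<integral>\<^sup>+t. ennreal (cmod (F z * tf_shift g z t * cnj (f t))) \<partial>lborel \<partial>W)
    \<le> (\<integral>\<^sup>+z. ennreal (cmod (F z)) * ennreal (sqrt (nsq f)) \<partial>W)"
  proof (rule nn_integral_mono)
    fix z
    have "(LBINT t. cmod (tf_shift g z t) * cmod (f t))\<^sup>2 \<le> nsq f"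
      using integral_norm_mult_le[OF L2_of_tf_shift[OF g, of z] f] by (simp add: L2_sq_tf_shift g g_norm)
    then have "(LBINT t. cmod (tf_shift g z t) * cmod (f t)) \<le> sqrt (nsq f)"
      by (rule real_le_rsqrt)
    moreover have "(\<integral>\<^sup>+t. ennreal (cmod (tf_shift g z t) * cmod (f t)) \<partial>lborel) = ennreal (LBINT t. cmod (tf_shift g z t) * cmod (f t))"
      by (intro nn_integral_eq_integral L2_of_integrable_norm_mult L2_of_tf_shift g f) auto
    ultimately have "(\<integral>\<^sup>+t. ennreal (cmod (tf_shift g z t) * cmod (f t)) \<partial>lborel) \<le> ennreal (sqrt (nsq f))"
      by (simp add: ennreal_leI)
    then show "(\<integral>\<^sup>+t. ennreal (cmod (F z * tf_shift g z t * cnj (f t))) \<partial>lborel) \<le> ennreal (cmod (F z)) * ennreal (sqrt (nsq f))"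
      by (simp add: norm_mult mult.assoc ennreal_mult nn_integral_cmult mult_left_mono)
  qed
  also have "\<dots> = (\<integral>\<^sup>+z. ennreal (cmod (F z)) \<partial>W) * ennreal (sqrt (nsq f))"
    by (rule nn_integral_multc) simp
  also have "\<dots> < \<infinity>"
  proof -
    have "(\<lambda>z. 1) \<in> L2_of W" by (simp add: L2_of_def)
    then have "integrable W (\<lambda>z. cmod (F z))" using L2_of_integrable_norm_mult[OF F, of "\<lambda>z. 1"] by simp
    then show ?thesis by (simp add: integrable_iff_bounded ennreal_mult_less_top)
  qed
  finally have fin: "(\<integral>\<^sup>+z. \<integral>\<^sup>+t. ennreal (cmod (F z * tf_shift g z t * cnj (f t))) \<partial>lborel \<partial>W) < \<infinity>" .
  have "ip (S F) f = (\<integral>t. \<integral>z. F z * tf_shift g z t * cnj (f t) \<partial>W \<partial>lborel)"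
    by (simp add: L2_ip_def S_def)
  also have "\<dots> = (\<integral>z. \<integral>t. F z * tf_shift g z t * cnj (f t) \<partial>lborel \<partial>W)"
    by (rule LW.Fubini_swap[OF _ fin]) measurable
  also have "\<dots> = L2_ip W F (V f)"
  proof -
    have "cnj (V f z) = (LBINT t. tf_shift g z t * cnj (f t))" for z
      unfolding V_def L2_ip_cnj by (simp add: L2_ip_def)
    then show ?thesis unfolding L2_ip_def[of W] by (simp add: mult.assoc)
  qed
  finally show ?thesis .
qed

lemma
  assumes f: "f \<in> L2B"
  shows L2_of_H: "H f \<in> L2B" and L2_sq_H_le: "nsq (H f) \<le> measure lborel \<Omega> * nsq f"
proof -
  show "H f \<in> L2B" unfolding H_def by (intro L2_of_S L2_of_W_V f)
  have "nsq (H f) \<le> measure lborel \<Omega> * L2_sq W (V f)"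
    unfolding H_def by (intro L2_of_S L2_of_W_V f)
  also have "\<dots> \<le> measure lborel \<Omega> * nsq f"
    by (intro mult_left_mono L2_of_W_V f) auto
  finally show "nsq (H f) \<le> measure lborel \<Omega> * nsq f" .
qed

text \<open>This exhibits \<open>H\<close> as symmetric and non-negative; its quadratic form is the
  energy of the transform inside \<Omega>.\<close>

lemma L2_ip_H: "f \<in> L2B \<Longrightarrow> h \<in> L2B \<Longrightarrow> ip (H f) h = L2_ip W (V f) (V h)"
  unfolding H_def by (intro L2_ip_S L2_of_W_V)

lemma H_diff:
  assumes "f \<in> L2B" "h \<in> L2B"
  shows "H (\<lambda>t. f t - h t) t = H f t - H h t"
proof -
  have "V (\<lambda>t. f t - h t) = (\<lambda>z. V f z - V h z)" by (rule ext) (rule V_diff[OF assms])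
  then show ?thesis unfolding H_def by (simp add: S_diff L2_of_W_V assms)
qed

lemma H_cmult: "H (\<lambda>t. c * f t) t = c * H f t"
  using S_cmult[of c "V f" t] unfolding H_def by (simp add: V_cmult[abs_def])

end

section \<open>Compactness and extremal eigenfunctions\<close>

context tf_localization
begin

text \<open>The difference is an inner product of \<open>f\<close> with a difference of two shifted
  windows, so Cauchy-Schwarz makes the strong continuity of the shifts uniform over unit
  vectors.\<close>

lemma V_equicontinuous:
  assumes e: "0 < e"
  shows "\<exists>d>0. \<forall>f w. f \<in> L2B \<and> nsq f = 1 \<and> norm (z - w) < d \<longrightarrow> cmod (V f z - V f w) < e"
proof -
  have "\<forall>\<^sub>F w in at z. nsq (\<lambda>t. tf_shift g w t - tf_shift g z t) < e\<^sup>2"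
    using order_tendstoD(2)[OF tf_shift_continuous[OF g, of z], of "e\<^sup>2"] e by simp
  then obtain d where d: "d > 0" "\<And>w. w \<noteq> z \<Longrightarrow> dist w z < d \<Longrightarrow> nsq (\<lambda>t. tf_shift g w t - tf_shift g z t) < e\<^sup>2"
    unfolding eventually_at by auto
  have "cmod (V f z - V f w) < e" if f: "f \<in> L2B" "nsq f = 1" and w: "norm (z - w) < d" for f w
  proof (cases "w = z")
    case False
    have "V f w - V f z = ip f (\<lambda>t. tf_shift g w t - tf_shift g z t)"
      unfolding V_def using f by (simp add: L2_ip_diff_right L2_of_tf_shift g)
    then have "(cmod (V f z - V f w))\<^sup>2 \<le> nsq (\<lambda>t. tf_shift g w t - tf_shift g z t)"
      using L2_ip_Cauchy_Schwarz[OF f(1) L2_of_diff[OF L2_of_tf_shift[OF g, of w] L2_of_tf_shift[OF g, of z]]] f(2)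
      by (simp add: norm_minus_commute)
    also have "\<dots> < e\<^sup>2" using d(2)[OF False] w by (simp add: dist_norm norm_minus_commute)
    finally show ?thesis using e by (simp add: power2_less_imp_less)
  qed (use e in auto)
  then show ?thesis using d(1) by blast
qed

text \<open>Arzela-Ascoli gives a subsequence converging uniformly on \<Omega>, hence in L2 of the
  finite measure \<open>W\<close>.\<close>

lemma V_compact:
  fixes f :: "nat \<Rightarrow> 'a \<Rightarrow> complex"
  assumes f: "\<And>n. f n \<in> L2B" "\<And>n. nsq (f n) = 1"
  shows "\<exists>F r. F \<in> L2_of W \<and> strict_mono (r :: nat \<Rightarrow> nat) \<and> (\<lambda>n. L2_sq W (\<lambda>z. V (f (r n)) z - F z)) \<longlonglongrightarrow> 0"
proof -
  obtain G r where G: "continuous_on \<Omega> G" and r: "strict_mono (r :: nat \<Rightarrow> nat)"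
    and unif: "\<And>e. 0 < e \<Longrightarrow> \<exists>N. \<forall>n z. n \<ge> N \<and> z \<in> \<Omega> \<longrightarrow> norm (V (f (r n)) z - G z) < e"
  proof (rule Arzela_Ascoli[OF \<Omega>, of "\<lambda>n. V (f n)" 1])
    show "cmod (V (f n) z) \<le> 1" for n z
      using cmod_V_le[OF f(1), of n z] f(2)[of n] by (simp add: abs_square_le_1)
    show "\<exists>d>0. \<forall>n y. y \<in> \<Omega> \<and> norm (z - y) < d \<longrightarrow> cmod (V (f n) z - V (f n) y) < e"
      if "z \<in> \<Omega>" "0 < e" for z e
      using V_equicontinuous[OF that(2), of z] f by blast
  qed blast
  \<comment> \<open>Extension by 0 makes the limit Borel on all of phase space; \<open>W\<close>
    does not see the complement of \<Omega>.\<close>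
  define F where "F = (\<lambda>z. if z \<in> \<Omega> then G z else 0)"
  have Fm: "F \<in> borel_measurable borel"
    unfolding F_def by (rule borel_measurable_continuous_on_if[OF _ G]) auto
  obtain B where B: "\<And>z. z \<in> \<Omega> \<Longrightarrow> cmod (G z) \<le> B"
    using compact_imp_bounded[OF compact_continuous_image[OF G \<Omega>]] unfolding bounded_iff by auto
  have "(cmod (F z))\<^sup>2 \<le> B\<^sup>2" if "z \<in> \<Omega>" for z
    unfolding F_def using B[OF that] that by (auto intro!: power_mono)
  then have F: "F \<in> L2_of W" by (rule L2_of_W_of_bounded(1)[OF Fm])
  have "(\<lambda>n. L2_sq W (\<lambda>z. V (f (r n)) z - F z)) \<longlonglongrightarrow> 0"
  proof (rule LIMSEQ_I)
    fix e :: real assume e: "0 < e"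
    \<comment> \<open>Adding 1 keeps the quotient meaningful for a null set \<Omega> and makes the
      final inequality strict.\<close>
    define d where "d = sqrt (e / (measure lborel \<Omega> + 1))"
    have m: "measure lborel \<Omega> + 1 > 0" by (simp add: add_nonneg_pos)
    have d: "d > 0" "d\<^sup>2 = e / (measure lborel \<Omega> + 1)" unfolding d_def using e m by auto
    obtain N where N: "\<And>n z. n \<ge> N \<Longrightarrow> z \<in> \<Omega> \<Longrightarrow> cmod (V (f (r n)) z - G z) < d"
      using unif[OF d(1)] by blast
    have "L2_sq W (\<lambda>z. V (f (r n)) z - F z) < e" if n: "n \<ge> N" for n
    proof -
      have fm: "f (r n) \<in> borel_measurable borel" using f(1)[of "r n"] by (simp add: L2_of_def)
      have "L2_sq W (\<lambda>z. V (f (r n)) z - F z) \<le> d\<^sup>2 * measure lborel \<Omega>"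
      proof (rule L2_of_W_of_bounded(2))
        show "(\<lambda>z. V (f (r n)) z - F z) \<in> borel_measurable borel"
          using V_measurable[OF fm] Fm by simp
        show "(cmod (V (f (r n)) z - F z))\<^sup>2 \<le> d\<^sup>2" if "z \<in> \<Omega>" for z
          using N[OF n that] that by (auto simp: F_def intro!: power_mono)
      qed
      also have "\<dots> < e" unfolding d(2) using m e by (simp add: field_simps)
      finally show ?thesis .
    qed
    then show "\<exists>N. \<forall>n\<ge>N. norm (L2_sq W (\<lambda>z. V (f (r n)) z - F z) - 0) < e"
      by (auto simp: L2_sq_nonneg)
  qed
  then show ?thesis using F r by blast
qed

text \<open>Expansion of the square. When \<open>M\<close> is the supremum of the form, the right
  side tends to 0 along a maximizing sequence, whose members are thus approximate
  eigenvectors.\<close>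

lemma L2_sq_H_minus_le:
  assumes f: "f \<in> L2B" and norm1: "nsq f = 1"
    and M: "nsq (H f) \<le> M * L2_sq W (V f)"
  shows "nsq (\<lambda>t. H f t - of_real M * f t) \<le> M\<^sup>2 - M * L2_sq W (V f)"
proof -
  have "nsq (\<lambda>t. H f t - of_real M * f t)
    = nsq (H f) - 2 * Re (ip (H f) (\<lambda>t. of_real M * f t)) + nsq (\<lambda>t. of_real M * f t)"
    using f by (intro L2_sq_diff L2_of_H L2_of_cmult)
  also have "\<dots> = nsq (H f) - 2 * (M * L2_sq W (V f)) + M\<^sup>2"
    by (simp add: L2_ip_cmult_right L2_sq_cmult L2_ip_H f L2_ip_self norm1)
  finally show ?thesis using M by simp
qed

text \<open>
  For a maximizing sequence \<open>f n\<close> of the form \<open>\<langle>H f, f\<rangle>\<close>, the functions \<open>V (f n)\<close> have a subsequence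
  converging uniformly on \<open>\<Omega>\<close> to some \<open>F\<close>, so the eigenfunction is \<open>S F\<close>. As it is explicit, neither
  weak compactness nor completeness of $L^2$ is needed.
\<close>

lemma max_eigenfunction:
  fixes h :: "nat \<Rightarrow> 'a \<Rightarrow> complex"
  assumes h: "\<And>k. k \<in> K \<Longrightarrow> h k \<in> L2B"
      "\<And>k. k \<in> K \<Longrightarrow> AE t in lborel. H (h k) t = of_real (lam k) * h k t"
    and f0: "f0 \<in> L2B" "\<And>k. k \<in> K \<Longrightarrow> ip f0 (h k) = 0"
    and \<mu>: "0 \<le> \<mu>" "\<mu> * nsq f0 < L2_sq W (V f0)"
  shows "\<exists>y M. y \<in> L2B \<and> nsq y > 0 \<and> (\<forall>k\<in>K. ip y (h k) = 0) \<and> \<mu> < M \<and>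
    (AE t in lborel. H y t = of_real M * y t)"
proof -
  define A where "A = {f \<in> L2B. nsq f = 1 \<and> (\<forall>k\<in>K. ip f (h k) = 0)}"
  define q where "q = (\<lambda>f. L2_sq W (V f))"
  define M where "M = Sup (q ` A)"
  have q_scale: "q (\<lambda>t. c * f t) = (cmod c)\<^sup>2 * q f" for c f
    unfolding q_def V_cmult[abs_def] by (rule L2_sq_cmult)
  have norm0: "q f = 0" if "f \<in> L2B" "nsq f = 0" for f
    using L2_of_W_V(2)[OF that(1)] that(2) L2_sq_nonneg[of W "V f"] by (simp add: q_def)
  have normalize: "(\<lambda>t. of_real (1 / sqrt (nsq f)) * f t) \<in> A \<and>
      q (\<lambda>t. of_real (1 / sqrt (nsq f)) * f t) = q f / nsq f"
    if "f \<in> L2B" "nsq f \<noteq> 0" "\<forall>k\<in>K. ip f (h k) = 0" for f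
  proof -
    have "nsq f > 0" using that(2) L2_sq_nonneg[of lborel f] by simp
    moreover have "(\<lambda>t. of_real (1 / sqrt (nsq f)) * f t) \<in> L2B"
      by (intro L2_of_cmult that)
    ultimately show ?thesis
      using that unfolding A_def mem_Collect_eq L2_sq_cmult L2_ip_cmult_left q_scale
      by (auto simp: power_divide norm_divide)
  qed
  have bdd: "bdd_above (q ` A)"
    unfolding bdd_above_def A_def q_def using L2_of_W_V(2) by (intro exI[of _ 1]) fastforce
  have f0_pos: "nsq f0 \<noteq> 0" using norm0[OF f0(1)] \<mu> by (auto simp: q_def)
  have A0: "A \<noteq> {}" using normalize[OF f0(1) f0_pos] f0(2) by blast
  have "q f0 / nsq f0 \<le> M"
    unfolding M_def using normalize[OF f0(1) f0_pos] f0(2) bdd by (metis cSup_upper imageI)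
  moreover have "\<mu> < q f0 / nsq f0"
    using f0_pos L2_sq_nonneg[of lborel f0] \<mu>(2) by (simp add: q_def pos_less_divide_eq)
  ultimately have M\<mu>: "\<mu> < M" by simp
  then have Mpos: "0 < M" using \<mu>(1) by simp
  have q_le: "q f \<le> M * nsq f" if "f \<in> L2B" "\<forall>k\<in>K. ip f (h k) = 0" for f
  proof (cases "nsq f = 0")
    case True
    then show ?thesis using norm0 that by simp
  next
    case False
    have "q f / nsq f \<le> M"
      unfolding M_def using normalize[OF that(1) False that(2)] bdd by (metis cSup_upper imageI)
    then show ?thesis using False L2_sq_nonneg[of lborel f] by (simp add: pos_divide_le_eq)
  qed
  \<comment> \<open>Since \<open>H\<close> is symmetric and the \<open>h k\<close> are
    eigenfunctions, their orthogonal complement is invariant.\<close>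
  have H_perp: "ip (H f) (h k) = 0" if "f \<in> L2B" "\<forall>k\<in>K. ip f (h k) = 0" "k \<in> K" for f k
  proof -
    have "ip (H f) (h k) = cnj (ip (H (h k)) f)"
      by (simp add: L2_ip_H that h L2_ip_cnj)
    also have "ip (H (h k)) f = ip (\<lambda>t. of_real (lam k) * h k t) f"
      by (rule L2_ip_cong_AE)
        (use h(2)[OF that(3)] L2_of_H[OF h(1)[OF that(3)]] h(1)[OF that(3)] that(1) in \<open>auto simp: L2_of_def\<close>)
    also have "\<dots> = of_real (lam k) * cnj (ip f (h k))"
      by (simp add: L2_ip_cmult_left L2_ip_cnj)
    finally show ?thesis using that by simp
  qed
  \<comment> \<open>Cauchy-Schwarz for the form between \<open>f\<close> and \<open>H f\<close>,
    then the bound by \<open>M\<close> at \<open>H f\<close>, which stays in the complement; one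
    factor \<open>nsq (H f)\<close> cancels.\<close>
  have L2_sq_H: "nsq (H f) \<le> M * q f" if f: "f \<in> A" for f
  proof (cases "nsq (H f) = 0")
    case True
    then show ?thesis using Mpos by (simp add: q_def L2_sq_nonneg)
  next
    case False
    have fs: "f \<in> L2B" using f by (simp add: A_def)
    have Hs: "H f \<in> L2B" by (rule L2_of_H[OF fs])
    have "of_real (nsq (H f)) = L2_ip W (V f) (V (H f))"
      by (simp add: L2_ip_H[OF fs Hs, symmetric] L2_ip_self)
    then have "(nsq (H f))\<^sup>2 \<le> q f * q (H f)"
      using L2_ip_Cauchy_Schwarz[OF L2_of_W_V(1)[OF fs] L2_of_W_V(1)[OF Hs]] unfolding q_def
      by (metis abs_of_nonneg norm_of_real L2_sq_nonneg)
    also have "\<dots> \<le> q f * (M * nsq (H f))"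
      using H_perp[OF fs] f by (intro mult_left_mono q_le Hs) (auto simp: A_def q_def L2_sq_nonneg)
    finally have "nsq (H f) * nsq (H f) \<le> (M * q f) * nsq (H f)"
      by (simp add: power2_eq_square mult_ac)
    then show ?thesis using False L2_sq_nonneg[of lborel "H f"] by (simp add: mult_le_cancel_right)
  qed
  have "\<exists>f\<in>A. M - inverse (real (Suc n)) < q f" for n
    using less_cSup_iff[of "q ` A" "M - inverse (real (Suc n))"] A0 bdd by (auto simp: M_def)
  then obtain f where f: "\<And>n. f n \<in> A" "\<And>n. M - inverse (real (Suc n)) < q (f n)" by metis
  have fs: "f n \<in> L2B" "nsq (f n) = 1" "\<And>k. k \<in> K \<Longrightarrow> ip (f n) (h k) = 0" for n
    using f(1)[of n] by (auto simp: A_def)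
  obtain F r where F: "F \<in> L2_of W" and r: "strict_mono r"
    and limF: "(\<lambda>n. L2_sq W (\<lambda>z. V (f (r n)) z - F z)) \<longlonglongrightarrow> 0"
    using V_compact[of f] fs by blast
  define y where "y = S F"
  define m where "m = measure lborel \<Omega>"
  define a where "a = (\<lambda>n. L2_sq W (\<lambda>z. V (f (r n)) z - F z))"
  define b where "b = (\<lambda>n. M\<^sup>2 - M * q (f (r n)))"
  define c where "c = (\<lambda>n. 2 * b n + 2 * (m * a n))"
  have y: "y \<in> L2B" unfolding y_def by (rule L2_of_S(1)[OF F])
  have Mf: "(\<lambda>t. of_real M * f n t) \<in> L2B" for n
    by (intro L2_of_cmult fs)
  have Hy: "nsq (\<lambda>t. H (f (r n)) t - y t) \<le> m * a n" for n
  proof -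
    have "(\<lambda>t. H (f (r n)) t - y t) = S (\<lambda>z. V (f (r n)) z - F z)"
      unfolding H_def y_def by (rule ext) (simp add: S_diff L2_of_W_V fs F)
    then show ?thesis unfolding m_def a_def
      using L2_of_S(2)[OF L2_of_diff[OF L2_of_W_V(1)[OF fs(1)] F]] by simp
  qed
  have Hf: "nsq (\<lambda>t. H (f (r n)) t - of_real M * f (r n) t) \<le> b n" for n
    unfolding b_def q_def by (rule L2_sq_H_minus_le) (use L2_sq_H[OF f(1)] fs in \<open>auto simp: q_def\<close>)
  \<comment> \<open>Both \<open>y\<close> and \<open>M\<close> times \<open>f (r n)\<close> are
    close to \<open>H (f (r n))\<close>.\<close>
  have yM: "nsq (\<lambda>t. y t - of_real M * f (r n) t) \<le> c n" for n
  proof -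
    have "nsq (\<lambda>t. (H (f (r n)) t - of_real M * f (r n) t) + (-1) * (H (f (r n)) t - y t))
      \<le> 2 * nsq (\<lambda>t. H (f (r n)) t - of_real M * f (r n) t) + 2 * nsq (\<lambda>t. (-1) * (H (f (r n)) t - y t))"
      by (intro L2_sq_add_le L2_of_cmult L2_of_diff L2_of_H fs y)
    also have "nsq (\<lambda>t. (-1) * (H (f (r n)) t - y t)) = nsq (\<lambda>t. H (f (r n)) t - y t)"
      unfolding L2_sq_cmult by simp
    finally show ?thesis using Hy[of n] Hf[of n] by (simp add: c_def algebra_simps)
  qed
  have a0: "a \<longlonglongrightarrow> 0" unfolding a_def by (rule limF)
  have b0: "b \<longlonglongrightarrow> 0"
  proof (rule tendsto_sandwich[OF _ _ tendsto_const])
    have "(\<lambda>n. M * inverse (real (Suc (r n)))) \<longlonglongrightarrow> M * 0"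
      using LIMSEQ_subseq_LIMSEQ[OF LIMSEQ_inverse_real_of_nat r] by (intro tendsto_intros) (simp add: comp_def)
    then show "(\<lambda>n. M * inverse (real (Suc (r n)))) \<longlonglongrightarrow> 0" by simp
    show "\<forall>\<^sub>F n in sequentially. b n \<le> M * inverse (real (Suc (r n)))"
    proof (intro always_eventually allI)
      fix n
      have "M * (M - inverse (real (Suc (r n)))) \<le> M * q (f (r n))"
        using f(2)[of "r n"] Mpos by (intro mult_left_mono) auto
      then show "b n \<le> M * inverse (real (Suc (r n)))"
        by (simp add: b_def power2_eq_square right_diff_distrib)
    qed
    show "\<forall>\<^sub>F n in sequentially. 0 \<le> b n"
      by (intro always_eventually allI order_trans[OF L2_sq_nonneg Hf])
  qed
  have c0: "c \<longlonglongrightarrow> 0"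
  proof -
    have "c \<longlonglongrightarrow> 2 * 0 + 2 * (m * 0)" unfolding c_def by (intro tendsto_intros a0 b0)
    then show ?thesis by simp
  qed
  have perp: "ip y (h k) = 0" if k: "k \<in> K" for k
  proof -
    have "(cmod (ip y (h k)))\<^sup>2 \<le> c n * nsq (h k)" for n
    proof -
      have "ip y (h k) = ip (\<lambda>t. y t - of_real M * f (r n) t) (h k)"
        by (simp add: L2_ip_diff_left y Mf h k L2_ip_cmult_left fs)
      then have "(cmod (ip y (h k)))\<^sup>2 \<le> nsq (\<lambda>t. y t - of_real M * f (r n) t) * nsq (h k)"
        using L2_ip_Cauchy_Schwarz[OF L2_of_diff[OF y Mf] h(1)[OF k]] by simp
      also have "\<dots> \<le> c n * nsq (h k)" by (intro mult_right_mono yM L2_sq_nonneg)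
      finally show ?thesis .
    qed
    moreover have "(\<lambda>n. c n * nsq (h k)) \<longlonglongrightarrow> 0 * nsq (h k)" by (intro tendsto_intros c0)
    ultimately have "(cmod (ip y (h k)))\<^sup>2 \<le> 0 * nsq (h k)"
      by (intro LIMSEQ_le_const) auto
    then show ?thesis by simp
  qed
  \<comment> \<open>Were \<open>y\<close> zero, the functions \<open>M\<close> times
    \<open>f (r n)\<close>, all of norm \<open>M\<close> > 0, would tend to 0.\<close>
  have ypos: "nsq y > 0"
  proof (rule ccontr)
    assume "\<not> nsq y > 0"
    then have y0: "nsq y = 0" using L2_sq_nonneg[of lborel y] by simp
    have "M\<^sup>2 \<le> 2 * c n" for n
    proof -
      have "nsq (\<lambda>t. y t + (-1) * (y t - of_real M * f (r n) t))
        \<le> 2 * nsq y + 2 * nsq (\<lambda>t. (-1) * (y t - of_real M * f (r n) t))"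
        by (intro L2_sq_add_le L2_of_cmult[of _ _ "-1"] L2_of_diff y Mf)
      moreover have "nsq (\<lambda>t. (-1) * (y t - of_real M * f (r n) t)) \<le> c n"
        unfolding L2_sq_cmult using yM by simp
      moreover have "nsq (\<lambda>t. y t + (-1) * (y t - of_real M * f (r n) t)) = M\<^sup>2"
        using L2_sq_cmult[of lborel "of_real M" "f (r n)"] by (simp add: fs)
      ultimately show ?thesis using y0 by simp
    qed
    moreover have "(\<lambda>n. 2 * c n) \<longlonglongrightarrow> 2 * 0" by (intro tendsto_intros c0)
    ultimately have "M\<^sup>2 \<le> 2 * 0" using LIMSEQ_le_const[of "\<lambda>n. 2 * c n" "2 * 0" "M\<^sup>2"] by blast
    then show False using Mpos by simp
  qed
  \<comment> \<open>With f for \<open>f (r n)\<close>, H y - M y = H (y - M f) + M (H f - y), and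
    boundedness of \<open>H\<close> makes both terms tend to 0.\<close>
  have "nsq (\<lambda>t. H y t - of_real M * y t) \<le> 2 * (m * c n) + 2 * (M\<^sup>2 * (m * a n))" for n
  proof -
    let ?u = "\<lambda>t. H (\<lambda>t. y t - of_real M * f (r n) t) t"
    let ?v = "\<lambda>t. of_real M * (H (f (r n)) t - y t)"
    have "(\<lambda>t. H y t - of_real M * y t) = (\<lambda>t. ?u t + ?v t)"
      by (rule ext) (simp add: H_diff[OF y Mf] H_cmult algebra_simps)
    moreover have "nsq (\<lambda>t. ?u t + ?v t) \<le> 2 * nsq ?u + 2 * nsq ?v"
      by (intro L2_sq_add_le L2_of_cmult L2_of_diff L2_of_H y Mf fs)
    moreover have "nsq ?u \<le> m * nsq (\<lambda>t. y t - of_real M * f (r n) t)"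
      unfolding m_def by (intro L2_sq_H_le L2_of_diff y Mf)
    moreover have "m * nsq (\<lambda>t. y t - of_real M * f (r n) t) \<le> m * c n"
      by (intro mult_left_mono yM) (simp add: m_def)
    moreover have "nsq ?v \<le> M\<^sup>2 * (m * a n)"
      unfolding L2_sq_cmult using Hy[of n] by (simp add: mult_left_mono)
    ultimately show ?thesis by simp
  qed
  moreover have "(\<lambda>n. 2 * (m * c n) + 2 * (M\<^sup>2 * (m * a n))) \<longlonglongrightarrow> 2 * (m * 0) + 2 * (M\<^sup>2 * (m * 0))"
    by (intro tendsto_intros c0 a0)
  ultimately have "nsq (\<lambda>t. H y t - of_real M * y t) \<le> 2 * (m * 0) + 2 * (M\<^sup>2 * (m * 0))"
    by (intro LIMSEQ_le_const) auto
  then have "nsq (\<lambda>t. H y t - of_real M * y t) = 0"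
    using L2_sq_nonneg[of lborel "\<lambda>t. H y t - of_real M * y t"] by simp
  then have "AE t in lborel. H y t = of_real M * y t"
    using L2_sq_eq_0_iff[OF L2_of_diff[OF L2_of_H[OF y] L2_of_cmult[OF y, of "of_real M"]]] by simp
  then show ?thesis using y ypos perp M\<mu> by blast
qed

end

section \<open>The accumulated spectrogram\<close>

text \<open>Pythagoras without normalization, since it is applied to the eigenfunctions and also to
  their transforms under \<open>W\<close>, whose squared norms are the eigenvalues.\<close>

lemma L2_sq_add_orthogonal_sum:
  assumes "finite K" and u: "u \<in> L2_of M" and e: "\<And>k. k \<in> K \<Longrightarrow> e k \<in> L2_of M"
    and orth: "\<And>j k. j \<in> K \<Longrightarrow> k \<in> K \<Longrightarrow> j \<noteq> k \<Longrightarrow> L2_ip M (e j) (e k) = 0"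
    and ue: "\<And>k. k \<in> K \<Longrightarrow> L2_ip M u (e k) = 0"
  shows "L2_sq M (\<lambda>x. u x + (\<Sum>k\<in>K. c k * e k x)) = L2_sq M u + (\<Sum>k\<in>K. (cmod (c k))\<^sup>2 * L2_sq M (e k))"
  using assms
proof (induction K rule: finite_induct)
  case (insert k K)
  let ?s = "\<lambda>x. u x + (\<Sum>k\<in>K. c k * e k x)"
  have s: "?s \<in> L2_of M"
    using insert.prems by (intro L2_of_add L2_of_sum L2_of_cmult) auto
  have ek: "e k \<in> L2_of M" using insert.prems by auto
  have "L2_ip M ?s (e k) = L2_ip M u (e k) + (\<Sum>j\<in>K. L2_ip M (\<lambda>x. c j * e j x) (e k))"
    using insert.prems by (subst L2_ip_add_left) (auto intro!: L2_ip_sum_left L2_of_sum L2_of_cmult)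
  also have "\<dots> = 0"
  proof -
    have "L2_ip M (e j) (e k) = 0" if "j \<in> K" for j
      using insert.prems(3)[of j k] insert.hyps(2) that by auto
    then show ?thesis using insert.prems(4)[of k] by (simp add: L2_ip_cmult_left)
  qed
  finally have 0: "L2_ip M ?s (e k) = 0" .
  have "(\<lambda>x. u x + (\<Sum>k\<in>insert k K. c k * e k x)) = (\<lambda>x. ?s x + c k * e k x)"
    using insert.hyps by (auto simp: algebra_simps)
  then have "L2_sq M (\<lambda>x. u x + (\<Sum>k\<in>insert k K. c k * e k x)) = L2_sq M ?s + (cmod (c k))\<^sup>2 * L2_sq M (e k)"
    using L2_sq_add[OF s L2_of_cmult[OF ek, of "c k"]] by (simp add: L2_ip_cmult_right 0 L2_sq_cmult)
  then show ?case using insert by simp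
qed simp

context tf_window
begin

text \<open>Covariance: time-frequency shifts compose up to a unimodular factor, so only the
  relative position w - z matters for the modulus.\<close>

lemma cmod_V_tf_shift: "cmod (V (tf_shift g z) w) = cmod (V g (w - z))"
proof -
  have "V (tf_shift g z) w = (LBINT t. (\<lambda>t. tf_shift g z t * cnj (tf_shift g w t)) (t - (- fst z)))"
    unfolding V_def L2_ip_def by (rule integral_translate[symmetric]) measurable
  also have "\<dots> = (LBINT t. cis (2 * pi * ((snd z - snd w) \<bullet> fst z)) * (g t * cnj (tf_shift g (w - z) t)))"
  proof (rule Bochner_Integration.integral_cong[OF refl])
    fix t
    have "cis (2 * pi * (snd z \<bullet> (t + fst z))) * cnj (cis (2 * pi * (snd w \<bullet> (t + fst z))))
      = cis (2 * pi * ((snd z - snd w) \<bullet> fst z)) * cnj (cis (2 * pi * ((snd w - snd z) \<bullet> t)))"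
      by (simp add: cis_cnj cis_mult inner_diff_left inner_add_right algebra_simps)
    then show "(\<lambda>t. tf_shift g z t * cnj (tf_shift g w t)) (t - (- fst z)) = cis (2 * pi * ((snd z - snd w) \<bullet> fst z)) * (g t * cnj (tf_shift g (w - z) t))"
      by (simp add: tf_shift_def algebra_simps)
  qed
  also have "\<dots> = cis (2 * pi * ((snd z - snd w) \<bullet> fst z)) * V g (w - z)"
    unfolding V_def L2_ip_def by (rule integral_mult_right_zero)
  finally show ?thesis by (simp add: norm_mult)
qed

lemma V_g_sq: "(\<integral>\<^sup>+z. ennreal ((cmod (V g z))\<^sup>2) \<partial>lborel) = 1"
  using ennreal_L2_sq[OF L2_of_V(1)[OF g]] L2_of_V(2)[OF g] by (simp add: g_norm)

end

text \<open>Substitution u = w - z and Tonelli: for fixed u, the points of \<Omega> that u moves out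
  of \<Omega> form the set on the right. It serves both for |V g|^2 and, in
  \<open>perimeter_lower_bound\<close>, for the indicator of a ball.\<close>

lemma nn_integral_outside:
  fixes \<Omega> :: "'b::euclidean_space set" and \<phi> :: "'b \<Rightarrow> ennreal"
  assumes [measurable]: "\<Omega> \<in> sets borel" "\<phi> \<in> borel_measurable borel"
  shows "(\<integral>\<^sup>+z. indicator \<Omega> z * (\<integral>\<^sup>+w. \<phi> (w - z) * indicator (- \<Omega>) w \<partial>lborel) \<partial>lborel)
    = (\<integral>\<^sup>+u. \<phi> u * emeasure lborel (\<Omega> - {x. x - (- u) \<in> \<Omega>}) \<partial>lborel)"
proof -
  have m: "(\<lambda>p. indicator \<Omega> (fst p) * (\<phi> (snd p) * indicator (- \<Omega>) (snd p + fst p))) \<in> borel_measurable (borel :: ('b \<times> 'b) measure)"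
    by measurable
  have "(\<integral>\<^sup>+z. indicator \<Omega> z * (\<integral>\<^sup>+w. \<phi> (w - z) * indicator (- \<Omega>) w \<partial>lborel) \<partial>lborel)
    = (\<integral>\<^sup>+z. \<integral>\<^sup>+u. indicator \<Omega> z * (\<phi> u * indicator (- \<Omega>) (u + z)) \<partial>lborel \<partial>lborel)"
  proof (rule nn_integral_cong)
    fix z :: 'b
    have "(\<integral>\<^sup>+w. \<phi> (w - z) * indicator (- \<Omega>) w \<partial>lborel) = (\<integral>\<^sup>+u. \<phi> u * indicator (- \<Omega>) (u + z) \<partial>lborel)"
      using nn_integral_translate[of "\<lambda>u. \<phi> u * indicator (- \<Omega>) (u + z)" z] by simp
    then show "indicator \<Omega> z * (\<integral>\<^sup>+w. \<phi> (w - z) * indicator (- \<Omega>) w \<partial>lborel)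
      = (\<integral>\<^sup>+u. indicator \<Omega> z * (\<phi> u * indicator (- \<Omega>) (u + z)) \<partial>lborel)"
      by (simp add: nn_integral_cmult)
  qed
  also have "\<dots> = (\<integral>\<^sup>+u. \<integral>\<^sup>+z. indicator \<Omega> z * (\<phi> u * indicator (- \<Omega>) (u + z)) \<partial>lborel \<partial>lborel)"
    using lborel_Tonelli[OF m] by simp
  also have "\<dots> = (\<integral>\<^sup>+u. \<phi> u * emeasure lborel (\<Omega> - {x. x - (- u) \<in> \<Omega>}) \<partial>lborel)"
  proof (rule nn_integral_cong)
    fix u :: 'b
    have "(\<integral>\<^sup>+z. indicator \<Omega> z * (\<phi> u * indicator (- \<Omega>) (u + z)) \<partial>lborel) = (\<integral>\<^sup>+z. \<phi> u * indicator (\<Omega> - {x. x - (- u) \<in> \<Omega>}) z \<partial>lborel)"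
      by (intro nn_integral_cong) (auto simp: indicator_def add.commute)
    also have "\<dots> = \<phi> u * emeasure lborel (\<Omega> - {x. x - (- u) \<in> \<Omega>})"
      by (rule nn_integral_cmult_indicator) measurable
    finally show "(\<integral>\<^sup>+z. indicator \<Omega> z * (\<phi> u * indicator (- \<Omega>) (u + z)) \<partial>lborel) = \<phi> u * emeasure lborel (\<Omega> - {x. x - (- u) \<in> \<Omega>})" .
  qed
  finally show ?thesis .
qed

lemma emeasure_diff_translate_le:
  fixes \<Omega> :: "'b::euclidean_space set"
  assumes \<Omega>: "compact \<Omega>" "finite_perimeter \<Omega>"
  shows "emeasure lborel (\<Omega> - {x. x - (- u) \<in> \<Omega>}) \<le> ennreal (norm u) * ennreal (perimeter \<Omega>)"
proof -
  have [measurable]: "\<Omega> \<in> sets borel" using \<Omega> by (simp add: borel_compact)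
  have "emeasure lborel (\<Omega> - {x. x - (- u) \<in> \<Omega>}) \<le> emeasure lborel \<Omega>"
    by (intro emeasure_mono) auto
  also have "\<dots> < \<infinity>" using emeasure_compact_finite[OF \<Omega>(1)] .
  finally have "emeasure lborel (\<Omega> - {x. x - (- u) \<in> \<Omega>}) = ennreal (measure lborel (\<Omega> - {x. x - (- u) \<in> \<Omega>}))"
    by (intro emeasure_eq_ennreal_measure) auto
  then show ?thesis
    using measure_diff_translate_le[OF \<Omega>, of "- u"] perimeter_nonneg[OF \<Omega>(2)]
    by (simp add: ennreal_mult[symmetric] ennreal_leI)
qed

section \<open>Min-max bound, trace and energy concentration\<close>

locale tf_eigensystem = tf_localization g \<Omega>
  for g :: "'a::euclidean_space \<Rightarrow> complex" and \<Omega> +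
  fixes I :: "nat set" and lam :: "nat \<Rightarrow> real" and h :: "nat \<Rightarrow> 'a \<Rightarrow> complex"
  assumes I: "I = {1..} \<or> (\<exists>N. I = {1..N})"
    and lam_nz: "k \<in> I \<Longrightarrow> lam k \<noteq> 0"
    and lam_mono: "j \<in> I \<Longrightarrow> k \<in> I \<Longrightarrow> j \<le> k \<Longrightarrow> lam k \<le> lam j"
    and h: "k \<in> I \<Longrightarrow> h k \<in> L2B"
    and orth: "j \<in> I \<Longrightarrow> k \<in> I \<Longrightarrow> ip (h j) (h k) = (if j = k then 1 else 0)"
    and eigen: "k \<in> I \<Longrightarrow> AE t in lborel. H (h k) t = of_real (lam k) * h k t"
    and complete: "\<mu> \<noteq> 0 \<Longrightarrow> y \<in> L2B \<Longrightarrow> AE t in lborel. H y t = of_real \<mu> * y t \<Longrightarrow>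
      \<exists>F c. finite F \<and> F \<subseteq> {k \<in> I. lam k = \<mu>} \<and> (AE t in lborel. y t = (\<Sum>k\<in>F. c k * h k t))"
begin

lemma L2_sq_h: "k \<in> I \<Longrightarrow> nsq (h k) = 1"
  using orth[of k k] L2_ip_self[of lborel "h k"] by (metis of_real_1 of_real_eq_iff)

text \<open>Double orthogonality: by the eigenvalue equation, the transforms of the
  \<open>h k\<close> are orthogonal over \<Omega> as well as over all of phase space.\<close>

lemma L2_ip_W_h:
  assumes k: "k \<in> I" and f: "f \<in> L2B"
  shows "L2_ip W (V (h k)) (V f) = of_real (lam k) * ip (h k) f"
proof -
  have "L2_ip W (V (h k)) (V f) = ip (H (h k)) f" by (simp add: L2_ip_H h k f)
  also have "\<dots> = ip (\<lambda>t. of_real (lam k) * h k t) f"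
    by (rule L2_ip_cong_AE) (use eigen[OF k] L2_of_H[OF h[OF k]] h[OF k] f in \<open>auto simp: L2_of_def\<close>)
  finally show ?thesis by (simp add: L2_ip_cmult_left)
qed

lemma L2_sq_W_h: "k \<in> I \<Longrightarrow> L2_sq W (V (h k)) = lam k"
  using L2_ip_W_h[of k "h k"] h[of k] L2_ip_self[of W "V (h k)"] orth[of k k] by (simp del: of_real_eq_iff flip: of_real_eq_iff[where 'a=complex])

lemma lam_range: "k \<in> I \<Longrightarrow> 0 < lam k \<and> lam k \<le> 1"
  using L2_sq_W_h[of k] L2_of_W_V(2)[OF h[of k]] L2_sq_h[of k] lam_nz[of k] L2_sq_nonneg[of W "V (h k)"] by fastforce

text \<open>Otherwise \<open>max_eigenfunction\<close> yields an eigenfunction orthogonal to the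
  first \<open>N\<close> with eigenvalue above \<open>\<mu>\<close>. By completeness it combines
  listed functions of that eigenvalue, all of index at most \<open>N\<close>, hence is orthogonal to
  itself. A free \<open>\<mu>\<close> covers both \<open>lam N\<close> and, for a list ending at
  \<open>N\<close>, the value 0.\<close>

lemma L2_sq_W_V_le:
  assumes N: "{1..N} \<subseteq> I" and \<mu>: "0 \<le> \<mu>" "\<And>k. k \<in> I \<Longrightarrow> N < k \<Longrightarrow> lam k \<le> \<mu>"
    and f: "f \<in> L2B" "\<And>k. k \<in> {1..N} \<Longrightarrow> ip f (h k) = 0"
  shows "L2_sq W (V f) \<le> \<mu> * nsq f"
proof (rule ccontr)
  assume "\<not> L2_sq W (V f) \<le> \<mu> * nsq f"
  then have lt: "\<mu> * nsq f < L2_sq W (V f)" by simp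
  obtain y M where y: "y \<in> L2B" "nsq y > 0" "\<forall>k\<in>{1..N}. ip y (h k) = 0" "\<mu> < M"
      "AE t in lborel. H y t = of_real M * y t"
    using max_eigenfunction[of "{1..N}" h lam f \<mu>] N h eigen f \<mu>(1) lt by blast
  have "M \<noteq> 0" using y(4) \<mu>(1) by simp
  from complete[OF this y(1,5)] obtain F c where F: "finite F" "F \<subseteq> {k \<in> I. lam k = M}"
      "AE t in lborel. y t = (\<Sum>k\<in>F. c k * h k t)" by blast
  have F1: "k \<in> {1..N}" if "k \<in> F" for k
  proof -
    have "k \<in> I" "lam k = M" using F(2) that by auto
    moreover have "1 \<le> k" using I \<open>k \<in> I\<close> by auto
    ultimately show ?thesis using \<mu>(2)[of k] y(4) by (cases "N < k") auto
  qed
  have hF: "h k \<in> L2B" if "k \<in> F" for k using F(2) h that by auto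
  have sm: "(\<lambda>t. \<Sum>k\<in>F. c k * h k t) \<in> L2B"
    by (intro L2_of_sum L2_of_cmult hF)
  have "ip y y = ip (\<lambda>t. \<Sum>k\<in>F. c k * h k t) y"
    by (rule L2_ip_cong_AE) (use F(3) y(1) sm in \<open>auto simp: L2_of_def\<close>)
  also have "\<dots> = (\<Sum>k\<in>F. ip (\<lambda>t. c k * h k t) y)"
    by (intro L2_ip_sum_left L2_of_cmult hF y)
  also have "\<dots> = 0"
  proof (rule sum.neutral, rule ballI)
    fix k assume "k \<in> F"
    then have "ip y (h k) = 0" using y(3) F1 by auto
    then have "ip (h k) y = 0" using L2_ip_cnj[of lborel y "h k"] by simp
    then show "ip (\<lambda>t. c k * h k t) y = 0" by (simp add: L2_ip_cmult_left)
  qed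
  finally show False using y(2) by (simp add: L2_ip_self)
qed

definition \<rho> :: "nat \<Rightarrow> 'a \<times> 'a \<Rightarrow> real" where
  "\<rho> N z = (\<Sum>k=1..N. (cmod (V (h k) z))\<^sup>2)"

text \<open>The quadratic form of \<open>H\<close> at \<open>tf_shift g z\<close>, that is, the part
  inside \<Omega> of the energy |V g|^2 centred at \<open>z\<close>.\<close>

definition Q :: "'a \<times> 'a \<Rightarrow> real" where
  "Q z = L2_sq W (V (tf_shift g z))"

lemma h_measurable [measurable]: "k \<in> I \<Longrightarrow> h k \<in> borel_measurable borel"
  using h[of k] by (simp add: L2_of_def)

text \<open>Split the shifted window along the first \<open>N\<close> eigenfunctions. The remainder
  \<open>u\<close> has squared norm \<open>1 - \<rho> N z\<close>, double orthogonality makes the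
  form additive over the pieces, and the min-max bound controls \<open>u\<close>.\<close>

lemma
  assumes N: "{1..N} \<subseteq> I" and \<mu>: "0 \<le> \<mu>" "\<And>k. k \<in> I \<Longrightarrow> N < k \<Longrightarrow> lam k \<le> \<mu>"
  shows Q_le: "Q z \<le> (\<Sum>k=1..N. lam k * (cmod (V (h k) z))\<^sup>2) + \<mu> * (1 - \<rho> N z)"
    and rho_le_1: "\<rho> N z \<le> 1"
proof -
  define f where "f = tf_shift g z"
  define c where "c = (\<lambda>k. ip f (h k))"
  define u where "u = (\<lambda>t. f t - (\<Sum>k=1..N. c k * h k t))"
  have f: "f \<in> L2B" "nsq f = 1" unfolding f_def by (simp_all add: L2_of_tf_shift L2_sq_tf_shift g g_norm)
  have hN: "h k \<in> L2B" if "k \<in> {1..N}" for k using h N that by auto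
  have s: "(\<lambda>t. \<Sum>k=1..N. c k * h k t) \<in> L2B" by (intro L2_of_sum L2_of_cmult hN)
  have u: "u \<in> L2B" unfolding u_def by (intro L2_of_diff f s)
  have c: "(cmod (c k))\<^sup>2 = (cmod (V (h k) z))\<^sup>2" for k
    unfolding c_def f_def V_def using L2_ip_cnj[of lborel "h k" "tf_shift g z"] by (metis complex_mod_cnj)
  have uh: "ip u (h k) = 0" if k: "k \<in> {1..N}" for k
  proof -
    have "ip u (h k) = c k - (\<Sum>j=1..N. ip (\<lambda>t. c j * h j t) (h k))"
      unfolding u_def c_def using k by (subst L2_ip_diff_left) (auto intro!: f s hN L2_ip_sum_left L2_of_cmult simp: c_def[symmetric])
    also have "(\<Sum>j=1..N. ip (\<lambda>t. c j * h j t) (h k)) = (\<Sum>j=1..N. if j = k then c j else 0)"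
      using N k by (intro sum.cong) (auto simp: L2_ip_cmult_left orth subset_iff)
    also have "\<dots> = c k" using k by simp
    finally show ?thesis by simp
  qed
  have fu: "f = (\<lambda>t. u t + (\<Sum>k=1..N. c k * h k t))" by (simp add: u_def)
  have "1 = nsq u + (\<Sum>k=1..N. (cmod (c k))\<^sup>2 * nsq (h k))"
    using L2_sq_add_orthogonal_sum[of "{1..N}" u lborel h c] u hN uh N f(2) orth fu by (auto simp: subset_iff)
  then have nu: "nsq u = 1 - \<rho> N z"
    using N by (simp add: c \<rho>_def L2_sq_h subset_iff)
  show "\<rho> N z \<le> 1" using nu L2_sq_nonneg[of lborel u] by simp
  have Vf: "V f = (\<lambda>w. V u w + (\<Sum>k=1..N. c k * V (h k) w))"
  proof
    fix w
    have "V u w = V f w - V (\<lambda>t. \<Sum>k=1..N. c k * h k t) w"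
      unfolding u_def by (rule V_diff[OF f(1) s])
    also have "V (\<lambda>t. \<Sum>k=1..N. c k * h k t) w = (\<Sum>k=1..N. V (\<lambda>t. c k * h k t) w)"
      by (intro V_sum L2_of_cmult hN)
    finally show "V f w = V u w + (\<Sum>k=1..N. c k * V (h k) w)" by (simp add: V_cmult)
  qed
  have "L2_ip W (V u) (V (h k)) = 0" if k: "k \<in> {1..N}" for k
  proof -
    have "L2_ip W (V (h k)) (V u) = of_real (lam k) * ip (h k) u"
      using N k u by (intro L2_ip_W_h) auto
    also have "ip (h k) u = 0" using uh[OF k] L2_ip_cnj[of lborel u "h k"] by simp
    finally show ?thesis using L2_ip_cnj[of W "V (h k)" "V u"] by simp
  qed
  moreover have "L2_ip W (V (h j)) (V (h k)) = 0" if "j \<in> {1..N}" "k \<in> {1..N}" "j \<noteq> k" for j k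
    using L2_ip_W_h[of j "h k"] N that hN orth[of j k] by (auto simp: subset_iff)
  ultimately have "L2_sq W (V f) = L2_sq W (V u) + (\<Sum>k=1..N. (cmod (c k))\<^sup>2 * L2_sq W (V (h k)))"
    unfolding Vf by (intro L2_sq_add_orthogonal_sum L2_of_W_V u hN) auto
  also have "(\<Sum>k=1..N. (cmod (c k))\<^sup>2 * L2_sq W (V (h k))) = (\<Sum>k=1..N. lam k * (cmod (V (h k) z))\<^sup>2)"
    using N by (intro sum.cong) (auto simp: c L2_sq_W_h subset_iff)
  also have "L2_sq W (V u) \<le> \<mu> * (1 - \<rho> N z)"
    unfolding nu[symmetric] by (rule L2_sq_W_V_le[OF N \<mu> u uh])
  finally show "Q z \<le> (\<Sum>k=1..N. lam k * (cmod (V (h k) z))\<^sup>2) + \<mu> * (1 - \<rho> N z)"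
    by (simp add: Q_def f_def)
qed

lemma Q_nonneg: "0 \<le> Q z" and Q_le_1: "Q z \<le> 1"
  unfolding Q_def using L2_sq_nonneg[of W] L2_of_W_V(2)[OF L2_of_tf_shift[OF g, of z]] by (simp_all add: L2_sq_tf_shift g g_norm)

lemma ennreal_Q: "ennreal (Q z) = (\<integral>\<^sup>+w. indicator \<Omega> w * ennreal ((cmod (V g (w - z)))\<^sup>2) \<partial>lborel)"
proof -
  have "ennreal (Q z) = (\<integral>\<^sup>+w. ennreal ((cmod (V (tf_shift g z) w))\<^sup>2) \<partial>W)"
    unfolding Q_def by (rule ennreal_L2_sq[symmetric]) (intro L2_of_W_V L2_of_tf_shift g)
  then show ?thesis unfolding cmod_V_tf_shift by (simp add: nn_integral_W)
qed

lemma Q_measurable [measurable]: "Q \<in> borel_measurable borel"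
proof -
  have "(\<lambda>z. ennreal (Q z)) \<in> borel_measurable borel" unfolding ennreal_Q by measurable
  then have "(\<lambda>z. enn2real (ennreal (Q z))) \<in> borel_measurable borel" by measurable
  then show ?thesis by (simp add: Q_nonneg)
qed

text \<open>This is the trace of \<open>H\<close>: each point of \<Omega> contributes the total mass
  1 of |V g|^2.\<close>

lemma nn_integral_Q: "(\<integral>\<^sup>+z. ennreal (Q z) \<partial>lborel) = ennreal (measure lborel \<Omega>)"
proof -
  have "(\<integral>\<^sup>+z. ennreal (Q z) \<partial>lborel) = (\<integral>\<^sup>+w. \<integral>\<^sup>+z. indicator \<Omega> w * ennreal ((cmod (V g (w - z)))\<^sup>2) \<partial>lborel \<partial>lborel)"
    unfolding ennreal_Q by (rule lborel_pair.Fubini') (simp add: case_prod_unfold)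
  also have "\<dots> = (\<integral>\<^sup>+w. indicator \<Omega> w \<partial>lborel)"
    using nn_integral_reflect[of "\<lambda>u. ennreal ((cmod (V g u))\<^sup>2)"] V_g_sq by (simp add: nn_integral_cmult)
  finally show ?thesis by (simp add: emeasure_\<Omega>)
qed

definition A :: nat where "A = nat \<lceil>measure lborel \<Omega>\<rceil>"

lemma A_bounds: "measure lborel \<Omega> \<le> real A" "real A \<le> measure lborel \<Omega> + 1"
proof -
  have "0 \<le> \<lceil>measure lborel \<Omega>\<rceil>" using measure_nonneg[of lborel \<Omega>] by linarith
  then have "real A = of_int \<lceil>measure lborel \<Omega>\<rceil>" by (simp add: A_def)
  then show "measure lborel \<Omega> \<le> real A" "real A \<le> measure lborel \<Omega> + 1"
    by linarith+
qed

text \<open>For a finite list the bound \<open>Q_le\<close> holds with remainder 0. Integrated over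
  phase space, it bounds the trace |\<Omega>| by a sum of \<open>N\<close> eigenvalues, each at most
  1.\<close>

lemma A_subset_I: "{1..A} \<subseteq> I"
proof (cases "I = {1..}")
  case False
  then obtain N where N: "I = {1..N}" using I by auto
  have Q_sum: "Q z \<le> (\<Sum>k=1..N. lam k * (cmod (V (h k) z))\<^sup>2)" for z
    using Q_le[of N 0 z] N by simp
  have "(\<integral>\<^sup>+z. ennreal (Q z) \<partial>lborel) \<le> (\<integral>\<^sup>+z. (\<Sum>k=1..N. ennreal (lam k * (cmod (V (h k) z))\<^sup>2)) \<partial>lborel)"
  proof (rule nn_integral_mono)
    fix z
    have "(\<Sum>k=1..N. ennreal (lam k * (cmod (V (h k) z))\<^sup>2)) = ennreal (\<Sum>k=1..N. lam k * (cmod (V (h k) z))\<^sup>2)"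
      using lam_range N by (intro sum_ennreal) (simp add: less_imp_le)
    then show "ennreal (Q z) \<le> (\<Sum>k=1..N. ennreal (lam k * (cmod (V (h k) z))\<^sup>2))"
      using Q_sum[of z] by (simp add: ennreal_leI)
  qed
  also have "\<dots> = (\<Sum>k=1..N. \<integral>\<^sup>+z. ennreal (lam k * (cmod (V (h k) z))\<^sup>2) \<partial>lborel)"
    using N by (intro nn_integral_sum) auto
  also have "\<dots> = (\<Sum>k=1..N. ennreal (lam k))"
  proof (intro sum.cong refl)
    fix k assume "k \<in> {1..N}"
    then have k: "k \<in> I" using N by simp
    have "(\<integral>\<^sup>+z. ennreal ((cmod (V (h k) z))\<^sup>2) \<partial>lborel) = 1"
      using ennreal_L2_sq[OF L2_of_V(1)[OF h[OF k]]] L2_of_V(2)[OF h[OF k]] L2_sq_h[OF k] by simp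
    then show "(\<integral>\<^sup>+z. ennreal (lam k * (cmod (V (h k) z))\<^sup>2) \<partial>lborel) = ennreal (lam k)"
      using lam_range[OF k] k by (simp add: ennreal_mult nn_integral_cmult)
  qed
  also have "\<dots> \<le> (\<Sum>k=1..N. ennreal 1)"
    using lam_range N by (intro sum_mono ennreal_leI) auto
  also have "\<dots> = ennreal (real N)" by (simp add: ennreal_of_nat_eq_real_of_nat)
  finally have "measure lborel \<Omega> \<le> real N" by (simp add: nn_integral_Q)
  then have "A \<le> N" unfolding A_def by (simp add: ceiling_le_iff)
  then show ?thesis using N by auto
qed auto

lemma integral_W_V_h: "k \<in> I \<Longrightarrow> integrable W (\<lambda>z. (cmod (V (h k) z))\<^sup>2) \<and> (\<integral>z. (cmod (V (h k) z))\<^sup>2 \<partial>W) = lam k"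
  using L2_sq_W_h[of k] L2_of_integrable[OF L2_of_W_V(1)[OF h]] by (simp add: L2_sq_def)

lemma integral_W_Q_le:
  assumes pos: "0 < measure lborel \<Omega>"
  shows "(\<integral>z. Q z \<partial>W) \<le> (\<Sum>k=1..A. lam k)"
proof -
  \<comment> \<open>Positive measure makes \<open>A\<close> at least 1, so \<open>lam A\<close> is a
    listed eigenvalue and can serve as the remainder bound.\<close>
  have A1: "1 \<le> A" using pos A_bounds(1) by (cases A) auto
  then have AI: "A \<in> I" using A_subset_I by auto
  define \<mu> where "\<mu> = lam A"
  define L where "L = (\<Sum>k=1..A. lam k)"
  have \<mu>: "0 \<le> \<mu>" "\<And>k. k \<in> I \<Longrightarrow> A < k \<Longrightarrow> lam k \<le> \<mu>"
    using lam_range[OF AI] lam_mono[OF AI] by (auto simp: \<mu>_def)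
  have \<mu>2: "\<mu> \<le> lam k" "lam k \<le> 1" if "k \<in> {1..A}" for k
    using lam_mono[of k A] AI A_subset_I that lam_range[of k] by (auto simp: \<mu>_def subset_iff)
  have ih: "integrable W (\<lambda>z. (cmod (V (h k) z))\<^sup>2)" "(\<integral>z. (cmod (V (h k) z))\<^sup>2 \<partial>W) = lam k" if "k \<in> {1..A}" for k
    using integral_W_V_h A_subset_I that by auto
  have i\<rho>: "integrable W (\<rho> A)" "(\<integral>z. \<rho> A z \<partial>W) = L"
    unfolding \<rho>_def[abs_def] L_def using ih by (auto simp: Bochner_Integration.integral_sum)
  have i2: "integrable W (\<lambda>z. \<Sum>k=1..A. lam k * (cmod (V (h k) z))\<^sup>2)"
    "(\<integral>z. (\<Sum>k=1..A. lam k * (cmod (V (h k) z))\<^sup>2) \<partial>W) = (\<Sum>k=1..A. lam k * lam k)"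
    using ih by (auto simp: Bochner_Integration.integral_sum)
  have "(\<integral>z. Q z \<partial>W) \<le> (\<integral>z. (\<Sum>k=1..A. lam k * (cmod (V (h k) z))\<^sup>2) + \<mu> * (1 - \<rho> A z) \<partial>W)"
  proof (rule integral_mono)
    show "integrable W Q"
      by (rule W.integrable_const_bound[where B=1]) (auto simp: Q_nonneg Q_le_1)
    show "integrable W (\<lambda>z. (\<Sum>k=1..A. lam k * (cmod (V (h k) z))\<^sup>2) + \<mu> * (1 - \<rho> A z))"
      using i2(1) i\<rho>(1) by (intro Bochner_Integration.integrable_add integrable_mult_right Bochner_Integration.integrable_diff) auto
  qed (rule Q_le[OF A_subset_I \<mu>])
  also have "\<dots> = (\<Sum>k=1..A. lam k * lam k) + \<mu> * (measure lborel \<Omega> - L)"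
    using i2 i\<rho> by (simp add: measure_W)
  also have "\<dots> \<le> L"
  proof -
    \<comment> \<open>With |\<Omega>| raised to \<open>A\<close>, the second factor is the sum of
      the \<open>A\<close> deficits \<open>1 - lam k\<close>. Each is non-negative, so its
      coefficient \<open>\<mu>\<close> may be raised to \<open>lam k\<close>, which cancels the
      squares.\<close>
    have "\<mu> * (measure lborel \<Omega> - L) \<le> \<mu> * (real A - L)"
      using \<mu>(1) A_bounds(1) by (intro mult_left_mono) auto
    also have "\<dots> = (\<Sum>k=1..A. \<mu> * (1 - lam k))"
      by (simp add: L_def sum_subtractf sum_distrib_left right_diff_distrib mult.commute)
    also have "\<dots> \<le> (\<Sum>k=1..A. lam k * (1 - lam k))"
      using \<mu>2 by (intro sum_mono mult_right_mono) auto
    also have "\<dots> = L - (\<Sum>k=1..A. lam k * lam k)"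
      by (simp add: L_def sum_subtractf right_diff_distrib)
    finally show ?thesis by simp
  qed
  finally show ?thesis by (simp add: L_def)
qed

text \<open>Of the unit mass of |V g|^2 centred at \<open>z\<close>, the part \<open>Q z\<close>
  lies in \<Omega> and the rest outside.\<close>

lemma nn_integral_one_minus_Q:
  "ennreal (\<integral>z. 1 - Q z \<partial>W) = (\<integral>\<^sup>+z. indicator \<Omega> z * (\<integral>\<^sup>+w. ennreal ((cmod (V g (w - z)))\<^sup>2) * indicator (- \<Omega>) w \<partial>lborel) \<partial>lborel)"
proof -
  have "ennreal (\<integral>z. 1 - Q z \<partial>W) = (\<integral>\<^sup>+z. ennreal (1 - Q z) \<partial>W)"
    by (rule nn_integral_eq_integral[symmetric])
      (auto simp: Q_le_1 Q_nonneg intro!: W.integrable_const_bound[where B=1])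
  also have "\<dots> = (\<integral>\<^sup>+z. indicator \<Omega> z * ennreal (1 - Q z) \<partial>lborel)"
    by (rule nn_integral_W) measurable
  also have "\<dots> = (\<integral>\<^sup>+z. indicator \<Omega> z * (\<integral>\<^sup>+w. ennreal ((cmod (V g (w - z)))\<^sup>2) * indicator (- \<Omega>) w \<partial>lborel) \<partial>lborel)"
  proof (intro nn_integral_cong arg_cong2[where f="(*)"] refl)
    fix z
    have "ennreal (Q z) + (\<integral>\<^sup>+w. ennreal ((cmod (V g (w - z)))\<^sup>2) * indicator (- \<Omega>) w \<partial>lborel)
      = (\<integral>\<^sup>+w. indicator \<Omega> w * ennreal ((cmod (V g (w - z)))\<^sup>2) + ennreal ((cmod (V g (w - z)))\<^sup>2) * indicator (- \<Omega>) w \<partial>lborel)"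
      unfolding ennreal_Q by (rule nn_integral_add[symmetric]) measurable
    also have "\<dots> = (\<integral>\<^sup>+w. ennreal ((cmod (V g (w - z)))\<^sup>2) \<partial>lborel)"
      by (intro nn_integral_cong) (auto simp: indicator_def)
    also have "\<dots> = 1"
      using nn_integral_translate[of "\<lambda>u. ennreal ((cmod (V g u))\<^sup>2)" z] V_g_sq by simp
    finally have "ennreal (Q z) + (\<integral>\<^sup>+w. ennreal ((cmod (V g (w - z)))\<^sup>2) * indicator (- \<Omega>) w \<partial>lborel) = 1" .
    then show "ennreal (1 - Q z) = (\<integral>\<^sup>+w. ennreal ((cmod (V g (w - z)))\<^sup>2) * indicator (- \<Omega>) w \<partial>lborel)"
      by (metis Q_nonneg ennreal_1 ennreal_add_diff_cancel_left ennreal_minus ennreal_neq_top)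
  qed
  finally show ?thesis .
qed

lemma nn_integral_rho_minus_indicator:
  "(\<integral>\<^sup>+z. ennreal \<bar>\<rho> A z - indicator \<Omega> z\<bar> \<partial>lborel) = ennreal (real A + measure lborel \<Omega> - 2 * (\<Sum>k=1..A. lam k))"
proof -
  have AI: "k \<in> I" if "k \<in> {1..A}" for k using A_subset_I that by auto
  have \<rho>: "0 \<le> \<rho> A z" "\<rho> A z \<le> 1" for z
    using rho_le_1[OF A_subset_I, of 1 z] lam_range by (auto simp: \<rho>_def intro: sum_nonneg)
  \<comment> \<open>Because \<open>\<rho>\<close> has values in [0, 1], membership in \<Omega>
    decides the sign of the difference, and the absolute value becomes linear in
    \<open>\<rho>\<close>.\<close>
  have abs: "\<bar>\<rho> A z - indicator \<Omega> z\<bar> = \<rho> A z + indicator \<Omega> z - 2 * (indicator \<Omega> z * \<rho> A z)" for z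
    using \<rho>[of z] by (auto simp: indicator_def)
  have ih: "integrable lborel (\<lambda>z. (cmod (V (h k) z))\<^sup>2)" "(LBINT z. (cmod (V (h k) z))\<^sup>2) = 1" if "k \<in> {1..A}" for k
    using L2_of_integrable[OF L2_of_V(1)[OF h[OF AI[OF that]]]] L2_of_V(2)[OF h[OF AI[OF that]]] L2_sq_h[OF AI[OF that]]
    by (auto simp: L2_sq_def)
  have i1: "integrable lborel (\<rho> A)" "(LBINT z. \<rho> A z) = real A"
    unfolding \<rho>_def[abs_def] using ih by (auto simp: Bochner_Integration.integral_sum)
  have [measurable]: "\<rho> A \<in> borel_measurable borel" using borel_measurable_integrable[OF i1(1)] by simp
  have i2: "integrable lborel (indicat_real \<Omega>)"
    using emeasure_compact_finite[OF \<Omega>] by (intro integrable_real_indicator) auto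
  have i3: "integrable lborel (\<lambda>z. indicator \<Omega> z * \<rho> A z)"
    using integrable_mult_indicator[of \<Omega> lborel "\<rho> A"] i1 by simp
  have "(LBINT z. indicator \<Omega> z * \<rho> A z) = (\<integral>z. \<rho> A z \<partial>W)"
    by (simp add: integral_W)
  also have "\<dots> = (\<Sum>k=1..A. lam k)"
    unfolding \<rho>_def[abs_def] using integral_W_V_h AI by (subst Bochner_Integration.integral_sum) auto
  finally have "(LBINT z. \<bar>\<rho> A z - indicator \<Omega> z\<bar>) = real A + measure lborel \<Omega> - 2 * (\<Sum>k=1..A. lam k)"
    unfolding abs using i1 i2 i3 by simp
  moreover have "(\<integral>\<^sup>+z. ennreal \<bar>\<rho> A z - indicator \<Omega> z\<bar> \<partial>lborel) = ennreal (LBINT z. \<bar>\<rho> A z - indicator \<Omega> z\<bar>)"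
    by (rule nn_integral_eq_integral) (use i1 i2 in auto)
  ultimately show ?thesis by simp
qed

text \<open>\<open>E\<close> is the mass that |V g|^2, centred at points of \<Omega>, leaks to the
  outside. Both upper bounds are recorded so that their product can be used; the 1 is the rounding
  error of \<open>A\<close>.\<close>

lemma accumulated_bound:
  assumes pos: "0 < measure lborel \<Omega>" and per: "finite_perimeter \<Omega>"
    and m: "integrable lborel (\<lambda>z. norm z * (cmod (V g z))\<^sup>2)"
  obtains E where "0 \<le> E" "E \<le> measure lborel \<Omega>"
    "E \<le> (LBINT z. norm z * (cmod (V g z))\<^sup>2) * perimeter \<Omega>"
    "(\<integral>\<^sup>+z. ennreal \<bar>\<rho> A z - indicator \<Omega> z\<bar> \<partial>lborel) \<le> ennreal (1 + 2 * E)"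
proof
  define E where "E = (\<integral>z. 1 - Q z \<partial>W)"
  have iQ: "integrable W Q"
    by (rule W.integrable_const_bound[where B=1]) (auto simp: Q_nonneg Q_le_1)
  have E: "E = measure lborel \<Omega> - (\<integral>z. Q z \<partial>W)"
    unfolding E_def using iQ by (simp add: measure_W)
  show "0 \<le> (\<integral>z. 1 - Q z \<partial>W)" by (intro Bochner_Integration.integral_nonneg) (simp add: Q_le_1)
  show "(\<integral>z. 1 - Q z \<partial>W) \<le> measure lborel \<Omega>"
    using E unfolding E_def by (simp add: Q_nonneg)
  have "ennreal E = (\<integral>\<^sup>+u. ennreal ((cmod (V g u))\<^sup>2) * emeasure lborel (\<Omega> - {x. x - (- u) \<in> \<Omega>}) \<partial>lborel)"
    unfolding E_def nn_integral_one_minus_Q by (rule nn_integral_outside) measurable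
  also have "\<dots> \<le> (\<integral>\<^sup>+u. ennreal (norm u * (cmod (V g u))\<^sup>2) * ennreal (perimeter \<Omega>) \<partial>lborel)"
  proof (rule nn_integral_mono)
    fix u
    have "ennreal ((cmod (V g u))\<^sup>2) * emeasure lborel (\<Omega> - {x. x - (- u) \<in> \<Omega>}) \<le> ennreal ((cmod (V g u))\<^sup>2) * (ennreal (norm u) * ennreal (perimeter \<Omega>))"
      by (intro mult_left_mono emeasure_diff_translate_le \<Omega> per) simp
    then show "ennreal ((cmod (V g u))\<^sup>2) * emeasure lborel (\<Omega> - {x. x - (- u) \<in> \<Omega>}) \<le> ennreal (norm u * (cmod (V g u))\<^sup>2) * ennreal (perimeter \<Omega>)"
      by (simp add: ennreal_mult mult_ac)
  qed
  also have "\<dots> = ennreal (LBINT z. norm z * (cmod (V g z))\<^sup>2) * ennreal (perimeter \<Omega>)"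
    using nn_integral_eq_integral[OF m] by (simp add: nn_integral_multc)
  also have "\<dots> = ennreal ((LBINT z. norm z * (cmod (V g z))\<^sup>2) * perimeter \<Omega>)"
    by (intro ennreal_mult[symmetric] perimeter_nonneg per Bochner_Integration.integral_nonneg) auto
  finally show "(\<integral>z. 1 - Q z \<partial>W) \<le> (LBINT z. norm z * (cmod (V g z))\<^sup>2) * perimeter \<Omega>"
    using perimeter_nonneg[OF per] unfolding E_def by (subst (asm) ennreal_le_iff) auto
  have "real A + measure lborel \<Omega> - 2 * (\<Sum>k=1..A. lam k) \<le> 1 + 2 * (\<integral>z. 1 - Q z \<partial>W)"
    using A_bounds(2) integral_W_Q_le[OF pos] E unfolding E_def by linarith
  then show "(\<integral>\<^sup>+z. ennreal \<bar>\<rho> A z - indicator \<Omega> z\<bar> \<partial>lborel) \<le> ennreal (1 + 2 * (\<integral>z. 1 - Q z \<partial>W))"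
    unfolding nn_integral_rho_minus_indicator by (rule ennreal_leI)
qed

end

section \<open>Lebesgue measurable representatives\<close>

text \<open>Completeness of the measure makes \<open>F\<close> measurable as soon as it agrees
  almost everywhere with a Borel function.\<close>

lemma integral_lebesgue_eq_AE:
  fixes F F' :: "'b::euclidean_space \<Rightarrow> 'c::euclidean_space"
  assumes "AE x in lborel. F x = F' x" and "F' \<in> borel_measurable borel"
  shows "integral\<^sup>L lebesgue F = integral\<^sup>L lborel F'"
proof -
  have ae: "AE x in lebesgue. F' x = F x" using AE_completion[OF assms(1)] by eventually_elim simp
  have F': "F' \<in> borel_measurable lebesgue" using assms(2) by (simp add: measurable_completion)
  have F: "F \<in> borel_measurable lebesgue" by (rule borel_measurable_AE[OF F' ae])
  have "integral\<^sup>L lebesgue F = integral\<^sup>L lebesgue F'"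
    using ae by (intro integral_cong_AE F F') auto
  also have "\<dots> = integral\<^sup>L lborel F'" by (rule integral_completion) (use assms(2) in simp)
  finally show ?thesis .
qed

lemma ex_borel_version:
  fixes f :: "'b::euclidean_space \<Rightarrow> complex"
  assumes "f \<in> borel_measurable lebesgue"
  shows "\<exists>f'\<in>borel_measurable borel. AE x in lborel. f x = f' x"
proof -
  obtain a where a [measurable]: "a \<in> borel_measurable borel" "AE x in lborel. Re (f x) = a x"
    using completion_ex_borel_measurable_real[of "\<lambda>x. Re (f x)" lborel] assms by auto
  obtain b where b [measurable]: "b \<in> borel_measurable borel" "AE x in lborel. Im (f x) = b x"
    using completion_ex_borel_measurable_real[of "\<lambda>x. Im (f x)" lborel] assms by auto
  have "(\<lambda>x. Complex (a x) (b x)) \<in> borel_measurable borel"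
    unfolding Complex_eq by measurable
  moreover have "AE x in lborel. f x = Complex (a x) (b x)"
    using a(2) b(2) by eventually_elim (simp add: complex_eq_iff)
  ultimately show ?thesis by (intro bexI[of _ "\<lambda>x. Complex (a x) (b x)"])
qed

lemma L2_ex_borel_version:
  fixes f :: "'b::euclidean_space \<Rightarrow> complex"
  assumes f: "f \<in> L2"
  shows "\<exists>f'\<in>L2B. AE x in lborel. f x = f' x"
proof -
  have fm: "f \<in> borel_measurable lebesgue" and fi: "integrable lebesgue (\<lambda>t. (cmod (f t))\<^sup>2)"
    using f by (auto simp: L2_def)
  obtain f' where f' [measurable]: "f' \<in> borel_measurable borel" and ae: "AE x in lborel. f x = f' x"
    using ex_borel_version[OF fm] by blast
  have "integrable lebesgue (\<lambda>t. (cmod (f' t))\<^sup>2)"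
    by (rule integrable_cong_AE_imp[OF fi]) (use AE_completion[OF ae] in \<open>auto intro!: measurable_completion elim: eventually_mono\<close>)
  then have "integrable lborel (\<lambda>t. (cmod (f' t))\<^sup>2)" by (subst (asm) integrable_completion) auto
  then show ?thesis using ae f' by (intro bexI[of _ f']) (auto simp: L2_of_def)
qed

lemma L2_of_lborel_L2: "f \<in> L2B \<Longrightarrow> f \<in> L2"
  by (auto simp: L2_of_def L2_def integrable_completion intro: measurable_completion)

text \<open>Null sets are translation invariant, and by Tonelli the cylinder over a reflected null
  set is null in phase space. The second form permits a change of window inside
  \<open>loc_op\<close> at any fixed \<open>t\<close>.\<close>

lemma
  fixes P :: "'a::euclidean_space \<Rightarrow> bool"
  assumes "AE x in lborel. P x"
  shows AE_lborel_translate: "AE x in lborel. P (x - h)"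
    and AE_lborel_reflect_fst: "AE z in (lborel :: ('a \<times> 'a) measure). P (t - fst z)"
proof -
  obtain N where N: "{x. \<not> P x} \<subseteq> N" "emeasure lborel N = 0" and Nb [measurable]: "N \<in> sets borel"
    using AE_E[OF assms] by auto
  have "{x. x - h \<in> N} \<in> null_sets lborel"
    by (rule null_setsI) (use emeasure_translate[OF Nb, of h] N in auto)
  then show "AE x in lborel. P (x - h)"
    by (rule AE_I') (use N(1) in auto)
  have "emeasure lborel {z::'a \<times> 'a. t - fst z \<in> N} = (\<integral>\<^sup>+z. indicator N (t - fst z) \<partial>(lborel :: ('a \<times> 'a) measure))"
  proof -
    have "(\<integral>\<^sup>+z. indicator N (t - fst z) \<partial>(lborel :: ('a \<times> 'a) measure)) = (\<integral>\<^sup>+z. indicator {z::'a \<times> 'a. t - fst z \<in> N} z \<partial>lborel)"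
      by (intro nn_integral_cong) (simp add: indicator_def)
    also have "\<dots> = emeasure lborel {z::'a \<times> 'a. t - fst z \<in> N}"
      by (rule nn_integral_indicator) measurable
    finally show ?thesis by simp
  qed
  also have "\<dots> = (\<integral>\<^sup>+y. \<integral>\<^sup>+x. indicator N (t - x) \<partial>(lborel :: 'a measure) \<partial>(lborel :: 'a measure))"
    by (subst lborel_Tonelli(2)) auto
  also have "(\<integral>\<^sup>+x. indicator N (t - x) \<partial>(lborel :: 'a measure)) = 0"
    using nn_integral_reflect[of "indicator N" t] N(2) by simp
  finally have "{z::'a \<times> 'a. t - fst z \<in> N} \<in> null_sets lborel"
    by (intro null_setsI) auto
  then show "AE z in (lborel :: ('a \<times> 'a) measure). P (t - fst z)"
    by (rule AE_I') (use N(1) in auto)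
qed

lemma L2_inner_eq_L2_ip:
  assumes "AE x in lborel. f x = f' x" "AE x in lborel. k x = k' x" "f' \<in> L2B" "k' \<in> L2B"
  shows "L2_inner f k = ip f' k'"
proof -
  have [measurable]: "f' \<in> borel_measurable borel" "k' \<in> borel_measurable borel"
    using assms by measurable
  show ?thesis unfolding L2_inner_def L2_ip_def
    by (rule integral_lebesgue_eq_AE) (use assms(1,2) in \<open>auto elim: eventually_elim2\<close>)
qed

text \<open>Null sets vanish in the integral defining the transform, so the equality holds at every
  \<open>z\<close>.\<close>

lemma stft_eq_L2_ip:
  assumes "AE x in lborel. f x = f' x" "AE x in lborel. g x = g' x" "f' \<in> L2B" "g' \<in> L2B"
  shows "stft g f z = ip f' (tf_shift g' z)"
proof -
  have [measurable]: "f' \<in> borel_measurable borel" "g' \<in> borel_measurable borel"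
    using assms by measurable
  obtain x \<xi> where z: "z = (x, \<xi>)" by force
  have "AE t in lborel. f t * cnj (g (t - x)) * cis (- 2 * pi * (\<xi> \<bullet> t)) = f' t * cnj (tf_shift g' z t)"
    using assms(1) AE_lborel_translate[OF assms(2), of x]
    by eventually_elim (simp add: tf_shift_def z cis_cnj mult_ac)
  then show ?thesis unfolding z stft_def L2_ip_def
    by (simp only: prod.case) (rule integral_lebesgue_eq_AE, auto simp: z)
qed

text \<open>A weak isoperimetric inequality. Around each point of \<Omega>, at least half of the
  chosen ball lies outside \<Omega>, while the translation estimate bounds the average loss by
  radius times perimeter. A radius linear in |\<Omega>| makes |\<Omega>| cancel.\<close>

lemma perimeter_lower_bound:
  "\<exists>c>0. \<forall>\<Omega>::'b::euclidean_space set. compact \<Omega> \<and> finite_perimeter \<Omega> \<and> 1 \<le> measure lborel \<Omega> \<longrightarrow> c \<le> perimeter \<Omega>"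
proof -
  define \<beta> where "\<beta> = unit_ball_vol (real DIM('b))"
  have \<beta>: "\<beta> > 0" unfolding \<beta>_def by simp
  \<comment> \<open>The value 2 / \<beta> yields \<beta> R \<ge> 2 m; the maximum with 1 yields R
    \<ge> 1, so that R to the power of the dimension is at least R.\<close>
  define c0 where "c0 = max 1 (2 / \<beta>)"
  have c0: "c0 \<ge> 1" "\<beta> * c0 \<ge> 2" using \<beta> by (auto simp: c0_def max_def field_simps)
  have "1 / (2 * c0) \<le> perimeter \<Omega>" if \<Omega>: "compact \<Omega>" "finite_perimeter \<Omega>" "1 \<le> measure lborel \<Omega>" for \<Omega> :: "'b set"
  proof -
    define m where "m = measure lborel \<Omega>"
    define R where "R = c0 * m"
    define B where "B = measure lborel (ball (0::'b) R)"
    have \<Omega>b [measurable]: "\<Omega> \<in> sets borel" using \<Omega> by (simp add: borel_compact)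
    have m1: "1 \<le> m" using \<Omega> by (simp add: m_def)
    have R1: "1 \<le> R" using c0(1) m1 mult_mono[of 1 c0 1 m] by (simp add: R_def)
    have em: "emeasure lborel \<Omega> = ennreal m"
      unfolding m_def using emeasure_compact_finite[OF \<Omega>(1)] by (simp add: emeasure_eq_ennreal_measure)
    have eB: "emeasure lborel (ball (z::'b) R) = ennreal B" for z
    proof -
      have "emeasure lborel (ball z R) = ennreal (\<beta> * R ^ DIM('b))" for z :: 'b
        unfolding \<beta>_def using R1 by (intro emeasure_ball) simp
      then show ?thesis unfolding B_def by (simp add: measure_def)
    qed
    have "2 * m \<le> B"
    proof -
      have "2 * m \<le> \<beta> * R" using c0(2) m1 mult_right_mono[OF c0(2), of m] by (simp add: R_def mult.assoc)
      also have "\<dots> \<le> \<beta> * R ^ DIM('b)"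
        using \<beta> R1 power_increasing[of 1 "DIM('b)" R] by (intro mult_left_mono) auto
      also have "\<dots> = B" unfolding B_def \<beta>_def using R1 by (subst content_ball) auto
      finally show ?thesis .
    qed
    have lower: "ennreal (B - m) \<le> (\<integral>\<^sup>+w. indicator (ball (0::'b) R) (w - z) * indicator (- \<Omega>) w \<partial>lborel)" for z
    proof -
      have "ennreal (B - m) = emeasure lborel (ball z R) - emeasure lborel \<Omega>"
        unfolding eB em using m1 by (simp add: ennreal_minus)
      also have "\<dots> \<le> emeasure lborel (ball z R - \<Omega>)"
      proof -
        have "emeasure lborel (ball z R) \<le> emeasure lborel ((ball z R - \<Omega>) \<union> \<Omega>)"
          by (intro emeasure_mono) auto
        also have "\<dots> \<le> emeasure lborel (ball z R - \<Omega>) + emeasure lborel \<Omega>"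
          by (intro emeasure_subadditive) auto
        finally show ?thesis by (simp add: em ennreal_minus_le_iff add.commute)
      qed
      also have "\<dots> = (\<integral>\<^sup>+w. indicator (ball z R - \<Omega>) w \<partial>lborel)" by simp
      also have "\<dots> = (\<integral>\<^sup>+w. indicator (ball (0::'b) R) (w - z) * indicator (- \<Omega>) w \<partial>lborel)"
        by (intro nn_integral_cong) (auto simp: indicator_def dist_norm norm_minus_commute)
      finally show ?thesis .
    qed
    have "ennreal (m * (B - m)) = (\<integral>\<^sup>+z. indicator \<Omega> z * ennreal (B - m) \<partial>lborel)"
      using m1 by (simp add: nn_integral_multc em ennreal_mult')
    also have "\<dots> \<le> (\<integral>\<^sup>+z. indicator \<Omega> z * (\<integral>\<^sup>+w. indicator (ball (0::'b) R) (w - z) * indicator (- \<Omega>) w \<partial>lborel) \<partial>lborel)"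
      by (intro nn_integral_mono mult_left_mono lower) simp
    also have "\<dots> = (\<integral>\<^sup>+u. indicator (ball (0::'b) R) u * emeasure lborel (\<Omega> - {x. x - (- u) \<in> \<Omega>}) \<partial>lborel)"
      by (rule nn_integral_outside[OF \<Omega>b]) (simp add: borel_measurable_indicator)
    also have "\<dots> \<le> (\<integral>\<^sup>+u. indicator (ball (0::'b) R) u * ennreal (R * perimeter \<Omega>) \<partial>lborel)"
    proof (rule nn_integral_mono)
      fix u :: 'b
      have "emeasure lborel (\<Omega> - {x. x - (- u) \<in> \<Omega>}) \<le> ennreal (R * perimeter \<Omega>)" if "u \<in> ball 0 R"
      proof -
        have "ennreal (norm u) * ennreal (perimeter \<Omega>) \<le> ennreal R * ennreal (perimeter \<Omega>)"
          using that by (intro mult_right_mono ennreal_leI) auto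
        then show ?thesis
          using emeasure_diff_translate_le[OF \<Omega>(1,2), of u] R1 perimeter_nonneg[OF \<Omega>(2)]
          by (simp add: ennreal_mult)
      qed
      then show "indicator (ball 0 R) u * emeasure lborel (\<Omega> - {x. x - (- u) \<in> \<Omega>}) \<le> indicator (ball 0 R) u * ennreal (R * perimeter \<Omega>)"
        by (simp add: indicator_def)
    qed
    also have "\<dots> = ennreal B * ennreal (R * perimeter \<Omega>)"
      using eB[of 0] by (subst nn_integral_multc) (simp_all add: borel_measurable_indicator)
    also have "\<dots> = ennreal (B * (R * perimeter \<Omega>))"
      using \<open>2 * m \<le> B\<close> m1 by (simp add: ennreal_mult')
    finally have "m * (B - m) \<le> B * (R * perimeter \<Omega>)"
      using perimeter_nonneg[OF \<Omega>(2)] R1 \<open>2 * m \<le> B\<close> m1 by (subst (asm) ennreal_le_iff) auto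
    \<comment> \<open>As B - m \<ge> B / 2, the factor \<open>m * B\<close> can be cancelled at the
      end, \<open>R\<close> being \<open>c0 * m\<close>.\<close>
    moreover have "m * (B / 2) \<le> m * (B - m)"
      using \<open>2 * m \<le> B\<close> m1 by (intro mult_left_mono) auto
    ultimately have "m * (B / 2) \<le> B * (R * perimeter \<Omega>)" by linarith
    then have "(m * B) * 1 \<le> 2 * (B * (R * perimeter \<Omega>))" by simp
    also have "\<dots> = (m * B) * (2 * c0 * perimeter \<Omega>)" by (simp add: R_def)
    finally have "(m * B) * 1 \<le> (m * B) * (2 * c0 * perimeter \<Omega>)" .
    moreover have "m * B > 0" using \<open>2 * m \<le> B\<close> m1 by simp
    ultimately have "1 \<le> 2 * c0 * perimeter \<Omega>" by (simp only: mult_le_cancel_left_pos)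
    then show ?thesis using c0(1) by (simp add: field_simps)
  qed
  then show ?thesis using c0(1) by (intro exI[of _ "1 / (2 * c0)"]) auto
qed

text \<open>Window and eigenfunctions are replaced by Borel representatives. Transforms are
  unaffected at every point, so the accumulated spectrogram itself stays the same function.\<close>

lemma spectrogram_L1_bound:
  fixes g :: "'a::euclidean_space \<Rightarrow> complex"
  assumes win: "g \<in> Mstar" "L2_norm g = 1"
    and dom: "compact \<Omega>" "finite_perimeter \<Omega>" "0 < measure lebesgue \<Omega>"
    and eig: "eigensystem g \<Omega> I lam h"
  obtains E where "0 \<le> E" "E \<le> measure lebesgue \<Omega>" "E \<le> (Mstar_norm g)\<^sup>2 * perimeter \<Omega>"
    "L1_norm (\<lambda>z. accumulated_spectrogram g \<Omega> h z - indicator \<Omega> z) \<le> ennreal (1 + 2 * E)"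
proof -
  have gL2: "g \<in> L2" using win by (simp add: Mstar_def)
  obtain g' where g': "g' \<in> L2B" and gg: "AE x in lborel. g x = g' x"
    using L2_ex_borel_version[OF gL2] by blast
  have g'm [measurable]: "g' \<in> borel_measurable borel" using g' by (simp add: L2_of_def)
  have hL2: "h k \<in> L2" if "k \<in> I" for k using eig that by (simp add: eigensystem_def)
  have "\<forall>k\<in>I. \<exists>f'. f' \<in> L2B \<and> (AE x in lborel. h k x = f' x)"
    using L2_ex_borel_version[OF hL2] by blast
  from bchoice[OF this] obtain h' where "\<forall>k\<in>I. h' k \<in> L2B \<and> (AE x in lborel. h k x = h' k x)" ..
  then have h': "\<And>k. k \<in> I \<Longrightarrow> h' k \<in> L2B" and hh: "\<And>k. k \<in> I \<Longrightarrow> AE x in lborel. h k x = h' k x"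
    by auto
  have norm_g': "nsq g' = 1"
  proof -
    have "AE x in lborel. (cmod (g x))\<^sup>2 = (cmod (g' x))\<^sup>2" using gg by eventually_elim simp
    then have "integral\<^sup>L lebesgue (\<lambda>x. (cmod (g x))\<^sup>2) = nsq g'"
      unfolding L2_sq_def by (rule integral_lebesgue_eq_AE) measurable
    then show ?thesis using win(2) unfolding L2_norm_def by simp
  qed
  interpret tf_localization g' \<Omega>
    by unfold_locales (use g' norm_g' dom in auto)
  have m_eq: "measure lebesgue \<Omega> = measure lborel \<Omega>" by (rule measure_completion) simp
  have stft_V: "stft g f z = V f' z" if "AE x in lborel. f x = f' x" "f' \<in> L2B" for f f' z
    unfolding V_def by (rule stft_eq_L2_ip[OF that(1) gg that(2) g'])
  \<comment> \<open>At each \<open>t\<close> the integrand changes at most where the window does at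
    \<open>t - fst z\<close>, a null set of phase space, so the two operators agree
    everywhere.\<close>
  have loc_H: "loc_op g \<Omega> f t = H f' t" if f: "AE x in lborel. f x = f' x" "f' \<in> L2B" for f f' t
  proof -
    have [measurable]: "f' \<in> borel_measurable borel" using f by (simp add: L2_of_def)
    have "loc_op g \<Omega> f t = integral\<^sup>L lebesgue (\<lambda>z. indicator \<Omega> z *\<^sub>R (stft g f z * g (t - fst z) * cis (2 * pi * (snd z \<bullet> t))))"
      unfolding loc_op_def set_lebesgue_integral_def by (simp add: case_prod_unfold)
    also have "\<dots> = integral\<^sup>L lborel (\<lambda>z. indicator \<Omega> z *\<^sub>R (V f' z * tf_shift g' z t))"
    proof (rule integral_lebesgue_eq_AE)
      show "AE z in lborel. indicator \<Omega> z *\<^sub>R (stft g f z * g (t - fst z) * cis (2 * pi * (snd z \<bullet> t))) = indicator \<Omega> z *\<^sub>R (V f' z * tf_shift g' z t)"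
        using AE_lborel_reflect_fst[OF gg, of t] by eventually_elim (simp add: stft_V[OF f] tf_shift_def)
    qed measurable
    also have "\<dots> = H f' t" unfolding H_def S_def by (rule integral_W[symmetric]) measurable
    finally show ?thesis .
  qed
  interpret tf_eigensystem g' \<Omega> I lam h'
  proof
    show "I = {1..} \<or> (\<exists>N. I = {1..N})" using eig by (simp add: eigensystem_def)
    show "lam k \<noteq> 0" if "k \<in> I" for k using eig that by (simp add: eigensystem_def)
    show "lam k \<le> lam j" if "j \<in> I" "k \<in> I" "j \<le> k" for j k using eig that by (simp add: eigensystem_def)
    show "h' k \<in> L2B" if "k \<in> I" for k by (rule h'[OF that])
    show "ip (h' j) (h' k) = (if j = k then 1 else 0)" if "j \<in> I" "k \<in> I" for j k
    proof -
      have "L2_inner (h j) (h k) = (if j = k then 1 else 0)" using eig that by (simp add: eigensystem_def)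
      then show ?thesis using L2_inner_eq_L2_ip[OF hh[OF that(1)] hh[OF that(2)] h'[OF that(1)] h'[OF that(2)]] by simp
    qed
    show "AE t in lborel. H (h' k) t = complex_of_real (lam k) * h' k t" if k: "k \<in> I" for k
    proof -
      have "AE t in lebesgue. loc_op g \<Omega> (h k) t = complex_of_real (lam k) * h k t"
        using eig k by (simp add: eigensystem_def)
      then have "AE t in lborel. loc_op g \<Omega> (h k) t = complex_of_real (lam k) * h k t"
        by (simp add: AE_completion_iff)
      then show ?thesis using hh[OF k] by eventually_elim (simp add: loc_H[OF hh[OF k] h'[OF k]])
    qed
    show "\<exists>F c. finite F \<and> F \<subseteq> {k \<in> I. lam k = \<mu>} \<and> (AE t in lborel. y t = (\<Sum>k\<in>F. c k * h' k t))"
      if \<mu>: "\<mu> \<noteq> 0" and y: "y \<in> L2B" and ev: "AE t in lborel. H y t = complex_of_real \<mu> * y t" for \<mu> y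
    proof -
      \<comment> \<open>A Borel function is its own representative, so the completeness of the given
        family applies to \<open>y\<close> directly.\<close>
      have "loc_op g \<Omega> y t = H y t" for t by (rule loc_H[OF _ y]) simp
      then have ae: "AE t in lebesgue. loc_op g \<Omega> y t = complex_of_real \<mu> * y t"
        using ev by (simp only: AE_completion_iff)
      have all: "\<forall>\<mu>::complex. \<forall>f\<in>L2. \<mu> \<noteq> 0 \<longrightarrow> (AE t in lebesgue. loc_op g \<Omega> f t = \<mu> * f t) \<longrightarrow>
          (\<exists>F c. finite F \<and> F \<subseteq> {k\<in>I. complex_of_real (lam k) = \<mu>} \<and> (AE t in lebesgue. f t = (\<Sum>k\<in>F. c k * h k t)))"
        using eig unfolding eigensystem_def by (elim conjE)
      have \<mu>': "complex_of_real \<mu> \<noteq> 0" using \<mu> by simp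
      from all[rule_format, OF L2_of_lborel_L2[OF y] \<mu>' ae]
      obtain F c where F: "finite F" "F \<subseteq> {k \<in> I. complex_of_real (lam k) = complex_of_real \<mu>}"
        and yF: "AE t in lebesgue. y t = (\<Sum>k\<in>F. c k * h k t)"
        by (elim exE conjE)
      have "AE t in lborel. \<forall>k\<in>F. h k t = h' k t"
        using F hh by (subst AE_finite_all) (auto simp: subset_iff)
      moreover have "AE t in lborel. y t = (\<Sum>k\<in>F. c k * h k t)" using yF by (simp add: AE_completion_iff)
      ultimately have "AE t in lborel. y t = (\<Sum>k\<in>F. c k * h' k t)"
        by eventually_elim simp
      then show ?thesis using F by auto
    qed
  qed
  \<comment> \<open>All indices up to \<open>A\<close> lie in \<open>I\<close>, where the
    representatives \<open>h'\<close> are available.\<close>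
  have spec: "accumulated_spectrogram g \<Omega> h z = \<rho> A z" for z
    unfolding accumulated_spectrogram_def \<rho>_def A_def[symmetric] m_eq
    using A_subset_I by (intro sum.cong) (auto simp: stft_V[OF hh h'] subset_iff)
  have L1: "L1_norm (\<lambda>z. accumulated_spectrogram g \<Omega> h z - indicator \<Omega> z) = (\<integral>\<^sup>+z. ennreal \<bar>\<rho> A z - indicator \<Omega> z\<bar> \<partial>lborel)"
    unfolding L1_norm_def spec by (rule nn_integral_completion)
  have mg: "(\<lambda>z. norm z * (cmod (stft g g z))\<^sup>2) = (\<lambda>z. norm z * (cmod (V g' z))\<^sup>2)"
    by (simp add: stft_V[OF gg g'])
  have mm: "(\<lambda>z. norm z * (cmod (V g' z))\<^sup>2) \<in> borel_measurable lborel"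
    using V_measurable[OF g'm] by simp
  have mint: "integrable lborel (\<lambda>z. norm z * (cmod (V g' z))\<^sup>2)"
  proof -
    have "integrable lebesgue (\<lambda>z. norm z * (cmod (V g' z))\<^sup>2)"
      using win(1) unfolding Mstar_def mem_Collect_eq mg by (rule conjunct2)
    then show ?thesis by (subst (asm) integrable_completion[OF mm])
  qed
  have mnorm: "(Mstar_norm g)\<^sup>2 = (LBINT z. norm z * (cmod (V g' z))\<^sup>2)"
  proof -
    have "integral\<^sup>L lebesgue (\<lambda>z. norm z * (cmod (V g' z))\<^sup>2) = (LBINT z. norm z * (cmod (V g' z))\<^sup>2)"
      by (rule integral_completion[OF mm])
    moreover have "0 \<le> (LBINT z. norm z * (cmod (V g' z))\<^sup>2)"
      by (intro Bochner_Integration.integral_nonneg) simp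
    ultimately show ?thesis unfolding Mstar_norm_def mg by (simp only: real_sqrt_pow2)
  qed
  have pos: "0 < measure lborel \<Omega>" using dom(3) m_eq by simp
  obtain E where E: "0 \<le> E" "E \<le> measure lborel \<Omega>"
    "E \<le> (LBINT z. norm z * (cmod (V g' z))\<^sup>2) * perimeter \<Omega>"
    "(\<integral>\<^sup>+z. ennreal \<bar>\<rho> A z - indicator \<Omega> z\<bar> \<partial>lborel) \<le> ennreal (1 + 2 * E)"
    using accumulated_bound[OF pos dom(2) mint] .
  show ?thesis
    by (rule that[OF E(1)]; unfold m_eq mnorm L1; rule E)
qed

theorem corollary5p1:
  fixes g :: "'a::euclidean_space \<Rightarrow> complex"
  assumes "g \<in> Mstar" and "L2_norm g = 1"
  shows "(\<forall>(\<Omega> :: ('a \<times> 'a) set) I lam h.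
            compact \<Omega> \<and> finite_perimeter \<Omega> \<and> measure lebesgue \<Omega> > 0 \<and> eigensystem g \<Omega> I lam h \<longrightarrow>
            ennreal (1 / measure lebesgue \<Omega>) *
              L1_norm (\<lambda>z. accumulated_spectrogram g \<Omega> h z - indicator \<Omega> z)
            \<le> ennreal (1 / measure lebesgue \<Omega>
                + (Mstar_norm g)\<^sup>2 * (perimeter \<Omega> / measure lebesgue \<Omega>)
                + 4 * Mstar_norm g * sqrt (perimeter \<Omega> / measure lebesgue \<Omega>)))
       \<and> (\<exists>C>0. \<forall>(\<Omega> :: ('a \<times> 'a) set) I lam h.
            compact \<Omega> \<and> finite_perimeter \<Omega> \<and> measure lebesgue \<Omega> \<ge> 1 \<and> eigensystem g \<Omega> I lam h \<longrightarrow>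
            ennreal (1 / measure lebesgue \<Omega>) *
              L1_norm (\<lambda>z. accumulated_spectrogram g \<Omega> h z - indicator \<Omega> z)
            \<le> ennreal (C * sqrt (perimeter \<Omega> / measure lebesgue \<Omega>)))"
proof -
  have M0: "0 \<le> Mstar_norm g" by (simp add: Mstar_norm_def)
  \<comment> \<open>This is sharper than the first claim, with 2 in place of 4 and no quadratic
    term; both claims are deduced from it.\<close>
  have bound: "ennreal (1 / measure lebesgue \<Omega>) * L1_norm (\<lambda>z. accumulated_spectrogram g \<Omega> h z - indicator \<Omega> z)
      \<le> ennreal (1 / measure lebesgue \<Omega> + 2 * (Mstar_norm g * sqrt (perimeter \<Omega> / measure lebesgue \<Omega>)))"
    if \<Omega>: "compact \<Omega>" "finite_perimeter \<Omega>" "0 < measure lebesgue \<Omega>" and eig: "eigensystem g \<Omega> I lam h"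
    for \<Omega> :: "('a \<times> 'a) set" and I lam h
  proof -
    obtain E where E: "0 \<le> E" "E \<le> measure lebesgue \<Omega>" "E \<le> (Mstar_norm g)\<^sup>2 * perimeter \<Omega>"
        "L1_norm (\<lambda>z. accumulated_spectrogram g \<Omega> h z - indicator \<Omega> z) \<le> ennreal (1 + 2 * E)"
      using spectrogram_L1_bound[OF assms \<Omega> eig] .
    let ?m = "measure lebesgue \<Omega>" and ?p = "perimeter \<Omega>"
    have p0: "0 \<le> ?p" by (rule perimeter_nonneg[OF \<Omega>(2)])
    \<comment> \<open>The square of \<open>E\<close> is at most the product of its two upper
      bounds.\<close>
    have "E / ?m \<le> Mstar_norm g * sqrt (?p / ?m)"
    proof (rule power2_le_imp_le)
      have "E * E \<le> ((Mstar_norm g)\<^sup>2 * ?p) * ?m"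
        using E by (intro mult_mono) auto
      then have "E * E / (?m * ?m) \<le> ((Mstar_norm g)\<^sup>2 * ?p) * ?m / (?m * ?m)"
        using \<Omega>(3) by (intro divide_right_mono) auto
      then show "(E / ?m)\<^sup>2 \<le> (Mstar_norm g * sqrt (?p / ?m))\<^sup>2"
        using \<Omega>(3) p0 by (simp add: power_mult_distrib power_divide power2_eq_square[of E] power2_eq_square[of ?m])
    qed (use M0 p0 in auto)
    then have le: "(1 + 2 * E) / ?m \<le> 1 / ?m + 2 * (Mstar_norm g * sqrt (?p / ?m))"
      by (simp add: add_divide_distrib)
    have "ennreal (1 / ?m) * L1_norm (\<lambda>z. accumulated_spectrogram g \<Omega> h z - indicator \<Omega> z) \<le> ennreal (1 / ?m) * ennreal (1 + 2 * E)"
      by (intro mult_left_mono E) simp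
    also have "\<dots> = ennreal ((1 + 2 * E) / ?m)"
      using \<Omega>(3) E(1) by (subst ennreal_mult[symmetric]) auto
    also have "\<dots> \<le> ennreal (1 / ?m + 2 * (Mstar_norm g * sqrt (?p / ?m)))"
      by (intro ennreal_leI le)
    finally show ?thesis .
  qed
  obtain c where c: "c > 0" "\<And>\<Omega>::('a \<times> 'a) set. compact \<Omega> \<Longrightarrow> finite_perimeter \<Omega> \<Longrightarrow> 1 \<le> measure lborel \<Omega> \<Longrightarrow> c \<le> perimeter \<Omega>"
    using perimeter_lower_bound by blast
  show ?thesis
  proof (intro conjI allI impI; (elim conjE)?)
    fix \<Omega> :: "('a \<times> 'a) set" and I lam h
    assume \<Omega>: "compact \<Omega>" "finite_perimeter \<Omega>" "0 < measure lebesgue \<Omega>" "eigensystem g \<Omega> I lam h"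
    have p0: "0 \<le> perimeter \<Omega>" by (rule perimeter_nonneg[OF \<Omega>(2)])
    have "1 / measure lebesgue \<Omega> + 2 * (Mstar_norm g * sqrt (perimeter \<Omega> / measure lebesgue \<Omega>))
      \<le> 1 / measure lebesgue \<Omega> + (Mstar_norm g)\<^sup>2 * (perimeter \<Omega> / measure lebesgue \<Omega>)
          + 4 * Mstar_norm g * sqrt (perimeter \<Omega> / measure lebesgue \<Omega>)"
      using M0 p0 by (simp add: add_increasing)
    then show "ennreal (1 / measure lebesgue \<Omega>) * L1_norm (\<lambda>z. accumulated_spectrogram g \<Omega> h z - indicator \<Omega> z)
        \<le> ennreal (1 / measure lebesgue \<Omega> + (Mstar_norm g)\<^sup>2 * (perimeter \<Omega> / measure lebesgue \<Omega>)
          + 4 * Mstar_norm g * sqrt (perimeter \<Omega> / measure lebesgue \<Omega>))"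
      by (intro order_trans[OF bound[OF \<Omega>]] ennreal_leI)
  next
    \<comment> \<open>The witness adds the coefficient of \<open>bound\<close> to 1 / sqrt c. For
      |\<Omega>| \<ge> 1 the perimeter is at least c, and then sqrt c / |\<Omega>| is at most the
      square root of perimeter over |\<Omega>|, which absorbs 1 / |\<Omega>|.\<close>
    show "\<exists>C>0. \<forall>(\<Omega> :: ('a \<times> 'a) set) I lam h.
            compact \<Omega> \<and> finite_perimeter \<Omega> \<and> measure lebesgue \<Omega> \<ge> 1 \<and> eigensystem g \<Omega> I lam h \<longrightarrow>
            ennreal (1 / measure lebesgue \<Omega>) *
              L1_norm (\<lambda>z. accumulated_spectrogram g \<Omega> h z - indicator \<Omega> z)
            \<le> ennreal (C * sqrt (perimeter \<Omega> / measure lebesgue \<Omega>))"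
    proof (intro exI[of _ "1 / sqrt c + 2 * Mstar_norm g"] conjI allI impI; (elim conjE)?)
      show "0 < 1 / sqrt c + 2 * Mstar_norm g" using c(1) M0 by (simp add: add_pos_nonneg)
      fix \<Omega> :: "('a \<times> 'a) set" and I lam h
      assume \<Omega>: "compact \<Omega>" "finite_perimeter \<Omega>" "1 \<le> measure lebesgue \<Omega>" "eigensystem g \<Omega> I lam h"
      let ?m = "measure lebesgue \<Omega>" and ?p = "perimeter \<Omega>"
      have "?m = measure lborel \<Omega>" using \<Omega>(1) by (intro measure_completion) (simp add: borel_compact)
      then have cp: "c \<le> ?p" using c(2)[OF \<Omega>(1,2)] \<Omega>(3) by simp
      have "sqrt c / ?m \<le> sqrt (?p / ?m)"
      proof (rule real_le_rsqrt)
        have "(sqrt c / ?m)\<^sup>2 = c / (?m * ?m)" using c(1) by (simp add: power_divide power2_eq_square[of ?m])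
        also have "\<dots> \<le> ?p / ?m"
          using cp \<Omega>(3) c(1) by (intro frac_le) auto
        finally show "(sqrt c / ?m)\<^sup>2 \<le> ?p / ?m" .
      qed
      then have "1 / sqrt c * (sqrt c / ?m) \<le> 1 / sqrt c * sqrt (?p / ?m)"
        using c(1) by (intro mult_left_mono) auto
      then have "1 / ?m \<le> 1 / sqrt c * sqrt (?p / ?m)" using c(1) by simp
      then have "1 / ?m + 2 * (Mstar_norm g * sqrt (?p / ?m)) \<le> (1 / sqrt c + 2 * Mstar_norm g) * sqrt (?p / ?m)"
        by (simp add: distrib_right)
      then show "ennreal (1 / ?m) * L1_norm (\<lambda>z. accumulated_spectrogram g \<Omega> h z - indicator \<Omega> z)
          \<le> ennreal ((1 / sqrt c + 2 * Mstar_norm g) * sqrt (?p / ?m))"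
        using \<Omega>(3) by (intro order_trans[OF bound[OF \<Omega>(1,2) _ \<Omega>(4)]] ennreal_leI) auto
    qed
  qed
qed

end
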